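(* Let $\Omega\subset Q^\pi_m$ be generic, $\Lambda=\{(t,x_t):t\in\mathbb{R}_+,x\in\Omega\}$, and $F\in C^{1,2}(\Lambda)$. Then the functional $J:\Lambda\to\mathbb{R}$, $$J(t,x_t):=\int_0^t\nabla_xF(s,x_{s-})\,dx:=\lim_{n\to\infty}\sum_{\pi_n\ni t_i\le t}\nabla_xF(t_i,x^n_{t_i-})\cdot(x(t_{i+1})-x(t_i)),$$ is continuous with respect to the $\pi$-topology. In particular, $\nabla_xF$ is $\Lambda$-integrable and $J$ is its pathwise integral.
   Context: Partitions: $\pi=(\pi_n)_{n\ge1}$ is a fixed sequence of partitions $\pi_n=(0=t^n_0<\dots<t^n_{k_n}<\infty)$ of $[0,\infty)$ with $t^n_{k_n}\to\infty$ and mesh vanishing on compacts; the superscript $n$ is dropped and sums involving $t_{i+1}$ run over $i<k_n$. Paths: $D_m$ is the space of càdlàg functions $[0,\infty)\to\mathbb{R}^m$, $x(0-):=x(0)$, $\Delta x(t):=x(t)-x(t-)$; $x_t(s):=x(s\wedge t)$, $x_{t-}(s):=x(s)1_{s<t}+x(t-)1_{s\ge t}$. $x^n:=\sum_{t_i\in\pi_n}x(t_{i+1})1_{[t_i,t_{i+1})}$, and $x^n_t,x^n_{t-}$ are the stopped versions of $x^n$. $Q^\pi_m$ is the set of $x\in D_m$ for which $q_n(t):=\sum_{\pi_n\ni t_i\le t}(x(t_{i+1})-x(t_i))(x(t_{i+1})-x(t_i))'$ converges in the Skorokhod $J_1$ topology; the limit is $[x]$. Generic sets: a nonempty $\Omega\subset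 D_m$ is generic if (i) for every $x\in\Omega$, $T>0$ there is $N=N_T(x)$ with $x^n_T\in\Omega$ for all $n\ge N$; (ii) for every $x\in\Omega$, $t\ge0$ there is a convex neighbourhood $\mathcal{U}$ of $0$ in $\mathbb{R}^m$ with $-\Delta x(t)\in\mathcal{U}$ and $x_t+e1_{[t,\infty)}\in\Omega$ for all $e\in\mathcal{U}$. Consequently, at each $(t,x)$ one fixes a convex neighbourhood $\mathcal{U}_{t-}(x)$ of $0$ containing $\Delta x(t)$ with $x_{t-}+e1_{[t,\infty)}\in\Omega$ for all $e\in\mathcal{U}_{t-}(x)$. Continuity of functionals $F$ on $\Lambda$: let $t'_n:=\max\{t_i<t:t_i\in\pi_n\}$ (and $0$ if there is no such $t_i$). $F$ is left-continuous if for all $(t,x_t)\in\Lambda$ ($x\in\Omega$): 1(a) $\lim_{s\uparrow t,\,s\le t}F(s,x_{s-})=F(t,x_{t-})$; 1(b) $\lim_{s\uparrow t,\,s<t}F(s,x_s)=F(t,x_{t-})$; 1(c) $t_n\to t$, $t_n\le t'_n$ implies $F(t_n,x^n_{t_n-})\to F(t,x_{t-})$; 1(d) $t_n\to t$, $t_n<t'_n$ implies $F(t_n,x^n_{t_n})\to F(t,x_{t-})$. $F$ is right-continuous if for all such $(t,x_t)$: 2(a) $\lim_{s\downarrow t,\,s\ge t}F(s,x_s)=F(t,x_t)$; 2(b) $\lim_{s\downarrow t,\,s>t}F(s,x_{s-})=F(t,x_t)$; 2(c) $t_n\to t$, $t_n\ge t'_n$ implies $F(t_n,x^n_{t_n})\to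 F(t,x_t)$; 2(d) $t_n\to t$, $t_n>t'_n$ implies $F(t_n,x^n_{t_n-})\to F(t,x_t)$. The $\pi$-topology is the initial topology on $\Lambda$ generated by the real functionals satisfying all of 1 and 2; a functional is continuous for it iff it is both left- and right-continuous in this sense. Vector- and matrix-valued functionals: componentwise. Notation: $F_-(t,x_t):=F(t,x_{t-})$. Derivatives: $\mathcal{D}F(t,x_t):=\lim_{h\downarrow0}\frac{F(t+h,x_t)-F(t,x_t)}{h}$; $\nabla_xF(t,x_t)$ is the gradient at $e=0$ of $e\mapsto F(t,x_t+e1_{[t,\infty)})$; $\nabla_x^2F$ is the vertical derivative of $\nabla_xF$. $F$ is locally bounded if for every $x\in\Omega$, $T\ge0$ there is $n_0\ge N_T(x)$ such that the family $(t\mapsto F(t,x^n_t))_{n\ge n_0}$ is bounded on $[0,T]$ uniformly in $n\ge n_0$. $F$ admits a modulus of vertical continuity if for every $x\in\Omega$, $T\ge0$, $r>0$ there is an increasing $\omega:\mathbb{R}_+\to\mathbb{R}_+$ with $\omega(0+)=0$ and $|F(t,x^n_{t-}+a1_{[t,\infty)})-F(t,x^n_{t-}+b1_{[t,\infty)})|\le\omega(|a-b|)$ for all $a,b\in\mathcal{U}_{t-}(x^n)\cap\overline{B}_r(0)$, $t\le T$ and all sufficiently large $n$. $C^{1,2}(\Lambda)$: continuous $F:\Lambda\to\mathbb{R}$ such that $\mathcal{D}F,\nabla_xF,\nabla_x^2F$ exist on $\Lambda$; $\mathcal{D}F$ is right-continuous and locally bounded; $(\nabla_xF)_-$ is left-continuous;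 $(\nabla^2_xF)_-$ is left-continuous and locally bounded, and $\nabla_x^2F$ admits a modulus of vertical continuity. $\Lambda$-integrability: let $\phi:\Lambda\to\mathbb{R}^m$ with $\phi_-$ left-continuous, and for $x\in\Omega$ put $\mathbf{I}_\phi(t,x^n_t):=\sum_{\pi_n\ni t_i\le t}\phi(t_i,x^n_{t_i-})\cdot(x(t_{i+1})-x(t_i))$. $\phi$ is $\Lambda$-integrable if the limit $\mathbf{I}_\phi(t,x_t):=\lim_n\mathbf{I}_\phi(t,x^n_t)$ exists for each $(t,x_t)\in\Lambda$ and $\mathbf{I}_\phi:\Lambda\to\mathbb{R}$ is continuous; $\mathbf{I}_\phi$ is then the pathwise integral of $\phi$. *)

theory Defs
  imports "HOL-Analysis.Analysis"
begin

section \<open>Partitions\<close>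

text \<open>The \<open>n\<close>-th partition is the list \<open>[t\<^sub>0, \<dots>, t\<^sub>k]\<close> of its points, so that the index condition
  \<open>i < k\<close> reads \<open>Suc i < length (\<pi> n)\<close>.\<close>

type_synonym partitions = "nat \<Rightarrow> real list"

definition partition_sequence :: "partitions \<Rightarrow> bool" where
  "partition_sequence \<pi> \<longleftrightarrow>
     (\<forall>n. \<pi> n \<noteq> [] \<and> hd (\<pi> n) = 0 \<and> sorted_wrt (<) (\<pi> n)) \<and>
     filterlim (\<lambda>n. last (\<pi> n)) at_top sequentially \<and>
     (\<forall>T\<ge>0. \<forall>\<epsilon>>0. \<forall>\<^sub>F n in sequentially.
        \<forall>i. Suc i < length (\<pi> n) \<and> \<pi> n ! i \<le> T \<longrightarrow> \<pi> n ! Suc i - \<pi> n ! i < \<epsilon>)"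

definition pred_point :: "partitions \<Rightarrow> nat \<Rightarrow> real \<Rightarrow> real" where
  "pred_point \<pi> n t =
     (if \<exists>u\<in>set (\<pi> n). u < t then Max {u \<in> set (\<pi> n). u < t} else 0)"

section \<open>Paths\<close>

text \<open>A path on \<open>[0,\<infinity>)\<close> is represented by its extension by \<open>0\<close> to the negative half-line; every
  operation below respects this normalisation (for times \<open>t \<ge> 0\<close>), so equality of
  representatives is equality of paths. Only \<open>left_lim\<close> has to treat time \<open>0\<close> separately, because
  of the convention \<open>x(0-) = x(0)\<close>.\<close>

definition cadlag :: "(real \<Rightarrow> 'a::real_normed_vector) set" where
  "cadlag = {x. (\<forall>t<0. x t = 0) \<and>
                (\<forall>t\<ge>0. (x \<longlongrightarrow> x t) (at_right t)) \<and>
                (\<forall>t>0. \<exists>l. (x \<longlongrightarrow> l) (at_left t))}"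

definition left_lim :: "(real \<Rightarrow> 'a::real_normed_vector) \<Rightarrow> real \<Rightarrow> 'a" where
  "left_lim x t = (if t \<le> 0 then x 0 else Lim (at_left t) x)"

definition jump :: "(real \<Rightarrow> 'a::real_normed_vector) \<Rightarrow> real \<Rightarrow> 'a" where
  "jump x t = x t - left_lim x t"

definition stop :: "real \<Rightarrow> (real \<Rightarrow> 'a::real_normed_vector) \<Rightarrow> real \<Rightarrow> 'a" where
  "stop t x = (\<lambda>s. x (min s t))"

definition stop_left :: "real \<Rightarrow> (real \<Rightarrow> 'a::real_normed_vector) \<Rightarrow> real \<Rightarrow> 'a" where
  "stop_left t x = (\<lambda>s. if s < t then x s else left_lim x t)"

text \<open>\<open>bump t e x = x + e 1\<^bsub>[t,\<infinity>)\<^esub>\<close>\<close>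

definition bump :: "real \<Rightarrow> 'a::real_normed_vector \<Rightarrow> (real \<Rightarrow> 'a) \<Rightarrow> real \<Rightarrow> 'a" where
  "bump t e x = (\<lambda>s. x s + indicat_real {t..} s *\<^sub>R e)"

definition approx_path ::
    "partitions \<Rightarrow> nat \<Rightarrow> (real \<Rightarrow> 'a::real_normed_vector) \<Rightarrow> real \<Rightarrow> 'a" where
  "approx_path \<pi> n x =
     (\<lambda>s. \<Sum>i | Suc i < length (\<pi> n).
        indicat_real {\<pi> n ! i..<\<pi> n ! Suc i} s *\<^sub>R x (\<pi> n ! Suc i))"

section \<open>Quadratic variation\<close>

text \<open>Convergence in the Skorokhod \<open>J\<^sub>1\<close> topology on \<open>[0,\<infinity>)\<close>. An increasing bijection of \<open>[0,\<infinity>)\<close> is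
  automatically continuous and fixes \<open>0\<close>.\<close>

definition J1_converges ::
    "(nat \<Rightarrow> real \<Rightarrow> 'a::real_normed_vector) \<Rightarrow> (real \<Rightarrow> 'a) \<Rightarrow> bool" where
  "J1_converges q q' \<longleftrightarrow>
     (\<exists>\<theta> :: nat \<Rightarrow> real \<Rightarrow> real.
        (\<forall>n. strict_mono_on {0..} (\<theta> n) \<and> \<theta> n ` {0..} = {0..}) \<and>
        uniform_limit {0..} \<theta> (\<lambda>t. t) sequentially \<and>
        (\<forall>T\<ge>0. uniform_limit {0..T} (\<lambda>n t. q n (\<theta> n t)) q' sequentially))"

definition discrete_qv ::
    "partitions \<Rightarrow> nat \<Rightarrow> (real \<Rightarrow> real^'m) \<Rightarrow> real \<Rightarrow> real^'m^'m" where
  "discrete_qv \<pi> n x t =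
     (\<Sum>i | Suc i < length (\<pi> n) \<and> \<pi> n ! i \<le> t.
        (\<chi> a b. (x (\<pi> n ! Suc i) - x (\<pi> n ! i)) $ a * (x (\<pi> n ! Suc i) - x (\<pi> n ! i)) $ b))"

definition QV_paths :: "partitions \<Rightarrow> (real \<Rightarrow> real^'m) set" where
  "QV_paths \<pi> =
     {x \<in> cadlag. \<exists>q\<in>cadlag. J1_converges (\<lambda>n. discrete_qv \<pi> n x) q}"

section \<open>Generic sets\<close>

definition generic :: "partitions \<Rightarrow> (real \<Rightarrow> real^'m) set \<Rightarrow> bool" where
  "generic \<pi> \<Omega> \<longleftrightarrow>
     \<Omega> \<noteq> {} \<and> \<Omega> \<subseteq> cadlag \<and>
     (\<forall>x\<in>\<Omega>. \<forall>T>0. \<exists>N. \<forall>n\<ge>N. stop T (approx_path \<pi> n x) \<in> \<Omega>) \<and>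
     (\<forall>x\<in>\<Omega>. \<forall>t\<ge>0. \<exists>U. convex U \<and> 0 \<in> interior U \<and> - jump x t \<in> U \<and>
        (\<forall>e\<in>U. bump t e (stop t x) \<in> \<Omega>))"

text \<open>The fixed neighbourhoods \<open>\<U>\<^bsub>t-\<^esub>(x)\<close>. They are chosen at every \<open>(t,x)\<close> with \<open>x\<^sub>t \<in> \<Omega>\<close> rather than
  only for \<open>x \<in> \<Omega>\<close>, because they are also used at \<open>x\<^sup>n\<close>, for which only the stopped paths are
  known to belong to \<open>\<Omega>\<close>.\<close>

definition vertical_nbhds ::
    "(real \<Rightarrow> real^'m) set \<Rightarrow> (real \<Rightarrow> (real \<Rightarrow> real^'m) \<Rightarrow> (real^'m) set) \<Rightarrow> bool" where
  "vertical_nbhds \<Omega> U \<longleftrightarrow>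
     (\<forall>t\<ge>0. \<forall>x\<in>cadlag. stop t x \<in> \<Omega> \<longrightarrow>
        convex (U t x) \<and> 0 \<in> interior (U t x) \<and> jump x t \<in> U t x \<and>
        (\<forall>e\<in>U t x. bump t e (stop_left t x) \<in> \<Omega>))"

definition stopped_paths :: "(real \<Rightarrow> real^'m) set \<Rightarrow> (real \<times> (real \<Rightarrow> real^'m)) set" where
  "stopped_paths \<Omega> = {(t, stop t x) | t x. 0 \<le> t \<and> x \<in> \<Omega>}"

section \<open>Continuity of functionals\<close>

text \<open>A functional on \<open>\<Lambda> = stopped_paths \<Omega>\<close> is a total function of which only the values on \<open>\<Lambda>\<close>
  matter. In the conditions on sequences, the comparison with \<open>pred_point \<pi> n t\<close> is required
  only eventually: for small \<open>n\<close> one may have \<open>pred_point \<pi> n t = 0\<close>, so that no time is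
  strictly below it.\<close>

definition left_cont ::
    "partitions \<Rightarrow> (real \<Rightarrow> real^'m) set \<Rightarrow>
     (real \<times> (real \<Rightarrow> real^'m) \<Rightarrow> 'b::topological_space) \<Rightarrow> bool" where
  "left_cont \<pi> \<Omega> F \<longleftrightarrow>
     (\<forall>x\<in>\<Omega>. \<forall>t\<ge>0.
        ((\<lambda>s. F (s, stop_left s x)) \<longlongrightarrow> F (t, stop_left t x)) (at t within {0..t}) \<and>
        ((\<lambda>s. F (s, stop s x)) \<longlongrightarrow> F (t, stop_left t x)) (at t within {0..<t}) \<and>
        (\<forall>s. (\<forall>n. 0 \<le> s n) \<and> s \<longlonglongrightarrow> t \<and> (\<forall>\<^sub>F n in sequentially. s n \<le> pred_point \<pi> n t) \<longrightarrow>
           (\<lambda>n. F (s n, stop_left (s n) (approx_path \<pi> n x))) \<longlonglongrightarrow> F (t, stop_left t x)) \<and>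
        (\<forall>s. (\<forall>n. 0 \<le> s n) \<and> s \<longlonglongrightarrow> t \<and> (\<forall>\<^sub>F n in sequentially. s n < pred_point \<pi> n t) \<longrightarrow>
           (\<lambda>n. F (s n, stop (s n) (approx_path \<pi> n x))) \<longlonglongrightarrow> F (t, stop_left t x)))"

definition right_cont ::
    "partitions \<Rightarrow> (real \<Rightarrow> real^'m) set \<Rightarrow>
     (real \<times> (real \<Rightarrow> real^'m) \<Rightarrow> 'b::topological_space) \<Rightarrow> bool" where
  "right_cont \<pi> \<Omega> F \<longleftrightarrow>
     (\<forall>x\<in>\<Omega>. \<forall>t\<ge>0.
        ((\<lambda>s. F (s, stop s x)) \<longlongrightarrow> F (t, stop t x)) (at t within {t..}) \<and>
        ((\<lambda>s. F (s, stop_left s x)) \<longlongrightarrow> F (t, stop t x)) (at t within {t<..}) \<and>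
        (\<forall>s. (\<forall>n. 0 \<le> s n) \<and> s \<longlonglongrightarrow> t \<and> (\<forall>\<^sub>F n in sequentially. s n \<ge> pred_point \<pi> n t) \<longrightarrow>
           (\<lambda>n. F (s n, stop (s n) (approx_path \<pi> n x))) \<longlonglongrightarrow> F (t, stop t x)) \<and>
        (\<forall>s. (\<forall>n. 0 \<le> s n) \<and> s \<longlonglongrightarrow> t \<and> (\<forall>\<^sub>F n in sequentially. s n > pred_point \<pi> n t) \<longrightarrow>
           (\<lambda>n. F (s n, stop_left (s n) (approx_path \<pi> n x))) \<longlonglongrightarrow> F (t, stop t x)))"

definition pi_topology ::
    "partitions \<Rightarrow> (real \<Rightarrow> real^'m) set \<Rightarrow> (real \<times> (real \<Rightarrow> real^'m)) topology" where
  "pi_topology \<pi> \<Omega> = topology_generated_by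
     {{p \<in> stopped_paths \<Omega>. f p \<in> V} | (f :: real \<times> (real \<Rightarrow> real^'m) \<Rightarrow> real) V.
        left_cont \<pi> \<Omega> f \<and> right_cont \<pi> \<Omega> f \<and> open V}"

lemma topspace_pi_topology:
  fixes \<Omega> :: "(real \<Rightarrow> real^'m) set"
  shows "topspace (pi_topology \<pi> \<Omega>) = stopped_paths \<Omega>"
proof -
  let ?f = "\<lambda>_ :: real \<times> (real \<Rightarrow> real^'m). 0 :: real"
  have "left_cont \<pi> \<Omega> ?f" "right_cont \<pi> \<Omega> ?f"
    by (simp_all add: left_cont_def right_cont_def)
  then have "stopped_paths \<Omega> \<in> {{p \<in> stopped_paths \<Omega>. f p \<in> V} |
      (f :: real \<times> (real \<Rightarrow> real^'m) \<Rightarrow> real) V. left_cont \<pi> \<Omega> f \<and> right_cont \<pi> \<Omega> f \<and> open V}"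
    by (intro CollectI exI[of _ ?f] exI[of _ UNIV]) auto
  then show ?thesis
    unfolding pi_topology_def topology_generated_by_topspace by blast
qed

text \<open>\<open>F\<^sub>-\<close>\<close>

definition left_version ::
    "(real \<times> (real \<Rightarrow> real^'m) \<Rightarrow> 'b) \<Rightarrow> real \<times> (real \<Rightarrow> real^'m) \<Rightarrow> 'b" where
  "left_version F = (\<lambda>(t, y). F (t, stop_left t y))"

section \<open>Derivatives and regularity classes\<close>

definition horiz_differentiable ::
    "(real \<Rightarrow> real^'m) set \<Rightarrow> (real \<times> (real \<Rightarrow> real^'m) \<Rightarrow> real) \<Rightarrow> bool" where
  "horiz_differentiable \<Omega> F \<longleftrightarrow>
     (\<forall>(t, y)\<in>stopped_paths \<Omega>. \<exists>l. ((\<lambda>h. (F (t + h, y) - F (t, y)) / h) \<longlongrightarrow> l) (at_right 0))"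

definition horiz_deriv ::
    "(real \<times> (real \<Rightarrow> real^'m) \<Rightarrow> real) \<Rightarrow> real \<times> (real \<Rightarrow> real^'m) \<Rightarrow> real" where
  "horiz_deriv F = (\<lambda>(t, y). Lim (at_right 0) (\<lambda>h. (F (t + h, y) - F (t, y)) / h))"

definition vert_differentiable ::
    "(real \<Rightarrow> real^'m) set \<Rightarrow> (real \<times> (real \<Rightarrow> real^'m) \<Rightarrow> 'b::real_normed_vector) \<Rightarrow> bool" where
  "vert_differentiable \<Omega> F \<longleftrightarrow>
     (\<forall>(t, y)\<in>stopped_paths \<Omega>. (\<lambda>e. F (t, bump t e y)) differentiable (at 0))"

definition vert_grad ::
    "(real \<times> (real \<Rightarrow> real^'m) \<Rightarrow> real) \<Rightarrow> real \<times> (real \<Rightarrow> real^'m) \<Rightarrow> real^'m" where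
  "vert_grad F = (\<lambda>(t, y). THE g. GDERIV (\<lambda>e. F (t, bump t e y)) 0 :> g)"

definition vert_hess ::
    "(real \<times> (real \<Rightarrow> real^'m) \<Rightarrow> real) \<Rightarrow> real \<times> (real \<Rightarrow> real^'m) \<Rightarrow> real^'m^'m" where
  "vert_hess F = (\<lambda>(t, y). jacobian (\<lambda>e. vert_grad F (t, bump t e y)) (at 0))"

definition locally_bounded ::
    "partitions \<Rightarrow> (real \<Rightarrow> real^'m) set \<Rightarrow>
     (real \<times> (real \<Rightarrow> real^'m) \<Rightarrow> 'b::real_normed_vector) \<Rightarrow> bool" where
  "locally_bounded \<pi> \<Omega> F \<longleftrightarrow>
     (\<forall>x\<in>\<Omega>. \<forall>T\<ge>0. \<exists>n0. (\<forall>n\<ge>n0. stop T (approx_path \<pi> n x) \<in> \<Omega>) \<and>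
        (\<exists>C. \<forall>n\<ge>n0. \<forall>t\<in>{0..T}. norm (F (t, stop t (approx_path \<pi> n x))) \<le> C))"

definition vert_modulus ::
    "partitions \<Rightarrow> (real \<Rightarrow> real^'m) set \<Rightarrow>
     (real \<Rightarrow> (real \<Rightarrow> real^'m) \<Rightarrow> (real^'m) set) \<Rightarrow>
     (real \<times> (real \<Rightarrow> real^'m) \<Rightarrow> 'b::real_normed_vector) \<Rightarrow> bool" where
  "vert_modulus \<pi> \<Omega> U F \<longleftrightarrow>
     (\<forall>x\<in>\<Omega>. \<forall>T\<ge>0. \<forall>r>0. \<exists>\<omega> :: real \<Rightarrow> real.
        mono_on {0..} \<omega> \<and> (\<forall>u\<ge>0. 0 \<le> \<omega> u) \<and> (\<omega> \<longlongrightarrow> 0) (at_right 0) \<and>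
        (\<forall>\<^sub>F n in sequentially. \<forall>t\<in>{0..T}.
           \<forall>a\<in>U t (approx_path \<pi> n x) \<inter> cball 0 r. \<forall>b\<in>U t (approx_path \<pi> n x) \<inter> cball 0 r.
             norm (F (t, bump t a (stop_left t (approx_path \<pi> n x))) -
                   F (t, bump t b (stop_left t (approx_path \<pi> n x)))) \<le> \<omega> (norm (a - b))))"

definition C12 ::
    "partitions \<Rightarrow> (real \<Rightarrow> real^'m) set \<Rightarrow>
     (real \<Rightarrow> (real \<Rightarrow> real^'m) \<Rightarrow> (real^'m) set) \<Rightarrow>
     (real \<times> (real \<Rightarrow> real^'m) \<Rightarrow> real) set" where
  "C12 \<pi> \<Omega> U =
     {F. continuous_map (pi_topology \<pi> \<Omega>) euclideanreal F \<and>
         horiz_differentiable \<Omega> F \<and> vert_differentiable \<Omega> F \<and>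
         vert_differentiable \<Omega> (vert_grad F) \<and>
         right_cont \<pi> \<Omega> (horiz_deriv F) \<and> locally_bounded \<pi> \<Omega> (horiz_deriv F) \<and>
         left_cont \<pi> \<Omega> (left_version (vert_grad F)) \<and>
         left_cont \<pi> \<Omega> (left_version (vert_hess F)) \<and>
         locally_bounded \<pi> \<Omega> (left_version (vert_hess F)) \<and>
         vert_modulus \<pi> \<Omega> U (vert_hess F)}"

section \<open>Pathwise integration\<close>

definition integral_sum ::
    "partitions \<Rightarrow> (real \<times> (real \<Rightarrow> real^'m) \<Rightarrow> real^'m) \<Rightarrow> nat \<Rightarrow> real \<Rightarrow>
     (real \<Rightarrow> real^'m) \<Rightarrow> real" where
  "integral_sum \<pi> \<phi> n t x =
     (\<Sum>i | Suc i < length (\<pi> n) \<and> \<pi> n ! i \<le> t.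
        \<phi> (\<pi> n ! i, stop_left (\<pi> n ! i) (approx_path \<pi> n x)) \<bullet> (x (\<pi> n ! Suc i) - x (\<pi> n ! i)))"

definition pathwise_integral ::
    "partitions \<Rightarrow> (real \<times> (real \<Rightarrow> real^'m) \<Rightarrow> real^'m) \<Rightarrow>
     real \<times> (real \<Rightarrow> real^'m) \<Rightarrow> real" where
  "pathwise_integral \<pi> \<phi> = (\<lambda>(t, y). lim (\<lambda>n. integral_sum \<pi> \<phi> n t y))"

text \<open>The sums at time \<open>t\<close> may involve one value of \<open>x\<close> after \<open>t\<close>. The first clause of integrability
  therefore says that the sums along \<open>x\<close> converge and that their limit depends on the stopped
  path \<open>x\<^sub>t\<close> only, as it must for a functional on \<open>\<Lambda>\<close>.\<close>

definition path_integrable ::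
    "partitions \<Rightarrow> (real \<Rightarrow> real^'m) set \<Rightarrow>
     (real \<times> (real \<Rightarrow> real^'m) \<Rightarrow> real^'m) \<Rightarrow> bool" where
  "path_integrable \<pi> \<Omega> \<phi> \<longleftrightarrow>
     left_cont \<pi> \<Omega> (left_version \<phi>) \<and>
     (\<forall>x\<in>\<Omega>. \<forall>t\<ge>0.
        (\<lambda>n. integral_sum \<pi> \<phi> n t x) \<longlonglongrightarrow> pathwise_integral \<pi> \<phi> (t, stop t x)) \<and>
     continuous_map (pi_topology \<pi> \<Omega>) euclideanreal (pathwise_integral \<pi> \<phi>)"

end

theory Submission
  imports Defs
begin

text \<open>Expanding \<open>F(t\<^sub>i, x\<^sup>n\<^bsub>t\<^sub>i\<^esub>) - F(t\<^sub>i, x\<^sup>n\<^bsub>t\<^sub>i-\<^esub>)\<close> to second order in the jump of \<open>x\<^sup>n\<close> writes the Riemann sums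
  of \<open>\<nabla>\<^sub>xF\<close> as the increment of \<open>F\<close> along \<open>x\<^sup>n\<close>, minus the integral of \<open>\<D>F\<close>, minus second-order sums
  weighted by the squared increments of \<open>x\<close>. Every term converges along times \<open>s\<^sub>n \<rightarrow> t\<close>, with one limit
  if \<open>s\<^sub>n \<ge> t'\<^sub>n\<close> and another if \<open>s\<^sub>n < t'\<^sub>n\<close>: for the discrete quadratic variation this holds
  because \<open>J\<^sub>1\<close> convergence forces its large jumps to sit exactly at \<open>t'\<^sub>n\<close>, and it passes to the weighted
  sums after a change of variables to the inverse of the quadratic variation. These two limits are
  the values of the integral at \<open>x\<^sub>t\<close> and \<open>x\<^bsub>t-\<^esub>\<close>. Since its value at \<open>x\<^sup>n\<close> is, up to the vanishing first
  term, the Riemann sum itself, two-sided convergence of the Riemann sums is precisely continuity.\<close>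

section \<open>Functions with a right derivative\<close>

text \<open>The increment of \<open>x\<close> that carries the jump at \<open>t\<close> runs from
  \<open>pp n t\<close> to the next partition point, so the sums contain it exactly from time
  \<open>pp n t\<close> on. Integrator and weights may both jump at \<open>t\<close>, so weak
  convergence of the discrete quadratic variations alone would not determine the limit of the
  weighted sums. What decides it is that the atom at \<open>t\<close> sits exactly at
  \<open>pp n t\<close>, where the weights have a limit of their own. Passing to the inverse takes a
  nondecreasing integrator, so the entries of the quadratic variation are polarised into squares.
  The Taylor remainder is not a vanishing error, since it persists at the jumps of \<open>x\<close>;
  divided by the squared increment it becomes one more bounded weight, with limit 0 along points
  below \<open>pp n t\<close>. Index 0 is exceptional throughout: \<open>ap n x\<close> starts at
  the value of \<open>x\<close> at the second partition point and has no jump at time 0, whereas the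
  sums contain the increment from time 0.\<close>

lemma right_deriv_bound:
  fixes \<phi> g :: "real \<Rightarrow> real"
  assumes ab: "a \<le> b" and cont: "continuous_on {a..b} \<phi>"
    and deriv: "\<And>s. a \<le> s \<Longrightarrow> s < b \<Longrightarrow> ((\<lambda>h. (\<phi> (s + h) - \<phi> s) / h) \<longlongrightarrow> g s) (at_right 0)"
    and bound: "\<And>s. a \<le> s \<Longrightarrow> s < b \<Longrightarrow> \<bar>g s\<bar> \<le> C"
  shows "\<bar>\<phi> b - \<phi> a\<bar> \<le> C * (b - a)"
proof -
  have "\<bar>\<phi> b - \<phi> a\<bar> \<le> (C + e) * (b - a)" if e: "e > 0" for e
  proof (rule ccontr)
    assume neg: "\<not> ?thesis"
    \<comment> \<open>The last point \<open>s\<close> of \<open>S\<close> is where the bound with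
      slope \<open>C + e\<close> stops holding. The right difference quotient at \<open>s\<close> is
      still below \<open>C + e\<close>, so it carries the bound beyond \<open>s\<close>.\<close>
    define \<psi> where "\<psi> s = \<bar>\<phi> s - \<phi> a\<bar> - (C + e) * (s - a)" for s
    define S where "S = {s \<in> {a..b}. \<psi> s \<le> 0}"
    have contpsi: "continuous_on {a..b} \<psi>"
      unfolding \<psi>_def by (intro continuous_intros cont)
    have "closed S" unfolding S_def
      using continuous_on_closed_Collect_le[OF contpsi continuous_on_const closed_atLeastAtMost, of 0] by simp
    moreover have "bounded S" unfolding S_def by (rule bounded_subset[of "{a..b}"]) auto
    ultimately have "compact S" by (simp add: compact_eq_bounded_closed)
    moreover have "a \<in> S" using ab by (auto simp: S_def \<psi>_def)
    ultimately obtain s where s: "s \<in> S" "\<And>u. u \<in> S \<Longrightarrow> u \<le> s"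
      using compact_attains_sup[of S] by auto
    have "\<psi> b > 0" using neg by (simp add: \<psi>_def)
    then have sb: "a \<le> s" "s < b" using s(1) by (auto simp: S_def order_less_le)
    have "eventually (\<lambda>h. dist ((\<phi> (s + h) - \<phi> s) / h) (g s) < e) (at_right 0)"
      using deriv[OF sb] e by (simp add: tendsto_iff)
    then obtain d where d: "d > 0" "\<And>h. 0 < h \<Longrightarrow> h < d \<Longrightarrow> dist ((\<phi> (s + h) - \<phi> s) / h) (g s) < e"
      unfolding eventually_at_right_field by auto
    define h where "h = min (d / 2) (b - s)"
    have h: "0 < h" "h < d" "s + h \<le> b" using d sb by (auto simp: h_def)
    have "\<bar>(\<phi> (s + h) - \<phi> s) / h\<bar> \<le> C + e"
      using d(2)[OF h(1,2)] bound[OF sb] by (simp add: dist_real_def)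
    then have "\<bar>\<phi> (s + h) - \<phi> s\<bar> \<le> (C + e) * h"
      using h by (simp add: field_simps abs_divide)
    then have "\<psi> (s + h) \<le> \<psi> s" unfolding \<psi>_def by (simp add: algebra_simps)
    then have "s + h \<in> S" using s(1) h sb by (auto simp: S_def)
    then show False using s(2)[of "s + h"] h by simp
  qed
  then have "\<bar>\<phi> b - \<phi> a\<bar> \<le> C * (b - a) + e" if "e > 0" for e
  proof (cases "a = b")
    case False
    then have "e / (b - a) > 0" using ab that by simp
    moreover have "(C + e / (b - a)) * (b - a) = C * (b - a) + e"
      using False by (simp add: distrib_right)
    ultimately show ?thesis
      using \<open>\<And>e. e > 0 \<Longrightarrow> \<bar>\<phi> b - \<phi> a\<bar> \<le> (C + e) * (b - a)\<close>[of "e / (b - a)"] by simp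
  qed (use that in auto)
  then show ?thesis by (rule field_le_epsilon)
qed

lemma difference_quotient_seq:
  fixes f :: "real \<Rightarrow> real"
  assumes "((\<lambda>h. (f (s + h) - f s) / h) \<longlongrightarrow> l) (at_right 0)"
  shows "(\<lambda>k. real (Suc k) * (f (s + 1 / real (Suc k)) - f s)) \<longlonglongrightarrow> l"
proof -
  have "filterlim (\<lambda>k. 1 / real (Suc k)) (at_right 0) sequentially"
    unfolding filterlim_at
    using LIMSEQ_inverse_real_of_nat by (auto simp: inverse_eq_divide)
  from filterlim_compose[OF assms this] show ?thesis by (simp add: field_simps)
qed

text \<open>A bounded right derivative need not be continuous, so the usual fundamental theorem does
  not apply. Instead \<open>g\<close> is a dominated limit of difference quotients, and the integral
  of such a quotient over \<open>[0,t]\<close> is the mean of \<phi> just after \<open>t\<close>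
  minus its mean just after 0.\<close>

lemma integral_right_deriv:
  fixes \<phi> g :: "real \<Rightarrow> real"
  assumes t: "0 \<le> t" "t < T" and cont: "continuous_on {0..T} \<phi>"
    and deriv: "\<And>s. 0 \<le> s \<Longrightarrow> s < T \<Longrightarrow> ((\<lambda>h. (\<phi> (s + h) - \<phi> s) / h) \<longlongrightarrow> g s) (at_right 0)"
    and bound: "\<And>s. 0 \<le> s \<Longrightarrow> s < T \<Longrightarrow> \<bar>g s\<bar> \<le> C"
  shows "g integrable_on {0..t}" "integral {0..t} g = \<phi> t - \<phi> 0"
proof -
  have lip: "\<bar>\<phi> v - \<phi> u\<bar> \<le> C * (v - u)" if "0 \<le> u" "u \<le> v" "v \<le> T" for u v
    using that by (intro right_deriv_bound[where g = g] continuous_on_subset[OF cont] deriv bound) auto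
  \<comment> \<open>The first \<open>K\<close> step sizes are skipped so that \<open>t + h k\<close>
    never leaves \<open>[0,T]\<close>.\<close>
  define K where "K = nat \<lceil>1 / (T - t)\<rceil>"
  define h where "h k = 1 / real (Suc (k + K))" for k
  have h0: "h k > 0" for k by (simp add: h_def)
  have hT: "t + h k \<le> T" for k
  proof -
    have "1 / (T - t) \<le> real K" unfolding K_def by linarith
    also have "\<dots> \<le> real (Suc (k + K))" by simp
    finally have "1 / real (Suc (k + K)) \<le> T - t" using t by (simp add: field_simps)
    then show ?thesis by (simp add: h_def)
  qed
  define P where "P u = integral {0..u} \<phi>" for u
  have P: "(P has_real_derivative \<phi> u) (at u within {0..T})" if "0 \<le> u" "u \<le> T" for u
    unfolding P_def has_real_derivative_iff_has_vector_derivative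
    by (rule integral_has_vector_derivative[OF cont]) (use that in auto)
  have Pq: "((\<lambda>h. (P (u + h) - P u) / h) \<longlongrightarrow> \<phi> u) (at_right 0)" if "0 \<le> u" "u < T" for u
  proof -
    have "((\<lambda>y. (P y - P u) / (y - u)) \<longlongrightarrow> \<phi> u) (at u within {0..T})"
      using P[of u] that by (simp add: has_field_derivative_iff)
    then have "((\<lambda>y. (P y - P u) / (y - u)) \<longlongrightarrow> \<phi> u) (at_right u)"
    proof (rule filterlim_mono[OF _ order_refl])
      have "at u within {u..T} \<le> at u within {0..T}" by (rule at_le) (use that in auto)
      then show "at_right u \<le> at u within {0..T}"
        using that by (simp add: at_within_Icc_at_right)
    qed
    then show ?thesis
      by (simp add: filterlim_at_right_to_0[of _ _ u] add.commute)
  qed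
  have Pseq: "(\<lambda>k. (P (u + h k) - P u) / h k) \<longlonglongrightarrow> \<phi> u" if "0 \<le> u" "u < T" for u
    using LIMSEQ_ignore_initial_segment[OF difference_quotient_seq[OF Pq[OF that]], of K]
    by (simp add: h_def mult.commute)
  define f where "f k s = (\<phi> (s + h k) - \<phi> s) / h k" for k s
  have contshift: "continuous_on {0..t} (\<lambda>s. \<phi> (s + h k))" for k
    using hT[of k] h0[of k]
    by (intro continuous_on_compose2[OF cont] continuous_intros) (auto intro: order_trans)
  have cont0: "continuous_on {0..u} \<phi>" if "u \<le> T" for u
    by (rule continuous_on_subset[OF cont]) (use that in auto)
  have fint: "f k integrable_on {0..t}" for k
    unfolding f_def using t h0[of k]
    by (intro integrable_continuous_real continuous_intros contshift cont0) auto
  have fbound: "norm (f k s) \<le> C" if "s \<in> {0..t}" for k s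
    using lip[of s "s + h k"] that hT[of k] h0[of k]
    by (auto simp: f_def field_simps abs_divide)
  have fconv: "(\<lambda>k. f k s) \<longlonglongrightarrow> g s" if "s \<in> {0..t}" for s
  proof -
    have "s \<ge> 0" "s < T" using that t by auto
    from LIMSEQ_ignore_initial_segment[OF difference_quotient_seq[OF deriv[OF this]], of K]
    show ?thesis by (simp add: f_def h_def mult.commute)
  qed
  note dom = dominated_convergence[where f = f and g = g and h = "\<lambda>_. C" and S = "{0..t}",
      OF fint integrable_const_ivl fbound fconv]
  show "g integrable_on {0..t}" using dom by auto
  have "integral {0..t} (f k) = (P (t + h k) - P t) / h k - (P (0 + h k) - P 0) / h k" for k
  proof -
    have "continuous_on {0 + h k..t + h k} \<phi>"
      by (rule continuous_on_subset[OF cont]) (use hT[of k] h0[of k] in auto)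
    then have sh: "integral {0..t} (\<lambda>s. \<phi> (s + h k)) = integral {h k..t + h k} \<phi>"
      using integral_shift[of 0 "h k" t \<phi>] by (simp add: comp_def)
    have "P (t + h k) = P (h k) + integral {h k..t + h k} \<phi>"
      unfolding P_def using t h0[of k] hT[of k]
      by (intro Henstock_Kurzweil_Integration.integral_combine[symmetric]
            integrable_continuous_real cont0) auto
    moreover have "integral {0..t} (f k) = (integral {0..t} (\<lambda>s. \<phi> (s + h k)) - integral {0..t} \<phi>) / h k"
      unfolding f_def using t
      by (simp add: integral_diff integrable_continuous_real contshift cont0)
    ultimately show ?thesis using sh by (simp add: P_def diff_divide_distrib add_divide_distrib)
  qed
  moreover have "(\<lambda>k. (P (t + h k) - P t) / h k - (P (0 + h k) - P 0) / h k) \<longlonglongrightarrow> \<phi> t - \<phi> 0"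
    by (intro tendsto_diff Pseq) (use t in auto)
  moreover have "(\<lambda>k. integral {0..t} (f k)) \<longlonglongrightarrow> integral {0..t} g" using dom by auto
  ultimately show "integral {0..t} g = \<phi> t - \<phi> 0"
    using LIMSEQ_unique by auto
qed

text \<open>At the fixed time \<open>t\<close> this is dominated convergence of the right
  derivatives. Replacing \<open>t\<close> by \<open>s n\<close> costs at most
  \<open>C * \<bar>s n - t\<bar>\<close> by the common Lipschitz bound, so the side from which
  \<open>s n\<close> approaches is irrelevant here.\<close>

lemma right_deriv_increments_converge:
  fixes \<phi> g :: "nat \<Rightarrow> real \<Rightarrow> real"
  assumes t: "0 \<le> t" "t < T"
    and cont: "\<And>n. n \<ge> n0 \<Longrightarrow> continuous_on {0..T} (\<phi> n)"
    and deriv: "\<And>n s. n \<ge> n0 \<Longrightarrow> 0 \<le> s \<Longrightarrow> s < T \<Longrightarrow>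
      ((\<lambda>h. (\<phi> n (s + h) - \<phi> n s) / h) \<longlongrightarrow> g n s) (at_right 0)"
    and bound: "\<And>n s. n \<ge> n0 \<Longrightarrow> 0 \<le> s \<Longrightarrow> s < T \<Longrightarrow> \<bar>g n s\<bar> \<le> C"
    and conv: "\<And>s. 0 \<le> s \<Longrightarrow> s < T \<Longrightarrow> (\<lambda>n. g n s) \<longlonglongrightarrow> g' s"
    and s: "\<And>n. 0 \<le> s n" "s \<longlonglongrightarrow> t"
  shows "(\<lambda>n. \<phi> n (s n) - \<phi> n 0) \<longlonglongrightarrow> integral {0..t} g'"
proof -
  have int: "g n integrable_on {0..t}" "integral {0..t} (g n) = \<phi> n t - \<phi> n 0" if "n \<ge> n0" for n
    using integral_right_deriv[of t T "\<phi> n" "g n" C] t cont deriv bound that by auto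
  have "(\<lambda>k. integral {0..t} (g (k + n0))) \<longlonglongrightarrow> integral {0..t} g'"
    by (rule dominated_convergence[where h = "\<lambda>_. C"])
       (use t int bound in \<open>auto intro!: LIMSEQ_ignore_initial_segment[where f = "\<lambda>n. g n _"] conv\<close>)
  then have "(\<lambda>k. \<phi> (k + n0) t - \<phi> (k + n0) 0) \<longlonglongrightarrow> integral {0..t} g'"
    by (simp add: int)
  then have 1: "(\<lambda>n. \<phi> n t - \<phi> n 0) \<longlonglongrightarrow> integral {0..t} g'"
    by (rule LIMSEQ_offset)
  have "eventually (\<lambda>n. s n < T) sequentially" using s(2) t(2) by (rule order_tendstoD)
  then have "eventually (\<lambda>n. norm (\<phi> n (s n) - \<phi> n t) \<le> C * \<bar>s n - t\<bar>) sequentially"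
    using eventually_ge_at_top[of n0]
  proof eventually_elim
    case (elim n)
    have lip: "\<bar>\<phi> n v - \<phi> n u\<bar> \<le> C * (v - u)" if "0 \<le> u" "u \<le> v" "v < T" for u v
      using that elim by (intro right_deriv_bound[where g = "g n"] continuous_on_subset[OF cont] deriv bound) auto
    show ?case using lip[of "s n" t] lip[of t "s n"] s(1)[of n] t elim
      by (cases "s n \<le> t") (auto simp: abs_minus_commute)
  qed
  moreover have "(\<lambda>n. C * \<bar>s n - t\<bar>) \<longlonglongrightarrow> 0"
    using tendsto_mult_right_zero[OF tendsto_rabs_zero[OF LIM_zero[OF s(2)]]] by simp
  ultimately have "(\<lambda>n. \<phi> n (s n) - \<phi> n t) \<longlonglongrightarrow> 0"
    by (rule Lim_null_comparison)
  from tendsto_add[OF this 1] show ?thesis by simp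
qed

section \<open>Countability of left-isolated times, and uniformity from sequences\<close>

lemma countable_left_isolated:
  fixes A :: "real set"
  assumes "\<And>t. t \<in> A \<Longrightarrow> \<exists>\<delta>>0. A \<inter> {t - \<delta><..<t} = {}"
  shows "countable A"
proof -
  obtain \<delta> where \<delta>: "\<And>t. t \<in> A \<Longrightarrow> \<delta> t > 0 \<and> A \<inter> {t - \<delta> t<..<t} = {}"
    using assms by metis
  have q: "\<exists>q\<in>\<rat>. t - \<delta> t < q \<and> q < t" if "t \<in> A" for t
    using Rats_dense_in_real[of "t - \<delta> t" t] \<delta>[OF that] by auto
  then obtain q where q: "\<And>t. t \<in> A \<Longrightarrow> q t \<in> \<rat> \<and> t - \<delta> t < q t \<and> q t < t" by metis
  have "inj_on q A"
  proof (rule linorder_inj_onI)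
    \<comment> \<open>The gap belonging to the later point \<open>t\<close> begins no earlier than
      \<open>s\<close>, so \<open>q s < s\<close> and \<open>q t\<close> lie on different sides of
      \<open>s\<close>.\<close>
    fix s t assume st: "s < t" "s \<in> A" "t \<in> A"
    then have "s \<le> t - \<delta> t" using \<delta>[of t] by (force simp: disjoint_iff not_less)
    then show "q s \<noteq> q t" using q[of s] q[of t] st by linarith
  qed auto
  moreover have "countable (q ` A)"
    by (rule countable_subset[OF _ countable_rat]) (use q in auto)
  ultimately show ?thesis by (simp add: countable_image_inj_eq)
qed

text \<open>Sequences whose points approach \<open>t\<close> can be glued, so convergence along all of them is already
  uniform near \<open>t\<close>.\<close>

lemma uniform_from_sequences:
  fixes pos :: "nat \<Rightarrow> 'z \<Rightarrow> real" and f :: "nat \<Rightarrow> 'z \<Rightarrow> 'a::metric_space"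
  assumes conv: "\<And>z. \<lbrakk>(\<lambda>n. pos n (z n)) \<longlonglongrightarrow> t; \<forall>\<^sub>F n in sequentially. P n (z n)\<rbrakk> \<Longrightarrow>
      (\<lambda>n. f n (z n)) \<longlonglongrightarrow> L"
    and z0: "(\<lambda>n. pos n (z0 n)) \<longlonglongrightarrow> t" "\<forall>\<^sub>F n in sequentially. P n (z0 n)"
    and e: "e > 0"
  shows "\<exists>\<delta>>0. \<exists>N. \<forall>n\<ge>N. \<forall>z. P n z \<and> \<bar>pos n z - t\<bar> < \<delta> \<longrightarrow> dist (f n z) L < e"
proof (rule ccontr)
  assume neg: "\<not> ?thesis"
  define Q where "Q k n z \<longleftrightarrow> P n z \<and> \<bar>pos n z - t\<bar> < 1 / real (Suc k) \<and> dist (f n z) L \<ge> e" for k n z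
  have ex: "\<exists>n\<ge>N. \<exists>z. Q k n z" for k N
  proof -
    have "1 / real (Suc k) > 0" by simp
    then show ?thesis using neg unfolding Q_def by (meson not_less)
  qed
  then obtain p where p: "\<And>k. \<exists>z. Q k (p k) z" "\<And>k. p k < p (Suc k)"
    using dependent_nat_choice[of "\<lambda>k n. \<exists>z. Q k n z" "\<lambda>k n n'. n < n'"]
    by (metis Suc_le_lessD)
  then have sm: "strict_mono p" by (simp add: strict_mono_Suc_iff)
  obtain w where w: "\<And>k. Q k (p k) (w k)" using p(1) by metis
  \<comment> \<open>The counterexamples sit at the positions \<open>p k\<close> of a subsequence;
    the sequence \<open>z0\<close> fills all other positions, so that the glued sequence still
    satisfies both premises of \<open>conv\<close>.\<close>
  define z where "z n = (if n \<in> range p then w (inv p n) else z0 n)" for n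
  have zp: "z (p k) = w k" for k
    by (simp add: z_def strict_mono_imp_inj_on[OF sm])
  have "(\<lambda>n. pos n (z n)) \<longlonglongrightarrow> t"
  proof (rule tendstoI)
    fix r :: real assume r: "r > 0"
    obtain k0 where k0: "1 / real (Suc k0) < r"
      using r nat_approx_posE by metis
    have "eventually (\<lambda>n. dist (pos n (z0 n)) t < r) sequentially"
      using z0(1) r by (rule tendstoD)
    then show "eventually (\<lambda>n. dist (pos n (z n)) t < r) sequentially"
      using eventually_ge_at_top[of "p k0"]
    proof eventually_elim
      case (elim n)
      show ?case
      proof (cases "n \<in> range p")
        case True
        then obtain k where k: "n = p k" by auto
        then have "k0 \<le> k" using elim sm by (simp add: strict_mono_less_eq)
        then have "1 / real (Suc k) \<le> 1 / real (Suc k0)" by (simp add: field_simps)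
        then show ?thesis using w[of k] k0 k zp[of k] by (auto simp: Q_def dist_real_def)
      qed (use elim in \<open>auto simp: z_def\<close>)
    qed
  qed
  moreover have "\<forall>\<^sub>F n in sequentially. P n (z n)"
    using z0(2)
  proof eventually_elim
    case (elim n)
    then show ?case
    proof (cases "n \<in> range p")
      case True
      then obtain k where k: "n = p k" by auto
      then show ?thesis using w[of k] zp[of k] by (auto simp: Q_def)
    qed (auto simp: z_def)
  qed
  ultimately have "(\<lambda>n. f n (z n)) \<longlonglongrightarrow> L" by (rule conv)
  then have "eventually (\<lambda>n. dist (f n (z n)) L < e) sequentially" using e by (rule tendstoD)
  then obtain M where M: "\<And>n. n \<ge> M \<Longrightarrow> dist (f n (z n)) L < e"
    by (auto simp: eventually_sequentially)
  have "p M \<ge> M" using sm by (rule seq_suble)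
  from M[OF this] w[of M] zp[of M] show False by (auto simp: Q_def)
qed

section \<open>Partitions and one-sided approach of a time\<close>

locale partition_seq =
  fixes \<pi> :: partitions
  assumes partition: "partition_sequence \<pi>"
begin

abbreviation pp :: "nat \<Rightarrow> real \<Rightarrow> real" where "pp \<equiv> pred_point \<pi>"

lemma nonempty: "\<pi> n \<noteq> []" and hd_0: "hd (\<pi> n) = 0" and sorted_pi: "sorted_wrt (<) (\<pi> n)"
  using partition by (auto simp: partition_sequence_def)

lemma nth_less_iff: "i < length (\<pi> n) \<Longrightarrow> j < length (\<pi> n) \<Longrightarrow> \<pi> n ! i < \<pi> n ! j \<longleftrightarrow> i < j"
  using sorted_wrt_nth_less[OF sorted_pi, of _ _ n] by (metis linorder_neq_iff order_less_asym)

lemma nth_le_iff: "i < length (\<pi> n) \<Longrightarrow> j < length (\<pi> n) \<Longrightarrow> \<pi> n ! i \<le> \<pi> n ! j \<longleftrightarrow> i \<le> j"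
  using nth_less_iff[of j n i] by (metis linorder_not_less)

lemma nth_eq_iff: "i < length (\<pi> n) \<Longrightarrow> j < length (\<pi> n) \<Longrightarrow> \<pi> n ! i = \<pi> n ! j \<longleftrightarrow> i = j"
  using nth_le_iff[of i n j] nth_le_iff[of j n i] by auto

lemma nth_0: "\<pi> n ! 0 = 0"
  using hd_0[of n] nonempty[of n] by (simp add: hd_conv_nth)

lemma nth_nonneg: "i < length (\<pi> n) \<Longrightarrow> 0 \<le> \<pi> n ! i"
  using nth_le_iff[of 0 n i] nonempty[of n] by (simp add: nth_0)

lemma nth_pos: "i < length (\<pi> n) \<Longrightarrow> 0 < i \<Longrightarrow> 0 < \<pi> n ! i"
  using nth_less_iff[of 0 n i] nonempty[of n] by (simp add: nth_0)

lemma nth_le_last: "i < length (\<pi> n) \<Longrightarrow> \<pi> n ! i \<le> last (\<pi> n)"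
  using nth_le_iff[of i n "length (\<pi> n) - 1"] nonempty[of n] by (simp add: last_conv_nth)

lemma zero_in: "0 \<in> set (\<pi> n)"
  using hd_0 nonempty by (metis hd_in_set)

lemma eventually_last: "\<forall>\<^sub>F n in sequentially. T < last (\<pi> n)"
  using partition unfolding partition_sequence_def filterlim_at_top_dense by blast

lemma eventually_mesh:
  assumes "e > 0"
  shows "\<forall>\<^sub>F n in sequentially. \<forall>i. Suc i < length (\<pi> n) \<and> \<pi> n ! i \<le> T \<longrightarrow> \<pi> n ! Suc i - \<pi> n ! i < e"
proof -
  have "\<forall>\<^sub>F n in sequentially. \<forall>i. Suc i < length (\<pi> n) \<and> \<pi> n ! i \<le> max T 0 \<longrightarrow> \<pi> n ! Suc i - \<pi> n ! i < e"
    using partition assms unfolding partition_sequence_def by (meson max.cobounded2)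
  then show ?thesis by eventually_elim auto
qed

lemma pp_max:
  assumes "t > 0"
  shows "pp n t \<in> set (\<pi> n)" "pp n t < t" "\<And>u. u \<in> set (\<pi> n) \<Longrightarrow> u < t \<Longrightarrow> u \<le> pp n t"
proof -
  let ?S = "{u \<in> set (\<pi> n). u < t}"
  have *: "pp n t = Max ?S"
    using assms zero_in[of n] by (auto simp: pred_point_def)
  have "finite ?S" "?S \<noteq> {}" using assms zero_in[of n] by auto
  from Max_in[OF this] show "pp n t \<in> set (\<pi> n)" "pp n t < t" unfolding * by auto
  show "u \<le> pp n t" if "u \<in> set (\<pi> n)" "u < t" for u
    unfolding * by (rule Max_ge) (use that in auto)
qed

lemma pp_nonpos: "t \<le> 0 \<Longrightarrow> pp n t = 0"
proof -
  assume t: "t \<le> 0"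
  have "u \<ge> 0" if "u \<in> set (\<pi> n)" for u using that nth_nonneg by (auto simp: in_set_conv_nth)
  then show ?thesis using t by (force simp: pred_point_def)
qed

lemma pp_nonneg: "0 \<le> pp n t"
  using pp_nonpos[of t n] pp_max(3)[of t 0 n] zero_in[of n] by (cases "t > 0") auto

lemma pp_le: "0 \<le> t \<Longrightarrow> pp n t \<le> t"
  using pp_nonpos[of t n] pp_max(2)[of t n] by (cases "t > 0") auto

lemma pp_index:
  assumes "0 < t" "t \<le> last (\<pi> n)"
  obtains i where "Suc i < length (\<pi> n)" "\<pi> n ! i = pp n t" "\<pi> n ! i < t" "t \<le> \<pi> n ! Suc i"
proof -
  obtain i where i: "i < length (\<pi> n)" "\<pi> n ! i = pp n t"
    using pp_max(1)[OF assms(1), of n] by (auto simp: in_set_conv_nth)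
  have "\<pi> n ! i < t" using i pp_max(2)[OF assms(1), of n] by simp
  moreover have "Suc i < length (\<pi> n)"
  proof (rule ccontr)
    assume "\<not> ?thesis"
    then have "i = length (\<pi> n) - 1" using i by simp
    then have "\<pi> n ! i = last (\<pi> n)" using nonempty[of n] by (simp add: last_conv_nth)
    then show False using \<open>\<pi> n ! i < t\<close> assms by simp
  qed
  moreover have "t \<le> \<pi> n ! Suc i"
  proof (rule ccontr)
    assume "\<not> ?thesis"
    then have "\<pi> n ! Suc i \<le> pp n t" using pp_max(3)[OF assms(1), of "\<pi> n ! Suc i" n] calculation by auto
    then show False using i nth_le_iff[of "Suc i" n i] calculation by simp
  qed
  ultimately show ?thesis using i that by blast
qed

lemma nth_le_pp_iff: "0 < t \<Longrightarrow> i < length (\<pi> n) \<Longrightarrow> \<pi> n ! i \<le> pp n t \<longleftrightarrow> \<pi> n ! i < t"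
  using pp_max(2)[of t n] pp_max(3)[of t "\<pi> n ! i" n] by force

lemma eventually_pp_close:
  assumes "e > 0"
  shows "\<forall>\<^sub>F n in sequentially. \<forall>s\<in>{0..T}. s - e < pp n s"
  using eventually_last[of T] eventually_mesh[OF assms, of T]
proof eventually_elim
  case (elim n)
  show ?case
  proof
    fix s assume s: "s \<in> {0..T}"
    show "s - e < pp n s"
    proof (cases "s > 0")
      case True
      then obtain i where "Suc i < length (\<pi> n)" "\<pi> n ! i = pp n s" "\<pi> n ! i < s" "s \<le> \<pi> n ! Suc i"
        using pp_index[of s n] s elim(1) by auto
      then show ?thesis using elim(2) s by fastforce
    qed (use assms s pp_nonpos[of s n] in auto)
  qed
qed

lemma pp_tendsto:
  assumes "s \<longlonglongrightarrow> t" "\<And>n. 0 \<le> s n"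
  shows "(\<lambda>n. pp n (s n)) \<longlonglongrightarrow> t"
proof -
  have "(\<lambda>n. pp n (s n) - s n) \<longlonglongrightarrow> 0"
  proof (rule tendstoI)
    fix e :: real assume e: "e > 0"
    have "\<forall>\<^sub>F n in sequentially. s n < t + 1" using assms(1) by (rule order_tendstoD) simp
    with eventually_pp_close[OF e, of "t + 1"]
    show "\<forall>\<^sub>F n in sequentially. dist (pp n (s n) - s n) 0 < e"
    proof eventually_elim
      case (elim n)
      then have "s n - e < pp n (s n)" using assms(2)[of n] by auto
      then show ?case using pp_le[OF assms(2), of n n] by (auto simp: dist_real_def)
    qed
  qed
  from tendsto_add[OF this assms(1)] show ?thesis by simp
qed

lemma nth_Suc_tendsto:
  assumes "(\<lambda>n. \<pi> n ! i n) \<longlonglongrightarrow> t" "\<forall>\<^sub>F n in sequentially. Suc (i n) < length (\<pi> n)"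
  shows "(\<lambda>n. \<pi> n ! Suc (i n)) \<longlonglongrightarrow> t"
proof -
  have "(\<lambda>n. \<pi> n ! Suc (i n) - \<pi> n ! i n) \<longlonglongrightarrow> 0"
  proof (rule tendstoI)
    fix e :: real assume e: "e > 0"
    have "\<forall>\<^sub>F n in sequentially. \<pi> n ! i n < t + 1" using assms(1) by (rule order_tendstoD) simp
    with eventually_mesh[OF e, of "t + 1"] assms(2)
    show "\<forall>\<^sub>F n in sequentially. dist (\<pi> n ! Suc (i n) - \<pi> n ! i n) 0 < e"
    proof eventually_elim
      case (elim n)
      then show ?case using nth_less_iff[of "i n" n "Suc (i n)"] by (auto simp: dist_real_def)
    qed
  qed
  from tendsto_add[OF this assms(1)] show ?thesis by simp
qed

lemma sum_index_initial:
  obtains j where "{i. Suc i < length (\<pi> n) \<and> \<pi> n ! i \<le> s} = {..<j}"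
proof -
  define j where "j = (LEAST i. \<not> (Suc i < length (\<pi> n) \<and> \<pi> n ! i \<le> s))"
  have j: "\<not> (Suc j < length (\<pi> n) \<and> \<pi> n ! j \<le> s)"
    unfolding j_def by (rule LeastI[of _ "length (\<pi> n)"]) simp
  have "i < j" if "Suc i < length (\<pi> n)" "\<pi> n ! i \<le> s" for i
  proof (rule ccontr)
    assume "\<not> i < j"
    then have "Suc j < length (\<pi> n)" "\<pi> n ! j \<le> \<pi> n ! i" using that nth_le_iff[of j n i] by auto
    then show False using j that by simp
  qed
  moreover have "Suc i < length (\<pi> n) \<and> \<pi> n ! i \<le> s" if "i < j" for i
    using not_less_Least[OF that[unfolded j_def]] by simp
  ultimately show ?thesis using that[of j] by auto
qed

section \<open>Limits along times on either side of the last partition point before t\<close>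

definition right_approach :: "real \<Rightarrow> (nat \<Rightarrow> real) \<Rightarrow> bool" where
  "right_approach t s \<longleftrightarrow> (\<forall>n. 0 \<le> s n) \<and> s \<longlonglongrightarrow> t \<and> (\<forall>\<^sub>F n in sequentially. pp n t \<le> s n)"

definition left_approach :: "real \<Rightarrow> (nat \<Rightarrow> real) \<Rightarrow> bool" where
  "left_approach t s \<longleftrightarrow> (\<forall>n. 0 \<le> s n) \<and> s \<longlonglongrightarrow> t \<and> (\<forall>\<^sub>F n in sequentially. s n < pp n t)"

lemma right_approach_const: "0 \<le> t \<Longrightarrow> right_approach t (\<lambda>_. t)"
  by (simp add: right_approach_def pp_le)

lemma right_approach_pp: "0 \<le> t \<Longrightarrow> right_approach t (\<lambda>n. pp n t)"
  by (simp add: right_approach_def pp_nonneg pp_tendsto)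

lemma eventually_pp_gt: "0 \<le> u \<Longrightarrow> u < t \<Longrightarrow> \<forall>\<^sub>F n in sequentially. u < pp n t"
  using order_tendstoD(1)[OF pp_tendsto[of "\<lambda>_. t" t]] by auto

text \<open>Provides a left approach at every positive time: it is the filler in the gluing argument
  and the sequence along which left limits are read off. The times \<open>pp n t\<close> themselves
  already form a right approach.\<close>

lemma left_approach_pp_pp:
  assumes "0 < t" shows "left_approach t (\<lambda>n. pp n (pp n t))"
proof -
  have "\<forall>\<^sub>F n in sequentially. 0 < pp n t" using eventually_pp_gt assms by simp
  then have "\<forall>\<^sub>F n in sequentially. pp n (pp n t) < pp n t" by eventually_elim (rule pp_max)
  then show ?thesis using assms by (simp add: left_approach_def pp_nonneg pp_tendsto)
qed

text \<open>Sides refer to \<open>pp n t\<close>, so a right approach may stay strictly below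
  \<open>t\<close>. At \<open>t = 0\<close> only the first clause makes sense, because
  \<open>pp n 0 = 0\<close> leaves no nonnegative time below it.\<close>

definition sided_limits ::
    "(nat \<Rightarrow> real \<Rightarrow> 'a::metric_space) \<Rightarrow> (real \<Rightarrow> 'a) \<Rightarrow> (real \<Rightarrow> 'a) \<Rightarrow> bool" where
  "sided_limits a A B \<longleftrightarrow>
     (\<forall>t\<ge>0. \<forall>s. right_approach t s \<longrightarrow> (\<lambda>n. a n (s n)) \<longlonglongrightarrow> A t) \<and>
     (\<forall>t>0. \<forall>s. left_approach t s \<longrightarrow> (\<lambda>n. a n (s n)) \<longlonglongrightarrow> B t)"

text \<open>The continuity conditions quantify over sequences that are nonnegative for every
  \<open>n\<close>, while sequences of partition points chosen by index are so only eventually;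
  truncating at 0 bridges the gap.\<close>

lemma tendsto_along_eventually_nonneg:
  fixes f :: "nat \<Rightarrow> real \<Rightarrow> 'a::topological_space"
  assumes conv: "\<And>s. \<lbrakk>\<forall>n. 0 \<le> s n; s \<longlonglongrightarrow> t; \<forall>\<^sub>F n in sequentially. P n (s n)\<rbrakk> \<Longrightarrow> (\<lambda>n. f n (s n)) \<longlonglongrightarrow> L"
    and t: "0 \<le> t" and s: "s \<longlonglongrightarrow> t" and ev: "\<forall>\<^sub>F n in sequentially. 0 \<le> s n \<and> P n (s n)"
  shows "(\<lambda>n. f n (s n)) \<longlonglongrightarrow> L"
proof -
  have "(\<lambda>n. max 0 (s n)) \<longlonglongrightarrow> max 0 t" by (intro tendsto_max tendsto_const s)
  then have "(\<lambda>n. max 0 (s n)) \<longlonglongrightarrow> t" using t by simp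
  moreover have "\<forall>\<^sub>F n in sequentially. P n (max 0 (s n))"
    using ev by eventually_elim simp
  ultimately have "(\<lambda>n. f n (max 0 (s n))) \<longlonglongrightarrow> L" by (intro conv) auto
  then show ?thesis
    by (rule Lim_transform_eventually) (use ev in \<open>eventually_elim, simp\<close>)
qed

lemma uniform_from_approach:
  fixes f :: "nat \<Rightarrow> real \<Rightarrow> 'a::metric_space"
  assumes "\<And>s. \<lbrakk>\<forall>n. 0 \<le> s n; s \<longlonglongrightarrow> t; \<forall>\<^sub>F n in sequentially. P n (s n)\<rbrakk> \<Longrightarrow> (\<lambda>n. f n (s n)) \<longlonglongrightarrow> L"
    and "0 \<le> t" and s0: "\<forall>n. 0 \<le> s0 n" "s0 \<longlonglongrightarrow> t" "\<forall>\<^sub>F n in sequentially. P n (s0 n)" and "e > 0"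
  shows "\<exists>\<delta>>0. \<exists>N. \<forall>n\<ge>N. \<forall>s. (0 \<le> s \<and> P n s) \<and> \<bar>s - t\<bar> < \<delta> \<longrightarrow> dist (f n s) L < e"
proof (rule uniform_from_sequences)
  show "(\<lambda>n. f n (s n)) \<longlonglongrightarrow> L" if "(\<lambda>n. s n) \<longlonglongrightarrow> t" "\<forall>\<^sub>F n in sequentially. 0 \<le> s n \<and> P n (s n)" for s
    by (rule tendsto_along_eventually_nonneg[where P = P]) (use assms that in auto)
  show "\<forall>\<^sub>F n in sequentially. 0 \<le> s0 n \<and> P n (s0 n)" using s0(3) by eventually_elim (use s0 in auto)
qed (use assms in auto)

lemma sided_limits_uniform_right:
  assumes "sided_limits a A B" "0 \<le> t" "e > 0"
  obtains \<delta> N where "\<delta> > 0"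
    "\<And>n s. N \<le> n \<Longrightarrow> 0 \<le> s \<Longrightarrow> pp n t \<le> s \<Longrightarrow> \<bar>s - t\<bar> < \<delta> \<Longrightarrow> dist (a n s) (A t) < e"
proof -
  have "\<exists>\<delta>>0. \<exists>N. \<forall>n\<ge>N. \<forall>s. (0 \<le> s \<and> pp n t \<le> s) \<and> \<bar>s - t\<bar> < \<delta> \<longrightarrow> dist (a n s) (A t) < e"
    by (rule uniform_from_approach[where ?s0.0 = "\<lambda>_. t"])
       (use assms in \<open>auto simp: sided_limits_def right_approach_def pp_le\<close>)
  then show ?thesis using that by blast
qed

lemma sided_limits_uniform_left:
  assumes "sided_limits a A B" "0 < t" "e > 0"
  obtains \<delta> N where "\<delta> > 0"
    "\<And>n s. N \<le> n \<Longrightarrow> 0 \<le> s \<Longrightarrow> s < pp n t \<Longrightarrow> \<bar>s - t\<bar> < \<delta> \<Longrightarrow> dist (a n s) (B t) < e"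
proof -
  have "\<exists>\<delta>>0. \<exists>N. \<forall>n\<ge>N. \<forall>s. (0 \<le> s \<and> s < pp n t) \<and> \<bar>s - t\<bar> < \<delta> \<longrightarrow> dist (a n s) (B t) < e"
    by (rule uniform_from_approach[where ?s0.0 = "\<lambda>n. pp n (pp n t)"])
       (use assms left_approach_pp_pp[OF assms(2)] in \<open>auto simp: sided_limits_def left_approach_def\<close>)
  then show ?thesis using that by blast
qed

lemma sided_limitsD:
  assumes "sided_limits a A B"
  shows "0 \<le> t \<Longrightarrow> right_approach t s \<Longrightarrow> (\<lambda>n. a n (s n)) \<longlonglongrightarrow> A t"
    and "0 < t \<Longrightarrow> left_approach t s \<Longrightarrow> (\<lambda>n. a n (s n)) \<longlonglongrightarrow> B t"
  using assms unfolding sided_limits_def by blast+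

lemma sided_limits_const:
  assumes "sided_limits a A B"
  shows "0 \<le> t \<Longrightarrow> (\<lambda>n. a n t) \<longlonglongrightarrow> A t"
    and "0 < t \<Longrightarrow> (\<lambda>n. a n (pp n (pp n t))) \<longlonglongrightarrow> B t"
  by (rule sided_limitsD(1)[OF assms _ right_approach_const]; simp)
     (rule sided_limitsD(2)[OF assms _ left_approach_pp_pp]; simp)

text \<open>Both \<open>A s\<close> and \<open>B s\<close> are limits of values of
  \<open>a n\<close> at times in \<open>(r, s]\<close>, taken at \<open>s\<close> and at
  \<open>pp n (pp n s)\<close>, so a bound uniform on that interval passes to both.\<close>

lemma sided_limits_dist_le:
  assumes lim: "sided_limits a A B" and s: "0 < s" "r < s"
    and close: "\<forall>\<^sub>F n in sequentially. \<forall>u. 0 \<le> u \<and> r < u \<and> u \<le> s \<longrightarrow> dist (a n u) c \<le> e"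
  shows "dist (A s) c \<le> e" "dist (B s) c \<le> e"
proof -
  have "\<forall>\<^sub>F n in sequentially. dist (a n s) c \<le> e"
    using close by eventually_elim (use s in auto)
  moreover have "(\<lambda>n. dist (a n s) c) \<longlonglongrightarrow> dist (A s) c"
    using s by (intro tendsto_intros sided_limits_const(1)[OF lim]) auto
  ultimately show "dist (A s) c \<le> e" by (intro tendsto_upperbound) auto
  have "\<forall>\<^sub>F n in sequentially. r < pp n (pp n s)"
    using left_approach_pp_pp[OF s(1)] s(2) by (auto simp: left_approach_def intro: order_tendstoD)
  with close have "\<forall>\<^sub>F n in sequentially. dist (a n (pp n (pp n s))) c \<le> e"
  proof eventually_elim
    case (elim n)
    have "pp n (pp n s) \<le> s" using pp_le[of s n] pp_le[of "pp n s" n] pp_nonneg[of n s] s by linarith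
    then show ?case using elim pp_nonneg[of n "pp n s"] by blast
  qed
  moreover have "(\<lambda>n. dist (a n (pp n (pp n s))) c) \<longlonglongrightarrow> dist (B s) c"
    using s by (intro tendsto_intros sided_limits_const(2)[OF lim]) auto
  ultimately show "dist (B s) c \<le> e" by (intro tendsto_upperbound) auto
qed

text \<open>Regularity of the limits comes for free: convergence along all right approaches is
  uniform near \<open>t\<close>, and \<open>A s\<close>, \<open>B s\<close> are limits of values
  already close to \<open>A t\<close>. Together with the counterpart on the left, \<open>A\<close>
  is right-continuous with left limits \<open>B\<close>; this later settles the continuity
  conditions that involve the fixed path \<open>x\<close> only.\<close>

lemma sided_limits_at_right:
  assumes lim: "sided_limits a A B" and t: "0 \<le> t"
  shows "(A \<longlongrightarrow> A t) (at_right t)" "(B \<longlongrightarrow> A t) (at_right t)"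
proof -
  have "\<exists>b>t. \<forall>s>t. s < b \<longrightarrow> dist (A s) (A t) < e \<and> dist (B s) (A t) < e" if e: "e > 0" for e
  proof -
    from sided_limits_uniform_right[OF lim t half_gt_zero[OF e]]
    obtain \<delta> N where \<delta>: "\<delta> > 0"
      "\<And>n s. N \<le> n \<Longrightarrow> 0 \<le> s \<Longrightarrow> pp n t \<le> s \<Longrightarrow> \<bar>s - t\<bar> < \<delta> \<Longrightarrow> dist (a n s) (A t) < e / 2" by metis
    have "dist (A s) (A t) < e \<and> dist (B s) (A t) < e" if s: "t < s" "s < t + \<delta>" for s
    proof -
      have "\<forall>\<^sub>F n in sequentially. \<forall>u. 0 \<le> u \<and> t < u \<and> u \<le> s \<longrightarrow> dist (a n u) (A t) \<le> e / 2"
        using eventually_ge_at_top[of N]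
      proof eventually_elim
        case (elim n)
        then show ?case using \<delta>(2)[of n] pp_le[OF t, of n] s by (force intro: less_imp_le)
      qed
      from sided_limits_dist_le[OF lim _ s(1) this] show ?thesis using s t e by auto
    qed
    then show ?thesis using \<delta>(1) by (intro exI[of _ "t + \<delta>"]) simp
  qed
  then show "(A \<longlongrightarrow> A t) (at_right t)" "(B \<longlongrightarrow> A t) (at_right t)"
    unfolding tendsto_iff eventually_at_right_field by blast+
qed

lemma sided_limits_at_left:
  assumes lim: "sided_limits a A B" and t: "0 < t"
  shows "(A \<longlongrightarrow> B t) (at_left t)" "(B \<longlongrightarrow> B t) (at_left t)"
proof -
  have "\<exists>b<t. \<forall>s>b. s < t \<longrightarrow> dist (A s) (B t) < e \<and> dist (B s) (B t) < e" if e: "e > 0" for e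
  proof -
    from sided_limits_uniform_left[OF lim t half_gt_zero[OF e]]
    obtain \<delta> N where \<delta>: "\<delta> > 0"
      "\<And>n s. N \<le> n \<Longrightarrow> 0 \<le> s \<Longrightarrow> s < pp n t \<Longrightarrow> \<bar>s - t\<bar> < \<delta> \<Longrightarrow> dist (a n s) (B t) < e / 2" by metis
    have "dist (A s) (B t) < e \<and> dist (B s) (B t) < e" if s: "max 0 (t - \<delta>) < s" "s < t" for s
    proof -
      \<comment> \<open>A fixed time before \<open>t\<close> eventually lies below
        \<open>pp n t\<close>, hence on the left side where the uniform estimate holds.\<close>
      have "\<forall>\<^sub>F n in sequentially. s < pp n t" using s by (intro eventually_pp_gt) auto
      then have "\<forall>\<^sub>F n in sequentially. \<forall>u. 0 \<le> u \<and> t - \<delta> < u \<and> u \<le> s \<longrightarrow> dist (a n u) (B t) \<le> e / 2"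
        using eventually_ge_at_top[of N]
      proof eventually_elim
        case (elim n)
        then show ?case using \<delta>(2)[of n] s by (force intro: less_imp_le)
      qed
      from sided_limits_dist_le[OF lim _ _ this] show ?thesis using s e by auto
    qed
    then show ?thesis using \<delta>(1) t by (intro exI[of _ "max 0 (t - \<delta>)"]) simp
  qed
  then show "(A \<longlongrightarrow> B t) (at_left t)" "(B \<longlongrightarrow> B t) (at_left t)"
    unfolding tendsto_iff eventually_at_left_field by blast+
qed

end

section \<open>Convergence of Stieltjes sums\<close>

context partition_seq begin

abbreviation upto_idx :: "nat \<Rightarrow> real \<Rightarrow> nat set" where
  "upto_idx n s \<equiv> {i. Suc i < length (\<pi> n) \<and> \<pi> n ! i \<le> s}"

lemma finite_upto_idx: "finite (upto_idx n s)"
  by (rule finite_subset[of _ "{..<length (\<pi> n)}"]) auto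

lemma pp_index_seq:
  assumes "s \<longlonglongrightarrow> t" "\<forall>\<^sub>F n in sequentially. 0 < s n"
  obtains j where "\<forall>\<^sub>F n in sequentially. Suc (j n) < length (\<pi> n) \<and> \<pi> n ! j n = pp n (s n)"
proof -
  have "\<forall>\<^sub>F n in sequentially. s n < t + 1" using assms(1) by (rule order_tendstoD) simp
  then have "\<forall>\<^sub>F n in sequentially. \<exists>j. Suc j < length (\<pi> n) \<and> \<pi> n ! j = pp n (s n)"
    using assms(2) eventually_last[of "t + 1"]
  proof eventually_elim
    case (elim n)
    obtain j where "Suc j < length (\<pi> n)" "\<pi> n ! j = pp n (s n)"
      by (rule pp_index[of "s n" n]) (use elim in auto)
    then show ?case by blast
  qed
  then obtain j where "\<forall>\<^sub>F n in sequentially. Suc (j n) < length (\<pi> n) \<and> \<pi> n ! j n = pp n (s n)"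
    unfolding eventually_ex by blast
  then show ?thesis by (rule that)
qed

end

lemma negligible_countable:
  fixes S :: "'a::euclidean_space set"
  assumes "countable S" shows "negligible S"
proof -
  have "negligible (\<Union>x\<in>S. {x})"
    by (rule negligible_countable_Union) (use assms in auto)
  then show ?thesis by simp
qed

text \<open>The values \<open>f n i\<close> at the partition points below \<open>t\<close> may have a limit \<open>fl t\<close> different from
  the limit \<open>fa t\<close> at the last point \<open>t'\<^sub>n\<close> before \<open>t\<close>.\<close>

locale stieltjes = partition_seq +
  fixes m f :: "nat \<Rightarrow> nat \<Rightarrow> real" and v v' fa fl :: "real \<Rightarrow> real" and C T :: real and n0 :: nat
  assumes m_nonneg: "\<And>n i. 0 \<le> m n i"
    and v_lim: "sided_limits (\<lambda>n s. \<Sum>i\<in>upto_idx n s. m n i) v v'"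
    and v_0: "v 0 = 0"
    and f_at: "\<And>t i. \<lbrakk>0 < t; t < T; \<forall>\<^sub>F n in sequentially. Suc (i n) < length (\<pi> n) \<and> \<pi> n ! i n = pp n t\<rbrakk>
      \<Longrightarrow> (\<lambda>n. f n (i n)) \<longlonglongrightarrow> fa t"
    and f_left: "\<And>t i. \<lbrakk>0 < t; t < T; (\<lambda>n. \<pi> n ! i n) \<longlonglongrightarrow> t;
        \<forall>\<^sub>F n in sequentially. Suc (i n) < length (\<pi> n) \<and> \<pi> n ! i n < pp n t\<rbrakk>
      \<Longrightarrow> (\<lambda>n. f n (i n)) \<longlonglongrightarrow> fl t"
    and f_bound: "\<And>n i. \<lbrakk>n0 \<le> n; Suc i < length (\<pi> n); \<pi> n ! i \<le> T\<rbrakk> \<Longrightarrow> \<bar>f n i\<bar> \<le> C"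
begin

text \<open>At these times the limit of the weights depends on how \<open>t\<close> is approached.
  There the transformed weights can only be identified at levels strictly between
  \<open>v' t\<close> and \<open>v t\<close>, so the two end levels are discarded; countability
  makes the discarded set null.\<close>

definition bad :: "real set" where
  "bad = {t. 0 < t \<and> t < T \<and> (\<exists>i. (\<forall>\<^sub>F n in sequentially. Suc (i n) < length (\<pi> n)) \<and>
     (\<lambda>n. \<pi> n ! i n) \<longlonglongrightarrow> t \<and> \<not> (\<lambda>n. f n (i n)) \<longlonglongrightarrow> fa t)}"

text \<open>Left of any \<open>t\<close> the \<open>f n\<close> are eventually uniformly close to the constant \<open>fl t\<close>, so times with
  an oscillation above a fixed level are isolated from the left.\<close>

lemma countable_bad: "countable bad"
proof -
  define B where "B e = {t. 0 < t \<and> t < T \<and> (\<exists>i. (\<forall>\<^sub>F n in sequentially. Suc (i n) < length (\<pi> n)) \<and>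
     (\<lambda>n. \<pi> n ! i n) \<longlonglongrightarrow> t \<and> \<not> (\<forall>\<^sub>F n in sequentially. dist (f n (i n)) (fa t) < e))}" for e
  have "countable (B e)" if e: "e > 0" for e
  proof (rule countable_left_isolated)
    fix t assume "t \<in> B e"
    then have t: "0 < t" "t < T" by (auto simp: B_def)
    have ev: "\<forall>\<^sub>F n in sequentially. 0 < pp n t" using eventually_pp_gt t by simp
    have lim: "(\<lambda>n. pp n t) \<longlonglongrightarrow> t" using t by (intro pp_tendsto) auto
    obtain z0 where z0: "\<forall>\<^sub>F n in sequentially. Suc (z0 n) < length (\<pi> n) \<and> \<pi> n ! z0 n = pp n (pp n t)"
      by (rule pp_index_seq[OF lim ev])
    have lz: "left_approach t (\<lambda>n. pp n (pp n t))" by (rule left_approach_pp_pp[OF t(1)])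
    have z0_lim: "(\<lambda>n. \<pi> n ! z0 n) \<longlonglongrightarrow> t"
      by (rule Lim_transform_eventually[of "\<lambda>n. pp n (pp n t)"])
         (use lz z0 in \<open>auto simp: left_approach_def elim: eventually_mono\<close>)
    have z0_less: "\<forall>\<^sub>F n in sequentially. Suc (z0 n) < length (\<pi> n) \<and> \<pi> n ! z0 n < pp n t"
      using z0 lz unfolding left_approach_def by (auto elim: eventually_elim2)
    have "\<exists>\<delta>>0. \<exists>N. \<forall>n\<ge>N. \<forall>z. (Suc z < length (\<pi> n) \<and> \<pi> n ! z < pp n t) \<and> \<bar>\<pi> n ! z - t\<bar> < \<delta>
        \<longrightarrow> dist (f n z) (fl t) < e / 3"
      by (rule uniform_from_sequences[where pos = "\<lambda>n z. \<pi> n ! z" and ?z0.0 = z0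
            and P = "\<lambda>n z. Suc z < length (\<pi> n) \<and> \<pi> n ! z < pp n t", OF _ z0_lim z0_less]) (use t f_left e in auto)
    then obtain \<delta> N where \<delta>: "\<delta> > 0" and N: "\<And>n z. n \<ge> N \<Longrightarrow> Suc z < length (\<pi> n) \<Longrightarrow> \<pi> n ! z < pp n t \<Longrightarrow>
        \<bar>\<pi> n ! z - t\<bar> < \<delta> \<Longrightarrow> dist (f n z) (fl t) < e / 3" by metis
    \<comment> \<open>Near \<open>u\<close> every index eventually falls into the zone where
      \<open>f\<close> is \<open>e / 3\<close>-close to \<open>fl t\<close>. This includes the
      indices of \<open>pp n u\<close>, whose values define \<open>fa u\<close>, so all values near
      \<open>u\<close> are closer than \<open>e\<close> to \<open>fa u\<close>.\<close>
    have False if u: "u \<in> B e" "t - \<delta> < u" "u < t" for u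
    proof -
      obtain i where i: "\<forall>\<^sub>F n in sequentially. Suc (i n) < length (\<pi> n)" "(\<lambda>n. \<pi> n ! i n) \<longlonglongrightarrow> u"
        "\<not> (\<forall>\<^sub>F n in sequentially. dist (f n (i n)) (fa u) < e)" and u0: "0 < u" "u < T"
        using u(1) by (auto simp: B_def)
      have close: "\<forall>\<^sub>F n in sequentially. dist (f n (k n)) (fl t) < e / 3"
        if k: "\<forall>\<^sub>F n in sequentially. Suc (k n) < length (\<pi> n)" "(\<lambda>n. \<pi> n ! k n) \<longlonglongrightarrow> u" for k
      proof -
        have "\<forall>\<^sub>F n in sequentially. t - \<delta> < \<pi> n ! k n" using k(2) u(2) by (rule order_tendstoD)
        moreover have "\<forall>\<^sub>F n in sequentially. \<pi> n ! k n < (u + t) / 2"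
          using k(2) by (rule order_tendstoD) (use u in simp)
        moreover have "\<forall>\<^sub>F n in sequentially. (u + t) / 2 < pp n t"
          by (rule eventually_pp_gt) (use u u0 in auto)
        ultimately show ?thesis using k(1) eventually_ge_at_top[of N]
        proof eventually_elim
          case (elim n)
          then show ?case using N[of n "k n"] u by (auto simp: abs_less_iff)
        qed
      qed
      have lim_u: "(\<lambda>n. u) \<longlonglongrightarrow> u" by simp
      obtain j where j: "\<forall>\<^sub>F n in sequentially. Suc (j n) < length (\<pi> n) \<and> \<pi> n ! j n = pp n u"
        by (rule pp_index_seq[OF lim_u]) (use u0 in auto)
      have j_lim: "(\<lambda>n. \<pi> n ! j n) \<longlonglongrightarrow> u"
        by (rule Lim_transform_eventually[of "\<lambda>n. pp n u"])
           (use u0 j in \<open>auto intro!: pp_tendsto elim: eventually_mono\<close>)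
      have j_len: "\<forall>\<^sub>F n in sequentially. Suc (j n) < length (\<pi> n)"
        using j by eventually_elim auto
      have "(\<lambda>n. dist (f n (j n)) (fl t)) \<longlonglongrightarrow> dist (fa u) (fl t)"
        by (intro tendsto_intros f_at[OF u0 j])
      moreover have "\<forall>\<^sub>F n in sequentially. dist (f n (j n)) (fl t) \<le> e / 3"
        using close[OF j_len j_lim] by eventually_elim auto
      ultimately have fau: "dist (fa u) (fl t) \<le> e / 3"
        by (intro tendsto_upperbound) auto
      have "\<forall>\<^sub>F n in sequentially. dist (f n (i n)) (fa u) < e"
        using close[OF i(1,2)]
      proof eventually_elim
        case (elim n)
        have "dist (f n (i n)) (fa u) \<le> dist (f n (i n)) (fl t) + dist (fa u) (fl t)"
          by (rule dist_triangle2)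
        then show ?case using elim fau e by linarith
      qed
      then show False using i(3) by contradiction
    qed
    then show "\<exists>\<delta>>0. B e \<inter> {t - \<delta><..<t} = {}"
      using \<delta> by (intro exI[of _ \<delta>]) auto
  qed
  then have "countable (\<Union>k. B (1 / real (Suc k)))" by (intro countable_UN) auto
  moreover have "bad \<subseteq> (\<Union>k. B (1 / real (Suc k)))"
  proof
    fix t assume "t \<in> bad"
    then obtain i where i: "\<forall>\<^sub>F n in sequentially. Suc (i n) < length (\<pi> n)" "(\<lambda>n. \<pi> n ! i n) \<longlonglongrightarrow> t"
      "\<not> (\<lambda>n. f n (i n)) \<longlonglongrightarrow> fa t" and t: "0 < t" "t < T" by (auto simp: bad_def)
    obtain e where e: "e > 0" "\<not> (\<forall>\<^sub>F n in sequentially. dist (f n (i n)) (fa t) < e)"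
      using i(3) by (auto simp: tendsto_iff)
    obtain k where k: "1 / real (Suc k) < e" using e(1) nat_approx_posE by metis
    have "\<not> (\<forall>\<^sub>F n in sequentially. dist (f n (i n)) (fa t) < 1 / real (Suc k))"
    proof
      assume "\<forall>\<^sub>F n in sequentially. dist (f n (i n)) (fa t) < 1 / real (Suc k)"
      then have "\<forall>\<^sub>F n in sequentially. dist (f n (i n)) (fa t) < e"
        by eventually_elim (use k in linarith)
      then show False using e(2) by contradiction
    qed
    then have "t \<in> B (1 / real (Suc k))" using i t by (auto simp: B_def)
    then show "t \<in> (\<Union>k. B (1 / real (Suc k)))" by blast
  qed
  ultimately show ?thesis by (rule countable_subset[rotated])
qed

section \<open>Change of variables to the inverse of the integrator\<close>

definition S :: "nat \<Rightarrow> nat \<Rightarrow> real" where "S n j = (\<Sum>i<j. m n i)"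
text \<open>Cut off outside the range covered by \<open>f_bound\<close>, so that \<open>G n\<close>
  is bounded at every level \<open>u\<close>, including those where the index found is
  meaningless.\<close>

definition f' :: "nat \<Rightarrow> nat \<Rightarrow> real" where
  "f' n i = (if Suc i < length (\<pi> n) \<and> \<pi> n ! i \<le> T then f n i else 0)"
definition idx :: "nat \<Rightarrow> real \<Rightarrow> nat" where "idx n u = (LEAST j. u \<le> S n (Suc j))"
text \<open>The integrand \<open>f\<close> read along the generalised inverse of \<open>v\<^sub>n\<close>; this turns the Stieltjes sums
  into Lebesgue integrals over a fixed interval.\<close>
definition G :: "nat \<Rightarrow> real \<Rightarrow> real" where "G n u = f' n (idx n u)"
abbreviation vn :: "nat \<Rightarrow> real \<Rightarrow> real" where "vn n s \<equiv> \<Sum>i\<in>upto_idx n s. m n i"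

lemma S_mono: "i \<le> j \<Longrightarrow> S n i \<le> S n j"
  unfolding S_def by (rule sum_mono2) (auto simp: m_nonneg)

lemma idx_eq: "S n j < u \<Longrightarrow> u \<le> S n (Suc j) \<Longrightarrow> idx n u = j"
  unfolding idx_def
proof (rule Least_equality)
  fix y assume *: "S n j < u" "u \<le> S n (Suc y)"
  show "j \<le> y"
  proof (rule ccontr)
    assume "\<not> j \<le> y"
    then have "S n (Suc y) \<le> S n j" by (intro S_mono) simp
    then show False using * by simp
  qed
qed auto

text \<open>\<open>G n\<close> equals \<open>f' n j\<close> on the interval from
  \<open>S n j\<close> (excluded) to \<open>S n (Suc j)\<close>, whose length is
  \<open>m n j\<close>; the excluded endpoint is a null set.\<close>

lemma G_has_integral: "(G n has_integral (\<Sum>i<j. f' n i * m n i)) {0..S n j}"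
proof (induction j)
  case 0
  then show ?case by (simp add: S_def has_integral_refl)
next
  case (Suc j)
  have "((\<lambda>_. f' n j) has_integral (S n (Suc j) - S n j) * f' n j) {S n j..S n (Suc j)}"
    using has_integral_const_real[of "f' n j" "S n j" "S n (Suc j)"] S_mono[of j "Suc j" n] by simp
  then have "(G n has_integral (S n (Suc j) - S n j) * f' n j) {S n j..S n (Suc j)}"
    by (rule has_integral_spike_finite[of "{S n j}", rotated 2])
       (auto simp: G_def intro!: arg_cong[of _ _ "f' n"] idx_eq)
  then have "(G n has_integral (\<Sum>i<j. f' n i * m n i) + (S n (Suc j) - S n j) * f' n j) {0..S n (Suc j)}"
    by (intro has_integral_combine[OF _ _ Suc]) (use S_mono[of 0 j n] S_mono[of j "Suc j" n] in \<open>auto simp: S_def\<close>)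
  then show ?case by (simp add: S_def algebra_simps)
qed

lemma sum_has_integral:
  assumes "s \<le> T"
  shows "(G n has_integral (\<Sum>i\<in>upto_idx n s. f n i * m n i)) {0..vn n s}"
proof -
  obtain j where j: "upto_idx n s = {..<j}" by (rule sum_index_initial)
  have "(\<Sum>i<j. f n i * m n i) = (\<Sum>i<j. f' n i * m n i)"
  proof (intro sum.cong refl)
    fix i assume "i \<in> {..<j}"
    then have "i \<in> upto_idx n s" by (simp only: j)
    then show "f n i * m n i = f' n i * m n i" using assms by (simp add: f'_def)
  qed
  then show ?thesis using G_has_integral[of n j] by (simp add: S_def j)
qed

lemma G_bound: "n0 \<le> n \<Longrightarrow> \<bar>G n u\<bar> \<le> \<bar>C\<bar>"
  using f_bound[of n "idx n u"] by (auto simp: G_def f'_def)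

lemma vn_mono: "a \<le> b \<Longrightarrow> vn n a \<le> vn n b"
  by (rule sum_mono2) (auto simp: m_nonneg finite_upto_idx)

lemma idx_le:
  assumes "0 < u" "u \<le> vn n s"
  shows "Suc (idx n u) < length (\<pi> n)" "\<pi> n ! idx n u \<le> s" "u \<le> S n (Suc (idx n u))"
proof -
  obtain j where j: "upto_idx n s = {..<j}" by (rule sum_index_initial)
  have uS: "u \<le> S n j" using assms j by (simp add: S_def)
  then have "j \<noteq> 0" using assms(1) by (cases j) (auto simp: S_def)
  then obtain k where k: "j = Suc k" by (cases j) auto
  have "idx n u \<le> k" unfolding idx_def by (rule Least_le) (use uS k in simp)
  then have "idx n u \<in> upto_idx n s" unfolding j k by simp
  then show "Suc (idx n u) < length (\<pi> n)" "\<pi> n ! idx n u \<le> s" by auto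
  show "u \<le> S n (Suc (idx n u))" unfolding idx_def by (rule LeastI[of _ k]) (use uS k in simp)
qed

text \<open>With \<open>idx_le\<close> this is the adjunction between \<open>vn n\<close> and its
  generalised inverse. The bound by \<open>vn n s1\<close> guarantees that the minimum defining
  \<open>idx n u\<close> is attained.\<close>

lemma idx_greater:
  assumes "0 < u" "u \<le> vn n s1" "vn n s < u"
  shows "s < \<pi> n ! idx n u"
proof (rule ccontr)
  assume "\<not> ?thesis"
  moreover note idx_le[OF assms(1,2)]
  ultimately have mem: "idx n u \<in> upto_idx n s" by auto
  obtain j where j: "upto_idx n s = {..<j}" by (rule sum_index_initial)
  have "S n (Suc (idx n u)) \<le> S n j" by (rule S_mono) (use mem in \<open>simp add: j\<close>)
  also have "S n j = vn n s" by (simp add: S_def j)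
  finally show False using assms idx_le(3)[OF assms(1,2)] by simp
qed

lemma v_mono: "0 \<le> a \<Longrightarrow> a \<le> b \<Longrightarrow> v a \<le> v b"
  by (rule LIMSEQ_le[OF sided_limits_const(1)[OF v_lim] sided_limits_const(1)[OF v_lim]])
     (auto intro!: exI[of _ 0] vn_mono)

lemma v'_le_v: "0 < t \<Longrightarrow> v' t \<le> v t"
proof (rule LIMSEQ_le[OF sided_limits_const(2)[OF v_lim] sided_limits_const(1)[OF v_lim]])
  assume t: "0 < t"
  have "pp n (pp n t) \<le> t" for n
    using pp_le[of t n] pp_le[of "pp n t" n] pp_nonneg[of n t] t by linarith
  then show "\<exists>N. \<forall>n\<ge>N. vn n (pp n (pp n t)) \<le> vn n t" by (auto intro: vn_mono)
qed auto

text \<open>The partition point at which \<open>vn n\<close> crosses level \<open>u\<close> tends to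
  the first time \<open>t\<close> at which \<open>v\<close> reaches \<open>u\<close>. If
  \<open>t\<close> is not bad, every index sequence tending to \<open>t\<close> gives the limit
  \<open>fa t\<close>. If \<open>t\<close> is bad, the choice of \<open>u\<close> forces
  \<open>v' t < u < v t\<close>, so the crossing happens inside the atom, exactly at
  \<open>pp n t\<close>, and \<open>f_at\<close> applies.\<close>

lemma G_convergent:
  assumes u: "0 < u" "u < v t0" and t0: "0 \<le> t0" "t0 < T"
    and E: "u \<notin> v ` \<rat> \<union> v ` bad \<union> v' ` bad"
  shows "convergent (\<lambda>n. G n u)"
proof -
  define X where "X = {s. 0 \<le> s \<and> u \<le> v s}"
  define t where "t = Inf X"
  have X: "t0 \<in> X" "bdd_below X" using u t0 by (auto simp: X_def bdd_below_def)
  have t_ge: "0 \<le> t" unfolding t_def using X by (intro cInf_greatest) (auto simp: X_def)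
  have t_le: "t \<le> t0" unfolding t_def using X by (intro cInf_lower)
  have below: "v s < u" if "0 \<le> s" "s < t" for s
  proof (rule ccontr)
    assume "\<not> ?thesis"
    then have "s \<in> X" using that by (simp add: X_def)
    then have "t \<le> s" unfolding t_def using X by (intro cInf_lower)
    then show False using that by simp
  qed
  have above_le: "u \<le> v s" if "t < s" for s
  proof -
    obtain s' where "s' \<in> X" "s' < s"
      using \<open>t < s\<close> X cInf_less_iff[of X s] unfolding t_def by auto
    then show ?thesis using v_mono[of s' s] by (auto simp: X_def)
  qed
  have above: "u < v s" if ts: "t < s" for s
  proof -
    \<comment> \<open>Levels taken by \<open>v\<close> at rational times are excluded, so
      \<open>v\<close> cannot stay at level \<open>u\<close> on an interval after \<open>t\<close>.
      Without strict crossing the partition points found could drift along such a plateau.\<close>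
    obtain q where q: "q \<in> \<rat>" "t < q" "q < s" using Rats_dense_in_real[OF ts] by auto
    then have "u \<noteq> v q" using E by auto
    then show ?thesis using above_le[OF q(2)] v_mono[of q s] q t_ge by auto
  qed
  have u_le: "u \<le> v t"
    by (rule tendsto_lowerbound[OF sided_limits_at_right(1)[OF v_lim t_ge]])
       (auto simp: eventually_at_right_field intro!: exI[of _ "t + 1"] above_le)
  have t: "0 < t" using u_le v_0 u(1) t_ge by (cases "t = 0") auto
  have tT: "t < T" using t_le t0 by simp
  have v'_le: "v' t \<le> u"
    by (rule tendsto_upperbound[OF sided_limits_at_left(1)[OF v_lim t]])
       (use t in \<open>auto simp: eventually_at_left_field intro!: exI[of _ 0] less_imp_le below\<close>)
  define i where "i n = idx n u" for n
  have ev_above: "\<forall>\<^sub>F n in sequentially. u < vn n s" if "t < s" for s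
    using sided_limits_const(1)[OF v_lim, of s] above[OF that] that t
    by (intro order_tendstoD(1)) auto
  have ev_below: "\<forall>\<^sub>F n in sequentially. vn n s < u" if "0 \<le> s" "s < t" for s
    using sided_limits_const(1)[OF v_lim, of s] below[OF that] that t
    by (intro order_tendstoD(2)) auto
  have ev1: "\<forall>\<^sub>F n in sequentially. u < vn n (t + 1)" by (rule ev_above) simp
  have len: "\<forall>\<^sub>F n in sequentially. Suc (i n) < length (\<pi> n)"
    using ev1 by eventually_elim (use idx_le(1)[of u _ "t + 1"] u in \<open>auto simp: i_def\<close>)
  have lim: "(\<lambda>n. \<pi> n ! i n) \<longlonglongrightarrow> t"
  proof (rule order_tendstoI)
    fix a assume a: "a < t"
    have "\<forall>\<^sub>F n in sequentially. vn n (max 0 a) < u" by (rule ev_below) (use a t in auto)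
    with ev1 show "\<forall>\<^sub>F n in sequentially. a < \<pi> n ! i n"
    proof eventually_elim
      case (elim n)
      then show ?case using idx_greater[of u n "t + 1" "max 0 a"] u by (auto simp: i_def)
    qed
  next
    fix b assume b: "t < b"
    have "\<forall>\<^sub>F n in sequentially. u < vn n ((t + b) / 2)" by (rule ev_above) (use b in simp)
    then show "\<forall>\<^sub>F n in sequentially. \<pi> n ! i n < b"
    proof eventually_elim
      case (elim n)
      then show ?case using idx_le(2)[of u n "(t + b) / 2"] u b by (auto simp: i_def)
    qed
  qed
  have "(\<lambda>n. f n (i n)) \<longlonglongrightarrow> fa t"
  proof (cases "t \<in> bad")
    case False
    then show ?thesis using len lim t tT by (auto simp: bad_def)
  next
    case True
    \<comment> \<open>Just before \<open>pp n t\<close> the sums are still below \<open>u\<close>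
      and at \<open>pp n t\<close> they exceed it, which pins the crossing index to
      \<open>pp n t\<close>.\<close>
    then have strict: "v' t < u" "u < v t" using E u_le v'_le by (auto simp: order_less_le)
    have "(\<lambda>n. vn n (pp n t)) \<longlonglongrightarrow> v t"
      by (rule sided_limitsD(1)[OF v_lim _ right_approach_pp]) (use t in auto)
    then have "\<forall>\<^sub>F n in sequentially. u < vn n (pp n t)" using strict(2) by (rule order_tendstoD)
    moreover have "\<forall>\<^sub>F n in sequentially. vn n (pp n (pp n t)) < u"
      using sided_limits_const(2)[OF v_lim t] strict(1) by (rule order_tendstoD)
    moreover have "\<forall>\<^sub>F n in sequentially. 0 < pp n t" using eventually_pp_gt t by simp
    ultimately have "\<forall>\<^sub>F n in sequentially. Suc (i n) < length (\<pi> n) \<and> \<pi> n ! i n = pp n t"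
      using len
    proof eventually_elim
      case (elim n)
      have "\<pi> n ! i n \<le> pp n t" using idx_le(2)[of u n "pp n t"] u elim by (simp add: i_def)
      moreover have "\<not> \<pi> n ! i n < pp n t"
        using idx_greater[of u n "pp n t" "pp n (pp n t)"] u elim nth_le_pp_iff[of "pp n t" "i n" n]
        by (auto simp: i_def)
      ultimately show ?case using elim by simp
    qed
    then show ?thesis by (rule f_at[OF t tT])
  qed
  moreover have "\<forall>\<^sub>F n in sequentially. f n (i n) = G n u"
  proof -
    have "\<forall>\<^sub>F n in sequentially. \<pi> n ! i n < T" using lim tT by (rule order_tendstoD)
    with len show ?thesis by eventually_elim (auto simp: G_def f'_def i_def)
  qed
  ultimately have "(\<lambda>n. G n u) \<longlonglongrightarrow> fa t" by (rule Lim_transform_eventually)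
  then show ?thesis by (rule convergentI)
qed

text \<open>The approximating integrals run up to \<open>vn n (s n)\<close>, which varies with
  \<open>n\<close> and is eventually below \<open>L + 1\<close>; extending by 0 puts them all on one
  interval. The exceptional levels form a null set, on which the value 0 is a convention.\<close>

definition limit_integral :: "real \<Rightarrow> real" where
  "limit_integral L = integral {0..L + 1}
     (\<lambda>u. if u \<in> v ` \<rat> \<union> v ` bad \<union> v' ` bad \<union> {0, L} \<or> L < u then 0 else lim (\<lambda>n. G n u))"

text \<open>The approach \<open>s\<close> enters only through the limit \<open>L\<close> of the
  accumulated mass, so one argument covers both sides, with \<open>L\<close> equal to
  \<open>v t\<close> or \<open>v' t\<close>. The bound \<open>L \<le> v t\<close> places every level
  below \<open>L\<close> within reach of \<open>G_convergent\<close>.\<close>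

lemma sums_tendsto:
  assumes t: "0 \<le> t" "t < T" and s: "s \<longlonglongrightarrow> t" and L: "(\<lambda>n. vn n (s n)) \<longlonglongrightarrow> L" "L \<le> v t"
  shows "(\<lambda>n. \<Sum>i\<in>upto_idx n (s n). f n i * m n i) \<longlonglongrightarrow> limit_integral L"
proof -
  define E where "E = v ` \<rat> \<union> v ` bad \<union> v' ` bad \<union> {0, L}"
  have cE: "negligible E"
    unfolding E_def
    by (intro negligible_countable countable_Un countable_image countable_bad countable_rat) auto
  \<comment> \<open>Setting the integrands to 0 on the null set \<open>E\<close> turns convergence
    almost everywhere into convergence at every point, the form in which dominated convergence is
    applied.\<close>
  define H where "H n u = (if u \<in> E then 0 else if u \<in> {0..vn n (s n)} then G n u else 0)" for n u
  define h where "h u = (if u \<in> E \<or> L < u then 0 else lim (\<lambda>n. G n u))" for u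
  have "\<forall>\<^sub>F n in sequentially. s n < T" using s t(2) by (rule order_tendstoD)
  moreover have "\<forall>\<^sub>F n in sequentially. vn n (s n) < L + 1" using L(1) by (rule order_tendstoD) simp
  ultimately have "\<forall>\<^sub>F n in sequentially. n0 \<le> n \<and> s n < T \<and> vn n (s n) < L + 1"
    using eventually_ge_at_top[of n0] by eventually_elim simp
  then obtain N where N: "\<And>n. N \<le> n \<Longrightarrow> n0 \<le> n \<and> s n < T \<and> vn n (s n) < L + 1"
    by (auto simp: eventually_sequentially)
  have H_int: "(H n has_integral (\<Sum>i\<in>upto_idx n (s n). f n i * m n i)) {0..L + 1}" if "N \<le> n" for n
  proof -
    have "((\<lambda>u. if u \<in> {0..vn n (s n)} then G n u else 0) has_integral
        (\<Sum>i\<in>upto_idx n (s n). f n i * m n i)) {0..L + 1}"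
      using sum_has_integral[of "s n" n] N[OF that] by (subst has_integral_restrict) auto
    then show ?thesis by (rule has_integral_spike[OF cE, rotated]) (auto simp: H_def)
  qed
  have "(\<lambda>k. integral {0..L + 1} (H (k + N))) \<longlonglongrightarrow> integral {0..L + 1} h"
  proof (rule dominated_convergence(2)[where h = "\<lambda>_. \<bar>C\<bar>"])
    show "H (k + N) integrable_on {0..L + 1}" for k
      using H_int[of "k + N"] by auto
    show "(\<lambda>_. \<bar>C\<bar>) integrable_on {0..L + 1}" by (rule integrable_const_ivl)
    show "norm (H (k + N) u) \<le> \<bar>C\<bar>" for k u
      using G_bound[of "k + N" u] N[of "k + N"] by (auto simp: H_def)
    show "(\<lambda>k. H (k + N) u) \<longlonglongrightarrow> h u" if u: "u \<in> {0..L + 1}" for u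
    proof -
      have "(\<lambda>n. H n u) \<longlonglongrightarrow> h u"
      proof (cases "u \<in> E")
        case False
        then have uE: "u \<noteq> 0" "u \<noteq> L" "u \<notin> v ` \<rat> \<union> v ` bad \<union> v' ` bad" by (auto simp: E_def)
        show ?thesis
        proof (cases "u < L")
          case True
          have "(\<lambda>n. G n u) \<longlonglongrightarrow> lim (\<lambda>n. G n u)"
            using G_convergent[of u t] uE u True L(2) t by (simp add: convergent_LIMSEQ_iff)
          moreover have "\<forall>\<^sub>F n in sequentially. G n u = H n u"
          proof -
            have "\<forall>\<^sub>F n in sequentially. u < vn n (s n)" using L(1) True by (rule order_tendstoD)
            then show ?thesis by eventually_elim (use u False in \<open>auto simp: H_def\<close>)
          qed
          moreover have "h u = lim (\<lambda>n. G n u)" using True False by (simp add: h_def)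
          ultimately show ?thesis by (simp add: Lim_transform_eventually)
        next
          case nl: False
          have "\<forall>\<^sub>F n in sequentially. vn n (s n) < u"
            using L(1) by (rule order_tendstoD) (use nl uE in auto)
          then have "\<forall>\<^sub>F n in sequentially. H n u = h u"
            by eventually_elim (use nl uE in \<open>auto simp: H_def h_def\<close>)
          then show ?thesis by (rule tendsto_eventually)
        qed
      qed (auto simp: H_def h_def)
      then show ?thesis by (rule LIMSEQ_ignore_initial_segment)
    qed
  qed
  moreover have "integral {0..L + 1} (H (k + N)) = (\<Sum>i\<in>upto_idx (k + N) (s (k + N)). f (k + N) i * m (k + N) i)" for k
    by (rule integral_unique, rule H_int) simp
  ultimately have "(\<lambda>k. \<Sum>i\<in>upto_idx (k + N) (s (k + N)). f (k + N) i * m (k + N) i) \<longlonglongrightarrow> integral {0..L + 1} h"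
    by simp
  then show ?thesis unfolding limit_integral_def h_def E_def by (rule LIMSEQ_offset[where k = N])
qed

lemma sums_sided_limits:
  obtains A B where
    "\<And>t s. 0 \<le> t \<Longrightarrow> t < T \<Longrightarrow> right_approach t s \<Longrightarrow>
      (\<lambda>n. \<Sum>i\<in>upto_idx n (s n). f n i * m n i) \<longlonglongrightarrow> A t"
    "\<And>t s. 0 < t \<Longrightarrow> t < T \<Longrightarrow> left_approach t s \<Longrightarrow>
      (\<lambda>n. \<Sum>i\<in>upto_idx n (s n). f n i * m n i) \<longlonglongrightarrow> B t"
proof
  fix t s assume "0 \<le> t" "t < T" "right_approach t s"
  then show "(\<lambda>n. \<Sum>i\<in>upto_idx n (s n). f n i * m n i) \<longlonglongrightarrow> limit_integral (v t)"
    by (intro sums_tendsto sided_limitsD(1)[OF v_lim]) (auto simp: right_approach_def)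
next
  fix t s assume "0 < t" "t < T" "left_approach t s"
  then show "(\<lambda>n. \<Sum>i\<in>upto_idx n (s n). f n i * m n i) \<longlonglongrightarrow> limit_integral (v' t)"
    by (intro sums_tendsto[of t] sided_limitsD(2)[OF v_lim] v'_le_v) (auto simp: left_approach_def)
qed

end

section \<open>Closure properties of sided convergence before a fixed time\<close>

context partition_seq begin

text \<open>Unlike \<open>sided_limits\<close>, this only concerns times before \<open>T\<close>, so that bounds on \<open>[0,T]\<close> suffice.\<close>

definition sided_limits_before ::
    "real \<Rightarrow> (nat \<Rightarrow> real \<Rightarrow> real) \<Rightarrow> (real \<Rightarrow> real) \<Rightarrow> (real \<Rightarrow> real) \<Rightarrow> bool" where
  "sided_limits_before T a A B \<longleftrightarrow>
     (\<forall>t s. 0 \<le> t \<and> t < T \<and> right_approach t s \<longrightarrow> (\<lambda>n. a n (s n)) \<longlonglongrightarrow> A t) \<and>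
     (\<forall>t s. 0 < t \<and> t < T \<and> left_approach t s \<longrightarrow> (\<lambda>n. a n (s n)) \<longlonglongrightarrow> B t)"

definition sided_conv :: "real \<Rightarrow> (nat \<Rightarrow> real \<Rightarrow> real) \<Rightarrow> bool" where
  "sided_conv T a \<longleftrightarrow> (\<exists>A B. sided_limits_before T a A B)"

lemma sided_limits_beforeD:
  assumes "sided_limits_before T a A B"
  shows "0 \<le> t \<Longrightarrow> t < T \<Longrightarrow> right_approach t s \<Longrightarrow> (\<lambda>n. a n (s n)) \<longlonglongrightarrow> A t"
    "0 < t \<Longrightarrow> t < T \<Longrightarrow> left_approach t s \<Longrightarrow> (\<lambda>n. a n (s n)) \<longlonglongrightarrow> B t"
  using assms unfolding sided_limits_before_def by simp_all

lemma sided_convI: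
  assumes "\<And>t s. 0 \<le> t \<Longrightarrow> t < T \<Longrightarrow> right_approach t s \<Longrightarrow> (\<lambda>n. a n (s n)) \<longlonglongrightarrow> A t"
    and "\<And>t s. 0 < t \<Longrightarrow> t < T \<Longrightarrow> left_approach t s \<Longrightarrow> (\<lambda>n. a n (s n)) \<longlonglongrightarrow> B t"
  shows "sided_conv T a"
  unfolding sided_conv_def sided_limits_before_def
  by (intro exI[of _ A] exI[of _ B] conjI allI impI; elim conjE; rule assms; assumption)

lemma sided_conv_add:
  assumes "sided_conv T a" "sided_conv T b"
  shows "sided_conv T (\<lambda>n s. a n s + b n s)"
proof -
  obtain A A' B B' where "sided_limits_before T a A A'" "sided_limits_before T b B B'"
    using assms unfolding sided_conv_def by blast
  note lims = this[THEN sided_limits_beforeD(1)] this[THEN sided_limits_beforeD(2)]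
  show ?thesis
    by (rule sided_convI[where A = "\<lambda>t. A t + B t" and B = "\<lambda>t. A' t + B' t"])
       (intro tendsto_add lims; assumption)+
qed

lemma sided_conv_cmult:
  assumes "sided_conv T a"
  shows "sided_conv T (\<lambda>n s. c * a n s)"
proof -
  obtain A A' where "sided_limits_before T a A A'"
    using assms unfolding sided_conv_def by blast
  note lims = sided_limits_beforeD[OF this]
  show ?thesis
    by (rule sided_convI[where A = "\<lambda>t. c * A t" and B = "\<lambda>t. c * A' t"])
       (intro tendsto_mult_left lims; assumption)+
qed

lemma sided_conv_diff: "sided_conv T a \<Longrightarrow> sided_conv T b \<Longrightarrow> sided_conv T (\<lambda>n s. a n s - b n s)"
  using sided_conv_add[OF _ sided_conv_cmult[where c = "-1"]] by force

lemma sided_conv_const: "z \<longlonglongrightarrow> L \<Longrightarrow> sided_conv T (\<lambda>n s. z n)"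
  by (rule sided_convI[where A = "\<lambda>_. L" and B = "\<lambda>_. L"])

lemma sided_conv_sum:
  assumes "finite I" "\<And>k. k \<in> I \<Longrightarrow> sided_conv T (a k)"
  shows "sided_conv T (\<lambda>n s. \<Sum>k\<in>I. a k n s)"
  using assms
proof (induction I)
  case empty
  show ?case using sided_conv_const[OF tendsto_const, of T 0] by simp
next
  case (insert k I)
  then show ?case by (simp add: sided_conv_add)
qed

lemma sided_conv_cong:
  assumes a: "sided_conv T a" and eq: "\<forall>\<^sub>F n in sequentially. \<forall>s. 0 \<le> s \<and> s < T \<longrightarrow> a n s = b n s"
  shows "sided_conv T b"
proof -
  obtain A A' where "sided_limits_before T a A A'"
    using a unfolding sided_conv_def by blast
  note A = sided_limits_beforeD[OF this]
  have ev: "\<forall>\<^sub>F n in sequentially. a n (s n) = b n (s n)" if "s \<longlonglongrightarrow> t" "t < T" "\<forall>n. 0 \<le> s n" for s t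
  proof -
    have "\<forall>\<^sub>F n in sequentially. s n < T" using that(1,2) by (rule order_tendstoD)
    with eq show ?thesis by eventually_elim (use that in auto)
  qed
  show ?thesis
  proof (rule sided_convI)
    fix t s assume t: "0 \<le> t" "t < T" and s: "right_approach t s"
    show "(\<lambda>n. b n (s n)) \<longlonglongrightarrow> A t"
      by (rule Lim_transform_eventually[OF A(1)[OF t s] ev]) (use s t in \<open>auto simp: right_approach_def\<close>)
  next
    fix t s assume t: "0 < t" "t < T" and s: "left_approach t s"
    show "(\<lambda>n. b n (s n)) \<longlonglongrightarrow> A' t"
      by (rule Lim_transform_eventually[OF A(2)[OF t s] ev]) (use s t in \<open>auto simp: left_approach_def\<close>)
  qed
qed

text \<open>The limit functions for different horizons are never compared: at time \<open>t\<close>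
  those of the horizon \<open>t + 1\<close> are used.\<close>

lemma sided_conv_imp_limits:
  assumes "\<And>T. sided_conv T a"
  obtains A B where "sided_limits a A B"
proof -
  obtain A B where "\<And>T. sided_limits_before T a (A T) (B T)"
    using assms unfolding sided_conv_def by metis
  then have "sided_limits a (\<lambda>t. A (t + 1) t) (\<lambda>t. B (t + 1) t)"
    unfolding sided_limits_def sided_limits_before_def by simp
  then show ?thesis by (rule that)
qed

lemma stieltjes_conv:
  assumes "\<And>n i. 0 \<le> m n i"
    and "sided_limits (\<lambda>n s. \<Sum>i\<in>upto_idx n s. m n i) v v'"
    and "v 0 = 0"
    and "\<And>t i. \<lbrakk>0 < t; t < T; \<forall>\<^sub>F n in sequentially. Suc (i n) < length (\<pi> n) \<and> \<pi> n ! i n = pp n t\<rbrakk>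
      \<Longrightarrow> (\<lambda>n. f n (i n)) \<longlonglongrightarrow> fa t"
    and "\<And>t i. \<lbrakk>0 < t; t < T; (\<lambda>n. \<pi> n ! i n) \<longlonglongrightarrow> t;
        \<forall>\<^sub>F n in sequentially. Suc (i n) < length (\<pi> n) \<and> \<pi> n ! i n < pp n t\<rbrakk>
      \<Longrightarrow> (\<lambda>n. f n (i n)) \<longlonglongrightarrow> fl t"
    and "\<And>n i. \<lbrakk>n0 \<le> n; Suc i < length (\<pi> n); \<pi> n ! i \<le> T\<rbrakk> \<Longrightarrow> \<bar>f n i\<bar> \<le> C"
  shows "sided_conv T (\<lambda>n s. \<Sum>i\<in>upto_idx n s. f n i * m n i)"
proof -
  interpret stieltjes \<pi> m f v v' fa fl C T n0
    by unfold_locales (fact assms)+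
  show ?thesis by (rule sums_sided_limits) (rule sided_convI; assumption)
qed

end

section \<open>Cadlag paths and their quadratic variation\<close>

lemma cadlag_right: "x \<in> cadlag \<Longrightarrow> 0 \<le> t \<Longrightarrow> (x \<longlongrightarrow> x t) (at_right t)"
  by (simp add: cadlag_def)

lemma cadlag_left: "x \<in> cadlag \<Longrightarrow> 0 < t \<Longrightarrow> (x \<longlongrightarrow> left_lim x t) (at_left t)"
  unfolding cadlag_def left_lim_def by (auto simp: tendsto_Lim)

lemma cadlag_right_ball:
  assumes "x \<in> cadlag" "0 \<le> t" "e > 0"
  obtains \<delta> where "\<delta> > 0" "\<And>s. t \<le> s \<Longrightarrow> s < t + \<delta> \<Longrightarrow> dist (x s) (x t) < e"
proof -
  have "\<forall>\<^sub>F s in at_right t. dist (x s) (x t) < e"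
    using cadlag_right[OF assms(1,2)] assms(3) by (rule tendstoD)
  then obtain b where b: "b > t" "\<And>s. t < s \<Longrightarrow> s < b \<Longrightarrow> dist (x s) (x t) < e"
    by (auto simp: eventually_at_right_field)
  show ?thesis
  proof
    show "dist (x s) (x t) < e" if "t \<le> s" "s < t + (b - t)" for s
      using b(2)[of s] that assms(3) by (cases "s = t") auto
  qed (use b in simp)
qed

lemma cadlag_left_ball:
  assumes "x \<in> cadlag" "0 < t" "e > 0"
  obtains \<delta> where "\<delta> > 0" "\<And>s. t - \<delta> < s \<Longrightarrow> s < t \<Longrightarrow> dist (x s) (left_lim x t) < e"
proof -
  have "\<forall>\<^sub>F s in at_left t. dist (x s) (left_lim x t) < e"
    using cadlag_left[OF assms(1,2)] assms(3) by (rule tendstoD)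
  then obtain b where b: "b < t" "\<And>s. b < s \<Longrightarrow> s < t \<Longrightarrow> dist (x s) (left_lim x t) < e"
    by (auto simp: eventually_at_left_field)
  show ?thesis
    by (rule that[of "t - b"]) (use b in auto)
qed

lemma cadlag_seq_right:
  assumes "x \<in> cadlag" "0 \<le> t" "s \<longlonglongrightarrow> t" "\<forall>\<^sub>F n in sequentially. t \<le> s n"
  shows "(\<lambda>n. x (s n)) \<longlonglongrightarrow> x t"
proof (rule tendstoI)
  fix e :: real assume "e > 0"
  then obtain \<delta> where \<delta>: "\<delta> > 0" "\<And>s. t \<le> s \<Longrightarrow> s < t + \<delta> \<Longrightarrow> dist (x s) (x t) < e"
    using cadlag_right_ball assms by metis
  have "\<forall>\<^sub>F n in sequentially. s n < t + \<delta>" using assms(3) by (rule order_tendstoD) (use \<delta> in simp)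
  with assms(4) show "\<forall>\<^sub>F n in sequentially. dist (x (s n)) (x t) < e"
    by eventually_elim (rule \<delta>)
qed

lemma cadlag_seq_left:
  assumes "x \<in> cadlag" "0 < t" "s \<longlonglongrightarrow> t" "\<forall>\<^sub>F n in sequentially. s n < t"
  shows "(\<lambda>n. x (s n)) \<longlonglongrightarrow> left_lim x t"
proof (rule tendstoI)
  fix e :: real assume "e > 0"
  then obtain \<delta> where \<delta>: "\<delta> > 0" "\<And>s. t - \<delta> < s \<Longrightarrow> s < t \<Longrightarrow> dist (x s) (left_lim x t) < e"
    using cadlag_left_ball assms by metis
  have "\<forall>\<^sub>F n in sequentially. t - \<delta> < s n" using assms(3) by (rule order_tendstoD) (use \<delta> in simp)
  then show "\<forall>\<^sub>F n in sequentially. dist (x (s n)) (left_lim x t) < e"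
    using assms(4) by eventually_elim (rule \<delta>)
qed

lemma cadlag_seq_cont:
  assumes x: "x \<in> cadlag" and t: "0 \<le> t" and s: "s \<longlonglongrightarrow> t" "\<And>n. 0 \<le> s n"
    and cont: "left_lim x t = x t"
  shows "(\<lambda>n. x (s n)) \<longlonglongrightarrow> x t"
proof (cases "t = 0")
  case True
  then show ?thesis using cadlag_seq_right[OF x t s(1)] s(2) by simp
next
  case False
  show ?thesis
  proof (rule tendstoI)
    fix e :: real assume e: "e > 0"
    obtain \<delta> where \<delta>: "\<delta> > 0" "\<And>s. t \<le> s \<Longrightarrow> s < t + \<delta> \<Longrightarrow> dist (x s) (x t) < e"
      using cadlag_right_ball[OF x t e] by metis
    obtain \<delta>' where \<delta>': "\<delta>' > 0" "\<And>s. t - \<delta>' < s \<Longrightarrow> s < t \<Longrightarrow> dist (x s) (left_lim x t) < e"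
      using cadlag_left_ball[OF x _ e] False t by (metis order_le_less)
    have "\<forall>\<^sub>F n in sequentially. t - \<delta>' < s n" using s(1) by (rule order_tendstoD) (use \<delta>' in simp)
    moreover have "\<forall>\<^sub>F n in sequentially. s n < t + \<delta>" using s(1) by (rule order_tendstoD) (use \<delta> in simp)
    ultimately show "\<forall>\<^sub>F n in sequentially. dist (x (s n)) (x t) < e"
    proof eventually_elim
      case (elim n)
      then show ?case using \<delta>(2)[of "s n"] \<delta>'(2)[of "s n"] cont by (cases "t \<le> s n") auto
    qed
  qed
qed

lemma cadlag_small_increments:
  assumes x: "x \<in> cadlag" and t: "0 \<le> t" and e: "e > 0"
  obtains \<delta> where "\<delta> > 0"
    "\<And>y z. \<bar>y - t\<bar> < \<delta> \<Longrightarrow> \<bar>z - t\<bar> < \<delta> \<Longrightarrow> t \<le> y \<and> t \<le> z \<or> 0 \<le> y \<and> 0 \<le> z \<and> y < t \<and> z < t \<Longrightarrow>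
      norm (x z - x y) < e"
proof -
  have e2: "e / 2 > 0" using e by simp
  obtain d1 where d1: "d1 > 0" "\<And>s. t \<le> s \<Longrightarrow> s < t + d1 \<Longrightarrow> dist (x s) (x t) < e / 2"
    using cadlag_right_ball[OF x t e2] by metis
  obtain d2 where d2: "d2 > 0" "\<And>s. 0 \<le> s \<Longrightarrow> t - d2 < s \<Longrightarrow> s < t \<Longrightarrow> dist (x s) (left_lim x t) < e / 2"
  proof (cases "t > 0")
    case True
    then show ?thesis using cadlag_left_ball[OF x _ e2, of t] that by metis
  next
    case False
    \<comment> \<open>At \<open>t = 0\<close> there is no time in \<open>0 \<le> s < t\<close>, so
      any radius serves.\<close>
    then show ?thesis by (intro that[of 1]) auto
  qed
  show ?thesis
  proof (rule that[of "min d1 d2"])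
    fix y z assume yz: "\<bar>y - t\<bar> < min d1 d2" "\<bar>z - t\<bar> < min d1 d2"
      "t \<le> y \<and> t \<le> z \<or> 0 \<le> y \<and> 0 \<le> z \<and> y < t \<and> z < t"
    obtain c where "dist (x y) c < e / 2" "dist (x z) c < e / 2"
      using yz d1(2)[of y] d1(2)[of z] d2(2)[of y] d2(2)[of z] by (auto simp: abs_less_iff)
    then have "dist (x z) (x y) < e" by (rule dist_triangle_half_l[OF _ , rotated])
    then show "norm (x z - x y) < e" by (simp add: dist_norm)
  qed (use d1 d2 in auto)
qed

text \<open>Bisection reduces boundedness to short intervals around a time \<open>t\<close>, where
  all values lie near \<open>x t\<close> or near one reference value to the left of
  \<open>t\<close>.\<close>

lemma cadlag_bounded:
  fixes x :: "real \<Rightarrow> 'a::real_normed_vector"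
  assumes x: "x \<in> cadlag"
  obtains B where "B > 0" "\<And>t. t \<le> T \<Longrightarrow> norm (x t) \<le> B"
proof -
  have neg: "x t = 0" if "t < 0" for t using x that by (simp add: cadlag_def)
  have "bounded (x ` {0..max 0 T})"
  proof (rule Bolzano[where P = "\<lambda>a b. bounded (x ` {a..b})"])
    show "bounded (x ` {a..c})" if "bounded (x ` {a..b})" "bounded (x ` {b..c})" "a \<le> b" "b \<le> c" for a b c
    proof -
      have "x ` {a..c} = x ` {a..b} \<union> x ` {b..c}"
        using that by (simp add: image_Un[symmetric] ivl_disj_un_two_touch)
      then show ?thesis using that by simp
    qed
    show "\<exists>d>0. \<forall>a b. a \<le> t \<and> t \<le> b \<and> b - a < d \<longrightarrow> bounded (x ` {a..b})" if t: "0 \<le> t" "t \<le> max 0 T" for t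
    proof -
      obtain d where d: "d > 0" "\<And>y z. \<bar>y - t\<bar> < d \<Longrightarrow> \<bar>z - t\<bar> < d \<Longrightarrow>
          t \<le> y \<and> t \<le> z \<or> 0 \<le> y \<and> 0 \<le> z \<and> y < t \<and> z < t \<Longrightarrow> norm (x z - x y) < 1"
        using cadlag_small_increments[OF x t(1) zero_less_one] by metis
      \<comment> \<open>The reference point to the left of \<open>t\<close>: close enough for
        \<open>cadlag_small_increments\<close>, and kept nonnegative. For \<open>t = 0\<close> it
        equals \<open>t\<close>, and the case that uses it is empty.\<close>
      define w where "w = max 0 (t - d / 2)"
      have "bounded (x ` {a..b})" if ab: "a \<le> t" "t \<le> b" "b - a < d" for a b
        unfolding bounded_iff
      proof (intro exI ballI)
        fix y assume "y \<in> x ` {a..b}"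
        then obtain s where s: "y = x s" "a \<le> s" "s \<le> b" by auto
        have b: "norm (x s) \<le> norm c + 1" if "norm (x s - c) < 1" for c
          using that norm_triangle_sub[of "x s" c] by linarith
        consider "s < 0" | "t \<le> s" | "0 \<le> s" "s < t" by linarith
        then show "norm y \<le> norm (x t) + norm (x w) + 1"
        proof cases
          case 1 then show ?thesis using neg s by simp
        next
          case 2
          then have "norm (x s - x t) < 1" using d(2)[of t s] s ab d(1) by auto
          from b[OF this] norm_ge_zero[of "x w"] show ?thesis unfolding s(1) by linarith
        next
          case 3
          then have "norm (x s - x w) < 1" using d(2)[of w s] s ab d(1) by (auto simp: w_def)
          from b[OF this] norm_ge_zero[of "x t"] show ?thesis unfolding s(1) by linarith
        qed
      qed
      then show ?thesis using d(1) by blast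
    qed
  qed simp
  then obtain B where B: "B > 0" "\<And>t. 0 \<le> t \<Longrightarrow> t \<le> max 0 T \<Longrightarrow> norm (x t) \<le> B"
    unfolding bounded_pos by auto
  show ?thesis
  proof
    show "norm (x t) \<le> B" if "t \<le> T" for t using B neg[of t] that by (cases "t < 0") auto
  qed (rule B)
qed

section \<open>Increments along the partitions and their squares\<close>

abbreviation outer :: "real^'m \<Rightarrow> real^'m^'m" where "outer d \<equiv> (\<chi> a b. d $ a * d $ b)"

lemma outer_tendsto: "(f \<longlongrightarrow> d) F \<Longrightarrow> ((\<lambda>n. outer (f n)) \<longlongrightarrow> outer d) F"
  by (intro tendsto_vec_lambda tendsto_mult tendsto_vec_nth)

lemma outer_0: "outer 0 = 0"
  by (simp add: vec_eq_iff)

context partition_seq begin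

abbreviation dx :: "(real \<Rightarrow> 'a::real_normed_vector) \<Rightarrow> nat \<Rightarrow> nat \<Rightarrow> 'a" where
  "dx x n i \<equiv> x (\<pi> n ! Suc i) - x (\<pi> n ! i)"

lemma discrete_qv_eq: "discrete_qv \<pi> n x t = (\<Sum>i\<in>upto_idx n t. outer (dx x n i))"
  by (simp add: discrete_qv_def)

lemma Suc_le_pp: "0 < t \<Longrightarrow> Suc i < length (\<pi> n) \<Longrightarrow> \<pi> n ! i < pp n t \<Longrightarrow> \<pi> n ! Suc i \<le> pp n t"
proof -
  assume a: "0 < t" "Suc i < length (\<pi> n)" "\<pi> n ! i < pp n t"
  obtain k where k: "k < length (\<pi> n)" "\<pi> n ! k = pp n t"
    using pp_max(1)[OF a(1), of n] by (auto simp: in_set_conv_nth)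
  then show ?thesis using a nth_less_iff[of i n k] nth_le_iff[of "Suc i" n k] by simp
qed

text \<open>Among the partition intervals near a positive time \<open>t\<close>, only the one
  starting at \<open>pp n t\<close> has its left end before \<open>t\<close> and its right end at or
  after \<open>t\<close>. All others stay on one side of \<open>t\<close>, where the path oscillates
  little.\<close>

lemma dx_small:
  assumes x: "x \<in> cadlag" and t: "0 \<le> t" and e: "e > 0"
  obtains \<delta> where "\<delta> > 0"
    "\<And>n i. \<lbrakk>Suc i < length (\<pi> n); dist (\<pi> n ! i) t < \<delta>; dist (\<pi> n ! Suc i) t < \<delta>;
      t \<le> \<pi> n ! i \<or> 0 < t \<and> \<pi> n ! i < pp n t\<rbrakk> \<Longrightarrow> norm (dx x n i) < e"
proof -
  obtain \<delta> where \<delta>: "\<delta> > 0"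
    "\<And>y z. \<bar>y - t\<bar> < \<delta> \<Longrightarrow> \<bar>z - t\<bar> < \<delta> \<Longrightarrow> t \<le> y \<and> t \<le> z \<or> 0 \<le> y \<and> 0 \<le> z \<and> y < t \<and> z < t \<Longrightarrow>
      norm (x z - x y) < e" using cadlag_small_increments[OF x t e] by metis
  show ?thesis
  proof (rule that[OF \<delta>(1)])
    fix n i assume i: "Suc i < length (\<pi> n)" "dist (\<pi> n ! i) t < \<delta>" "dist (\<pi> n ! Suc i) t < \<delta>"
      "t \<le> \<pi> n ! i \<or> 0 < t \<and> \<pi> n ! i < pp n t"
    have lt: "\<pi> n ! i < \<pi> n ! Suc i" and ge: "0 \<le> \<pi> n ! i"
      using i(1) nth_less_iff[of i n "Suc i"] nth_nonneg[of i n] by auto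
    have "t \<le> \<pi> n ! i \<or> \<pi> n ! Suc i < t"
      using i Suc_le_pp[of t i n] pp_max(2)[of t n] by force
    then show "norm (dx x n i) < e"
      using \<delta>(2)[of "\<pi> n ! i" "\<pi> n ! Suc i"] i(2,3) lt ge by (auto simp: dist_real_def)
  qed
qed

lemma dx_tendsto_0:
  assumes x: "x \<in> cadlag" and t: "0 \<le> t" and i: "(\<lambda>n. \<pi> n ! i n) \<longlonglongrightarrow> t"
    "\<forall>\<^sub>F n in sequentially. Suc (i n) < length (\<pi> n) \<and> (t \<le> \<pi> n ! i n \<or> 0 < t \<and> \<pi> n ! i n < pp n t)"
  shows "(\<lambda>n. dx x n (i n)) \<longlonglongrightarrow> 0"
proof (rule tendstoI)
  fix e :: real assume "e > 0"
  from dx_small[OF x t this] obtain \<delta> where \<delta>: "\<delta> > 0"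
    "\<And>n i. \<lbrakk>Suc i < length (\<pi> n); dist (\<pi> n ! i) t < \<delta>; dist (\<pi> n ! Suc i) t < \<delta>;
      t \<le> \<pi> n ! i \<or> 0 < t \<and> \<pi> n ! i < pp n t\<rbrakk> \<Longrightarrow> norm (dx x n i) < e" by blast
  have len: "\<forall>\<^sub>F n in sequentially. Suc (i n) < length (\<pi> n)" using i(2) by eventually_elim auto
  show "\<forall>\<^sub>F n in sequentially. dist (dx x n (i n)) 0 < e"
    using tendstoD[OF i(1) \<delta>(1)] tendstoD[OF nth_Suc_tendsto[OF i(1) len] \<delta>(1)] i(2)
    by eventually_elim (simp add: \<delta>(2))
qed

lemma dx_tendsto_jump:
  assumes x: "x \<in> cadlag" and t: "0 < t"
    and i: "\<forall>\<^sub>F n in sequentially. Suc (i n) < length (\<pi> n) \<and> \<pi> n ! i n = pp n t"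
  shows "(\<lambda>n. x (\<pi> n ! Suc (i n))) \<longlonglongrightarrow> x t" "(\<lambda>n. x (\<pi> n ! i n)) \<longlonglongrightarrow> left_lim x t"
    "(\<lambda>n. dx x n (i n)) \<longlonglongrightarrow> jump x t" "(\<lambda>n. \<pi> n ! i n) \<longlonglongrightarrow> t"
proof -
  have pp: "(\<lambda>n. pp n t) \<longlonglongrightarrow> t" by (rule pp_tendsto) (use t in auto)
  show i_lim: "(\<lambda>n. \<pi> n ! i n) \<longlonglongrightarrow> t"
    by (rule Lim_transform_eventually[OF pp]) (use i in \<open>auto elim: eventually_mono\<close>)
  have len: "\<forall>\<^sub>F n in sequentially. Suc (i n) < length (\<pi> n)" using i by eventually_elim auto
  have "\<forall>\<^sub>F n in sequentially. t \<le> \<pi> n ! Suc (i n)"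
    using i
  proof eventually_elim
    case (elim n)
    then show ?case
      using nth_less_iff[of "i n" n "Suc (i n)"] pp_max(3)[OF t, of "\<pi> n ! Suc (i n)" n] by fastforce
  qed
  then show 1: "(\<lambda>n. x (\<pi> n ! Suc (i n))) \<longlonglongrightarrow> x t"
    by (intro cadlag_seq_right[OF x] nth_Suc_tendsto[OF i_lim len]) (use t in auto)
  have "\<forall>\<^sub>F n in sequentially. \<pi> n ! i n < t"
    using i by eventually_elim (use pp_max(2)[OF t] in auto)
  then show 2: "(\<lambda>n. x (\<pi> n ! i n)) \<longlonglongrightarrow> left_lim x t"
    by (intro cadlag_seq_left[OF x t i_lim])
  show "(\<lambda>n. dx x n (i n)) \<longlonglongrightarrow> jump x t"
    unfolding jump_def by (intro tendsto_diff 1 2)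
qed

lemma upto_idx_0:
  "\<forall>\<^sub>F n in sequentially. Suc 0 < length (\<pi> n) \<and> upto_idx n 0 = {0}"
  using eventually_last[of 0]
proof eventually_elim
  case (elim n)
  have "Suc 0 < length (\<pi> n)"
  proof (rule ccontr)
    assume "\<not> ?thesis"
    then have "length (\<pi> n) = 1" using nonempty[of n] by (cases "\<pi> n") auto
    then have "last (\<pi> n) = \<pi> n ! 0" using nonempty[of n] by (simp add: last_conv_nth)
    then show False using elim nth_0 by simp
  qed
  moreover have "i = 0" if "Suc i < length (\<pi> n)" "\<pi> n ! i \<le> 0" for i
    using nth_pos[of i n] that by (cases i) auto
  ultimately show ?case using nth_0[of n] by auto
qed

lemma dx_0_tendsto_0:
  assumes "x \<in> cadlag" shows "(\<lambda>n. dx x n 0) \<longlonglongrightarrow> 0"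
proof (rule dx_tendsto_0[OF assms order_refl])
  show "(\<lambda>n. \<pi> n ! 0) \<longlonglongrightarrow> 0" by (simp add: nth_0)
  show "\<forall>\<^sub>F n in sequentially. Suc 0 < length (\<pi> n) \<and> (0 \<le> \<pi> n ! 0 \<or> (0::real) < 0 \<and> \<pi> n ! 0 < pp n 0)"
    using upto_idx_0 by eventually_elim (simp add: nth_0)
qed

text \<open>No partition point lies strictly between \<open>b\<close> and \<open>p\<close>. The time
  \<open>p\<close> need not be a partition point itself; then the right-hand side is an empty
  sum.\<close>

lemma sum_upto_idx_step:
  fixes g :: "nat \<Rightarrow> 'a::ab_group_add"
  assumes "0 < p" "b < p" "pp n p \<le> b"
  shows "(\<Sum>i\<in>upto_idx n p. g i) - (\<Sum>i\<in>upto_idx n b. g i) = (\<Sum>i | Suc i < length (\<pi> n) \<and> \<pi> n ! i = p. g i)"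
proof -
  have "upto_idx n p = upto_idx n b \<union> {i. Suc i < length (\<pi> n) \<and> \<pi> n ! i = p}"
  proof (rule set_eqI)
    fix i
    have "\<pi> n ! i \<le> p \<longleftrightarrow> \<pi> n ! i \<le> b \<or> \<pi> n ! i = p" if "Suc i < length (\<pi> n)"
      using pp_max(3)[OF assms(1), of "\<pi> n ! i" n] assms that by force
    then show "i \<in> upto_idx n p \<longleftrightarrow> i \<in> upto_idx n b \<union> {i. Suc i < length (\<pi> n) \<and> \<pi> n ! i = p}"
      by blast
  qed
  moreover have "upto_idx n b \<inter> {i. Suc i < length (\<pi> n) \<and> \<pi> n ! i = p} = {}" using assms by auto
  moreover have "finite {i. Suc i < length (\<pi> n) \<and> \<pi> n ! i = p}"
    by (rule finite_subset[OF _ finite_upto_idx[of n p]]) auto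
  ultimately show ?thesis by (simp add: sum.union_disjoint finite_upto_idx)
qed

text \<open>In the limit \<open>discrete_qv\<close> at \<open>s n\<close> equals \<open>q\<close> at
  the pulled-back time \<open>\<eta> n (s n)\<close>, so all depends on which side of
  \<open>t\<close> that time lies, that is, on comparing \<open>s n\<close> with
  \<open>\<theta> n t\<close>. At a jump time of \<open>q\<close> eventually
  \<open>\<theta> n t = pp n t\<close>, which is the comparison in the definition of the two
  approaches; at a continuity time the side is irrelevant.\<close>

lemma J1_sided_limits:
  fixes x :: "real \<Rightarrow> real^'m"
  assumes x: "x \<in> cadlag" and q: "q \<in> cadlag" and J1: "J1_converges (\<lambda>n. discrete_qv \<pi> n x) q"
  shows "sided_limits (\<lambda>n. discrete_qv \<pi> n x) q (left_lim q)" "q 0 = 0"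
proof -
  let ?q = "\<lambda>n. discrete_qv \<pi> n x"
  obtain \<theta> :: "nat \<Rightarrow> real \<Rightarrow> real" where mono: "\<And>n. strict_mono_on {0..} (\<theta> n)"
    and onto: "\<And>n. \<theta> n ` {0..} = {0..}"
    and unif: "uniform_limit {0..} \<theta> (\<lambda>t. t) sequentially"
    and conv: "\<And>T. T \<ge> 0 \<Longrightarrow> uniform_limit {0..T} (\<lambda>n t. ?q n (\<theta> n t)) q sequentially"
    using J1 unfolding J1_converges_def by auto
  have ex: "\<exists>r. 0 \<le> r \<and> \<theta> n r = s" if "0 \<le> s" for n s
  proof -
    have "s \<in> \<theta> n ` {0..}" using onto that by simp
    then show ?thesis by auto
  qed
  define \<eta> where "\<eta> n s = (SOME r. 0 \<le> r \<and> \<theta> n r = s)" for n s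
  have \<eta>: "0 \<le> \<eta> n s \<and> \<theta> n (\<eta> n s) = s" if "0 \<le> s" for n s
    unfolding \<eta>_def by (rule someI_ex[OF ex[OF that]])
  have less_iff: "\<theta> n a < \<theta> n b \<longleftrightarrow> a < b" if "0 \<le> a" "0 \<le> b" for n a b
    using strict_mono_on_less[OF mono[of n], of a b] that by simp
  have \<theta>_nonneg: "0 \<le> \<theta> n a" if "0 \<le> a" for n a
  proof -
    have "\<theta> n a \<in> \<theta> n ` {0..}" using that by simp
    then show ?thesis unfolding onto by simp
  qed
  have \<theta>_lim: "(\<lambda>n. \<theta> n a) \<longlonglongrightarrow> a" if "0 \<le> a" for a
    using tendsto_uniform_limitI[OF unif, of a] that by simp
  have \<eta>_lim: "(\<lambda>n. \<eta> n (s n)) \<longlonglongrightarrow> t" if s: "\<And>n. 0 \<le> s n" "s \<longlonglongrightarrow> t" for s t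
  proof -
    have "(\<lambda>n. \<eta> n (s n) - s n) \<longlonglongrightarrow> 0"
    proof (rule tendstoI)
      fix e :: real assume "e > 0"
      then have "\<forall>\<^sub>F n in sequentially. \<forall>a\<in>{0..}. dist (\<theta> n a) a < e"
        using unif by (simp add: uniform_limit_iff)
      then show "\<forall>\<^sub>F n in sequentially. dist (\<eta> n (s n) - s n) 0 < e"
      proof eventually_elim
        case (elim n)
        from bspec[OF elim, of "\<eta> n (s n)"] \<eta>[OF s(1)[of n], of n]
        show ?case by (simp add: dist_real_def abs_minus_commute)
      qed
    qed
    from tendsto_add[OF this s(2)] show ?thesis by simp
  qed
  have diff: "(\<lambda>n. ?q n (s n) - q (\<eta> n (s n))) \<longlonglongrightarrow> 0" if s: "\<And>n. 0 \<le> s n" "s \<longlonglongrightarrow> t" for s t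
  proof (rule tendstoI)
    fix e :: real assume e: "e > 0"
    have t: "0 \<le> t" by (rule LIMSEQ_le_const[OF s(2)]) (use s in auto)
    have "\<forall>\<^sub>F n in sequentially. \<forall>a\<in>{0..t+1}. dist (?q n (\<theta> n a)) (q a) < e"
      using conv[of "t + 1"] t e by (simp add: uniform_limit_iff)
    moreover have "\<forall>\<^sub>F n in sequentially. \<eta> n (s n) < t + 1"
      using \<eta>_lim[OF s] by (rule order_tendstoD) simp
    ultimately show "\<forall>\<^sub>F n in sequentially. dist (?q n (s n) - q (\<eta> n (s n))) 0 < e"
    proof eventually_elim
      case (elim n)
      from bspec[OF elim(1), of "\<eta> n (s n)"] elim(2) \<eta>[OF s(1)[of n], of n]
      show ?case by (simp add: dist_norm)
    qed
  qed
  have lim_of: "(\<lambda>n. ?q n (s n)) \<longlonglongrightarrow> L"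
    if s: "\<And>n. 0 \<le> s n" "s \<longlonglongrightarrow> t" and L: "(\<lambda>n. q (\<eta> n (s n))) \<longlonglongrightarrow> L" for s t L
    using tendsto_add[OF diff[OF s] L] by simp

  \<comment> \<open>The time change must carry a jump of \<open>q\<close> at \<open>t\<close> to a
    jump of \<open>discrete_qv\<close> of comparable size. Such jumps occur at partition points
    only, and near \<open>t\<close> every increment other than the one at \<open>pp n t\<close> is
    too small.\<close>
  have \<theta>_pp: "\<forall>\<^sub>F n in sequentially. \<theta> n t = pp n t" if t: "0 < t" and jump: "left_lim q t \<noteq> q t" for t
  proof -
    define p where "p n = \<theta> n t" for n
    have p_pos: "0 < p n" for n
      using less_iff[of 0 t n] \<theta>_nonneg[of 0 n] t by (simp add: p_def)
    have p_lim: "p \<longlonglongrightarrow> t" unfolding p_def using t by (intro \<theta>_lim) simp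
    \<comment> \<open>A time before \<open>p n\<close> with no partition point in between: from
      \<open>b n\<close> to \<open>p n\<close> the sum gains only the term at \<open>p n\<close>.
      Its pulled-back time is below \<open>t\<close>, so the sum at \<open>b n\<close> tends to the
      left limit of \<open>q\<close>.\<close>
    define b where "b n = max (pp n (p n)) (p n - 1 / real (Suc n))" for n
    have b: "0 \<le> b n" "b n < p n" "pp n (p n) \<le> b n" for n
      using pp_nonneg[of n "p n"] pp_max(2)[OF p_pos, of n n] by (auto simp: b_def)
    have "b \<longlonglongrightarrow> max t (t - 0)" unfolding b_def
      using LIMSEQ_inverse_real_of_nat p_pos
      by (intro tendsto_max tendsto_diff p_lim pp_tendsto) (auto simp: inverse_eq_divide less_imp_le)
    then have b_lim: "b \<longlonglongrightarrow> t" by simp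
    have "\<eta> n (b n) < t" for n
      using less_iff[of "\<eta> n (b n)" t n] \<eta>[OF b(1)[of n], of n] b(2)[of n] t by (simp add: p_def)
    then have "(\<lambda>n. q (\<eta> n (b n))) \<longlonglongrightarrow> left_lim q t"
      by (intro cadlag_seq_left[OF q t \<eta>_lim[OF b(1) b_lim]]) simp
    then have lb: "(\<lambda>n. ?q n (b n)) \<longlonglongrightarrow> left_lim q t" by (rule lim_of[OF b(1) b_lim])
    have lp: "(\<lambda>n. ?q n (p n)) \<longlonglongrightarrow> q t"
      using tendsto_uniform_limitI[OF conv[of t], of t] t by (simp add: p_def)
    define c where "c = norm (q t - left_lim q t) / 2"
    have c: "c > 0" using jump by (simp add: c_def)
    have "(\<lambda>n. norm (?q n (p n) - ?q n (b n))) \<longlonglongrightarrow> norm (q t - left_lim q t)"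
      by (intro tendsto_norm tendsto_diff lp lb)
    then have ev_c: "\<forall>\<^sub>F n in sequentially. c < norm (?q n (p n) - ?q n (b n))"
      by (rule order_tendstoD) (use c in \<open>simp add: c_def\<close>)
    have "\<forall>\<^sub>F n in sequentially. \<exists>i. Suc i < length (\<pi> n) \<and> \<pi> n ! i = p n \<and> c < norm (outer (dx x n i))"
      using ev_c
    proof eventually_elim
      case (elim n)
      let ?I = "{i. Suc i < length (\<pi> n) \<and> \<pi> n ! i = p n}"
      have eq: "?q n (p n) - ?q n (b n) = (\<Sum>i\<in>?I. outer (dx x n i))"
        unfolding discrete_qv_eq by (rule sum_upto_idx_step[OF p_pos b(2,3)])
      have "?I \<noteq> {}"
      proof
        assume empty: "?I = {}"
        show False using elim c unfolding eq empty by simp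
      qed
      then obtain i where i: "i \<in> ?I" by blast
      have "k = i" if "k \<in> ?I" for k using that i nth_eq_iff[of k n i] by simp
      then have "?I = {i}" using i by blast
      then have "c < norm (outer (dx x n i))" using elim unfolding eq by simp
      then show ?case using i by blast
    qed
    then obtain i where i: "\<forall>\<^sub>F n in sequentially. Suc (i n) < length (\<pi> n) \<and> \<pi> n ! i n = p n \<and> c < norm (outer (dx x n (i n)))"
      unfolding eventually_ex by blast
    have i_lim: "(\<lambda>n. \<pi> n ! i n) \<longlonglongrightarrow> t"
      by (rule Lim_transform_eventually[OF p_lim]) (use i in \<open>auto elim: eventually_mono\<close>)
    have len: "\<forall>\<^sub>F n in sequentially. Suc (i n) < length (\<pi> n)" using i by eventually_elim auto
    \<comment> \<open>By continuity of \<open>outer\<close> at 0, a term of norm above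
      \<open>c\<close> comes from an increment of norm at least \<open>e\<close>, and near
      \<open>t\<close> this leaves only the index of \<open>pp n t\<close>.\<close>
    have "((\<lambda>d. outer d) \<longlongrightarrow> outer (0 :: real^'m)) (at 0)" by (intro outer_tendsto tendsto_ident_at)
    then have "\<forall>\<^sub>F d in at (0 :: real^'m). dist (outer d) 0 < c"
      unfolding outer_0 using c by (rule tendstoD)
    then obtain e where e: "e > 0" "\<And>d :: real^'m. d \<noteq> 0 \<Longrightarrow> norm d < e \<Longrightarrow> norm (outer d) < c"
      unfolding eventually_at by auto
    from dx_small[OF x less_imp_le[OF t] e(1)] obtain \<delta> where \<delta>: "\<delta> > 0"
      "\<And>n i. \<lbrakk>Suc i < length (\<pi> n); dist (\<pi> n ! i) t < \<delta>; dist (\<pi> n ! Suc i) t < \<delta>;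
        t \<le> \<pi> n ! i \<or> 0 < t \<and> \<pi> n ! i < pp n t\<rbrakk> \<Longrightarrow> norm (dx x n i) < e" by blast
    show ?thesis
      using tendstoD[OF i_lim \<delta>(1)] tendstoD[OF nth_Suc_tendsto[OF i_lim len] \<delta>(1)] i
    proof eventually_elim
      case (elim n)
      show ?case
      proof (rule ccontr)
        assume "\<theta> n t \<noteq> pp n t"
        then have "\<pi> n ! i n \<noteq> pp n t" using elim by (simp add: p_def)
        then have "t \<le> \<pi> n ! i n \<or> 0 < t \<and> \<pi> n ! i n < pp n t"
          using elim(3) nth_le_pp_iff[of t "i n" n] t by force
        then have "norm (dx x n (i n)) < e" using \<delta>(2)[of "i n" n] elim by blast
        moreover have "c < norm (outer D)" "norm D < e \<Longrightarrow> D \<noteq> 0 \<Longrightarrow> norm (outer D) < c"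
          if "D = dx x n (i n)" for D
          using elim(3) e(2)[of D] unfolding that by blast+
        ultimately show False
          using c outer_0 by (metis norm_zero order_less_asym)
      qed
    qed
  qed

  show "sided_limits ?q q (left_lim q)"
    unfolding sided_limits_def
  proof (intro conjI allI impI)
    fix t s assume t: "0 \<le> t" and "right_approach t s"
    then have s: "\<And>n. 0 \<le> s n" "s \<longlonglongrightarrow> t" "\<forall>\<^sub>F n in sequentially. pp n t \<le> s n"
      by (auto simp: right_approach_def)
    note \<eta>s = \<eta>_lim[OF s(1,2)]
    show "(\<lambda>n. ?q n (s n)) \<longlonglongrightarrow> q t"
    proof (rule lim_of[OF s(1,2)], cases "left_lim q t = q t")
      case True
      then show "(\<lambda>n. q (\<eta> n (s n))) \<longlonglongrightarrow> q t"
        using \<eta> s by (intro cadlag_seq_cont[OF q t \<eta>s]) auto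
    next
      case False
      then have t0: "0 < t" using t by (auto simp: left_lim_def order_less_le)
      have "\<forall>\<^sub>F n in sequentially. t \<le> \<eta> n (s n)"
        using \<theta>_pp[OF t0 False] s(3)
      proof eventually_elim
        case (elim n)
        then show ?case using less_iff[of "\<eta> n (s n)" t n] \<eta>[OF s(1)[of n], of n] t by auto
      qed
      then show "(\<lambda>n. q (\<eta> n (s n))) \<longlonglongrightarrow> q t"
        by (rule cadlag_seq_right[OF q t \<eta>s])
    qed
  next
    fix t s assume t: "0 < t" and "left_approach t s"
    then have s: "\<And>n. 0 \<le> s n" "s \<longlonglongrightarrow> t" "\<forall>\<^sub>F n in sequentially. s n < pp n t"
      by (auto simp: left_approach_def)
    note \<eta>s = \<eta>_lim[OF s(1,2)]
    show "(\<lambda>n. ?q n (s n)) \<longlonglongrightarrow> left_lim q t"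
    proof (rule lim_of[OF s(1,2)], cases "left_lim q t = q t")
      case True
      then show "(\<lambda>n. q (\<eta> n (s n))) \<longlonglongrightarrow> left_lim q t"
        using \<eta> s t cadlag_seq_cont[OF q _ \<eta>s] by auto
    next
      case False
      have "\<forall>\<^sub>F n in sequentially. \<eta> n (s n) < t"
        using \<theta>_pp[OF t False] s(3)
      proof eventually_elim
        case (elim n)
        then show ?case using less_iff[of "\<eta> n (s n)" t n] \<eta>[OF s(1)[of n], of n] t by auto
      qed
      then show "(\<lambda>n. q (\<eta> n (s n))) \<longlonglongrightarrow> left_lim q t"
        by (rule cadlag_seq_left[OF q t \<eta>s])
    qed
  qed
  \<comment> \<open>At time 0 the sum eventually consists of the first increment alone, which
    vanishes in the limit by right continuity of \<open>x\<close> at 0.\<close>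
  then have "(\<lambda>n. ?q n 0) \<longlonglongrightarrow> q 0" by (rule sided_limits_const) simp
  moreover have "(\<lambda>n. ?q n 0) \<longlonglongrightarrow> 0"
  proof (rule Lim_transform_eventually)
    show "(\<lambda>n. outer (dx x n 0)) \<longlonglongrightarrow> 0"
      using outer_tendsto[OF dx_0_tendsto_0[OF x]] by (simp only: outer_0)
    show "\<forall>\<^sub>F n in sequentially. outer (dx x n 0) = ?q n 0"
      using upto_idx_0 by eventually_elim (simp add: discrete_qv_eq)
  qed
  ultimately show "q 0 = 0" by (rule LIMSEQ_unique)
qed

end

section \<open>Stopped paths and generic sets\<close>

lemma left_lim_cong:
  assumes "0 < t" "\<And>s. s < t \<Longrightarrow> y s = z s"
  shows "left_lim y t = left_lim z t"
proof -
  have "\<forall>\<^sub>F s in at_left t. y s = z s"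
    using assms(2) by (auto simp: eventually_at_left_field intro!: exI[of _ "t - 1"])
  then have "Lim (at_left t) y = Lim (at_left t) z" by (rule Lim_cong) simp
  then show ?thesis using assms(1) by (simp add: left_lim_def)
qed

lemma left_lim_eqI:
  assumes "0 < t" "(y \<longlongrightarrow> l) (at_left t)"
  shows "left_lim y t = l"
  using assms by (simp add: left_lim_def tendsto_Lim)

lemma left_lim_stop: "0 \<le> t \<Longrightarrow> t \<le> T \<Longrightarrow> left_lim (stop T y) t = left_lim y t"
  by (cases "t = 0") (auto simp: left_lim_def[of _ 0] stop_def intro!: left_lim_cong)

lemma left_lim_stop_left: "0 \<le> t \<Longrightarrow> left_lim (stop_left t y) t = left_lim y t"
  by (cases "t = 0") (auto simp: left_lim_def[of _ 0] stop_left_def intro!: left_lim_cong)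

lemma stop_stop: "s \<le> t \<Longrightarrow> stop s (stop t y) = stop s y"
  by (auto simp: stop_def fun_eq_iff min_def)

lemma stop_left_stop: "0 \<le> s \<Longrightarrow> s \<le> t \<Longrightarrow> stop_left s (stop t y) = stop_left s y"
  by (auto simp: stop_left_def left_lim_stop fun_eq_iff) (auto simp: stop_def)

lemma stop_left_idem: "0 \<le> t \<Longrightarrow> stop_left t (stop_left t y) = stop_left t y"
proof
  fix s assume "0 \<le> t"
  then show "stop_left t (stop_left t y) s = stop_left t y s"
    by (simp add: stop_left_def[of t "stop_left t y"] left_lim_stop_left) (simp add: stop_left_def)
qed

lemma stop_stop_left: "stop t (stop_left t y) = stop_left t y"
  by (auto simp: stop_left_def stop_def fun_eq_iff)

lemma stop_left_continuous: "left_lim y t = y t \<Longrightarrow> stop_left t y = stop t y"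
  by (auto simp: stop_left_def stop_def fun_eq_iff)

lemma bump_stop_left: "stop_left t y = bump t (- jump y t) (stop t y)"
  by (auto simp: stop_left_def stop_def bump_def jump_def fun_eq_iff)

lemma bump_jump: "bump t (jump y t) (stop_left t y) = stop t y"
  by (auto simp: stop_left_def stop_def bump_def jump_def fun_eq_iff)

lemma bump_0: "bump t 0 y = y"
  by (simp add: bump_def)

lemma bump_bump: "bump t e (bump t d y) = bump t (d + e) y"
  by (auto simp: bump_def fun_eq_iff scaleR_add_right)

lemma stop_bump: "stop t y = y \<Longrightarrow> stop t (bump t e y) = bump t e y"
proof
  fix s assume "stop t y = y"
  then have "y (min s t) = y s" by (metis stop_def)
  then show "stop t (bump t e y) s = bump t e y s"
    by (auto simp: stop_def bump_def min_def indicator_def split: if_splits)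
qed

lemma stopped_pathsI: "0 \<le> t \<Longrightarrow> y \<in> \<Omega> \<Longrightarrow> stop t y = y \<Longrightarrow> (t, y) \<in> stopped_paths \<Omega>"
  unfolding stopped_paths_def by force

lemma indicator_right:
  fixes a b t :: real
  shows "\<forall>\<^sub>F s in at_right t. indicat_real {a..<b} s = indicat_real {a..<b} t"
proof -
  define c where "c = (if t < a then a else if t < b then b else t + 1)"
  have "t < c" by (auto simp: c_def)
  moreover have "indicat_real {a..<b} s = indicat_real {a..<b} t" if "t < s" "s < c" for s
    using that by (auto simp: c_def indicator_def split: if_splits)
  ultimately show ?thesis by (auto simp: eventually_at_right_field)
qed

text \<open>Taking left limits moves the closed end of the interval, which turns the formula for
  \<open>approx_path\<close> into one for its left limits.\<close>

lemma indicator_left: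
  fixes a b t :: real
  shows "\<forall>\<^sub>F s in at_left t. indicat_real {a..<b} s = indicat_real {a<..b} t"
proof -
  define c where "c = (if b < t then b else if a < t then a else t - 1)"
  have "c < t" by (auto simp: c_def)
  moreover have "indicat_real {a..<b} s = indicat_real {a<..b} t" if "c < s" "s < t" for s
    using that by (auto simp: c_def indicator_def split: if_splits)
  ultimately show ?thesis by (auto simp: eventually_at_left_field)
qed

section \<open>The step approximations of a path\<close>

context partition_seq begin

abbreviation ap :: "nat \<Rightarrow> (real \<Rightarrow> 'a::real_normed_vector) \<Rightarrow> real \<Rightarrow> 'a" where
  "ap \<equiv> approx_path \<pi>"

lemma finite_intervals: "finite {i. Suc i < length (\<pi> n)}"
  by (rule finite_subset[of _ "{..<length (\<pi> n)}"]) auto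

lemma ap_neg: "s < 0 \<Longrightarrow> ap n x s = 0"
proof -
  assume s: "s < 0"
  have "indicat_real {\<pi> n ! i..<\<pi> n ! Suc i} s = 0" if "Suc i < length (\<pi> n)" for i
    using nth_nonneg[of i n] that s by (auto simp: indicator_def)
  then show ?thesis by (simp add: approx_path_def)
qed

lemma ap_eq:
  assumes "Suc i < length (\<pi> n)" "\<pi> n ! i \<le> s" "s < \<pi> n ! Suc i"
  shows "ap n x s = x (\<pi> n ! Suc i)"
proof -
  have "indicat_real {\<pi> n ! j..<\<pi> n ! Suc j} s = (if j = i then 1 else 0)" if "Suc j < length (\<pi> n)" for j
  proof -
    have "j = i" if "\<pi> n ! j \<le> s" "s < \<pi> n ! Suc j"
    proof -
      have "\<pi> n ! j < \<pi> n ! Suc i" "\<pi> n ! i < \<pi> n ! Suc j" using that assms by linarith+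
      moreover have "j < length (\<pi> n)" "i < length (\<pi> n)" using assms \<open>Suc j < length (\<pi> n)\<close> by auto
      ultimately have "j < Suc i" "i < Suc j"
        by (simp_all only: nth_less_iff assms(1) \<open>Suc j < length (\<pi> n)\<close>)
      then show ?thesis by linarith
    qed
    then show ?thesis using assms(2,3) by (cases "j = i") (auto simp: indicator_def)
  qed
  then have "ap n x s = (\<Sum>j | Suc j < length (\<pi> n). if j = i then x (\<pi> n ! Suc i) else 0)"
    unfolding approx_path_def by (intro sum.cong) auto
  then show ?thesis using assms finite_intervals[of n] by simp
qed

lemma ap_at_left: "(ap n x \<longlongrightarrow> (\<Sum>i | Suc i < length (\<pi> n). indicat_real {\<pi> n ! i<..\<pi> n ! Suc i} t *\<^sub>R x (\<pi> n ! Suc i))) (at_left t)"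
  unfolding approx_path_def
  by (intro tendsto_sum tendsto_scaleR tendsto_const tendsto_eventually indicator_left)

lemma ap_at_right: "(ap n x \<longlongrightarrow> ap n x t) (at_right t)"
  unfolding approx_path_def
  by (intro tendsto_sum tendsto_scaleR tendsto_const tendsto_eventually indicator_right)

lemma ap_cadlag: "ap n x \<in> cadlag"
  unfolding cadlag_def using ap_neg ap_at_left ap_at_right by blast

lemma left_lim_ap:
  assumes "Suc i < length (\<pi> n)" "\<pi> n ! i < t" "t \<le> \<pi> n ! Suc i"
  shows "left_lim (ap n x) t = x (\<pi> n ! Suc i)"
proof -
  have t: "0 < t" using nth_nonneg[of i n] assms by simp
  have "\<forall>\<^sub>F s in at_left t. x (\<pi> n ! Suc i) = ap n x s"
    unfolding eventually_at_left_field
  proof (intro exI[of _ "\<pi> n ! i"] conjI allI impI)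
    fix s assume "\<pi> n ! i < s" "s < t"
    then show "x (\<pi> n ! Suc i) = ap n x s" using ap_eq[OF assms(1), of s x] assms(3) by simp
  qed (use assms in simp)
  then have "(ap n x \<longlongrightarrow> x (\<pi> n ! Suc i)) (at_left t)"
    by (rule Lim_transform_eventually[OF tendsto_const])
  with t show ?thesis by (rule left_lim_eqI)
qed

text \<open>Index 0 is excluded because of the convention for left limits at 0:
  \<open>ap n x\<close> has no jump there, although the increment \<open>dx x n 0\<close> need not
  vanish.\<close>

lemma jump_ap: "Suc i < length (\<pi> n) \<Longrightarrow> 0 < i \<Longrightarrow> jump (ap n x) (\<pi> n ! i) = dx x n i"
proof -
  assume i: "Suc i < length (\<pi> n)" "0 < i"
  then obtain k where k: "i = Suc k" by (cases i) auto
  have "left_lim (ap n x) (\<pi> n ! i) = x (\<pi> n ! i)"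
    unfolding k using i k nth_less_iff[of k n "Suc k"] by (intro left_lim_ap) auto
  moreover have "ap n x (\<pi> n ! i) = x (\<pi> n ! Suc i)"
    using i nth_less_iff[of i n "Suc i"] by (intro ap_eq) auto
  ultimately show ?thesis by (simp add: jump_def)
qed

lemma partition_interval:
  assumes "0 \<le> s" "s < last (\<pi> n)"
  obtains i where "Suc i < length (\<pi> n)" "\<pi> n ! i \<le> s" "s < \<pi> n ! Suc i"
proof -
  obtain j where j: "upto_idx n s = {..<j}" by (rule sum_index_initial)
  have len: "Suc 0 < length (\<pi> n)"
  proof (rule ccontr)
    assume "\<not> ?thesis"
    then have "length (\<pi> n) = 1" using nonempty[of n] by (cases "\<pi> n") auto
    then show False using assms nth_0[of n] nonempty[of n] by (simp add: last_conv_nth)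
  qed
  then have "0 \<in> upto_idx n s" using assms(1) by (simp add: nth_0)
  then obtain i where i: "j = Suc i" unfolding j by (cases j) auto
  then have mem: "i \<in> upto_idx n s" and nmem: "Suc i \<notin> upto_idx n s" unfolding j by auto
  have "s < \<pi> n ! Suc i"
  proof (cases "Suc (Suc i) < length (\<pi> n)")
    case True
    then show ?thesis using nmem by auto
  next
    case False
    then have "Suc i = length (\<pi> n) - 1" using mem by auto
    then show ?thesis using assms(2) nonempty[of n] by (simp add: last_conv_nth)
  qed
  then show ?thesis using mem that by auto
qed

lemma ap_const_right:
  assumes "0 \<le> s" "s < last (\<pi> n)"
  obtains b where "s < b" "\<And>u. s \<le> u \<Longrightarrow> u < b \<Longrightarrow> stop u (ap n x) = stop s (ap n x) \<and> upto_idx n u = upto_idx n s"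
proof -
  obtain i where i: "Suc i < length (\<pi> n)" "\<pi> n ! i \<le> s" "s < \<pi> n ! Suc i"
    using partition_interval[OF assms] by metis
  show ?thesis
  proof (rule that[OF i(3)], intro conjI)
    fix u assume u: "s \<le> u" "u < \<pi> n ! Suc i"
    have "ap n x r = x (\<pi> n ! Suc i)" if "s \<le> r" "r \<le> u" for r
      using that u i by (intro ap_eq) auto
    then show "stop u (ap n x) = stop s (ap n x)"
      using u by (auto simp: stop_def fun_eq_iff min_def)
    have "\<pi> n ! k \<le> s" if "Suc k < length (\<pi> n)" "\<pi> n ! k \<le> u" for k
    proof -
      have "k \<le> i" using that u i nth_less_iff[of k n "Suc i"] by auto
      then have "\<pi> n ! k \<le> \<pi> n ! i" using that i nth_le_iff[of k n i] by simp
      then show ?thesis using i by simp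
    qed
    then show "upto_idx n u = upto_idx n s" using u by auto
  qed
qed

end

locale generic_set = partition_seq +
  fixes \<Omega> :: "(real \<Rightarrow> real^'m) set"
  assumes gen: "generic \<pi> \<Omega>"
begin

lemma in_cadlag: "x \<in> \<Omega> \<Longrightarrow> x \<in> cadlag"
  using gen by (auto simp: generic_def)

lemma stop_in: "x \<in> \<Omega> \<Longrightarrow> 0 \<le> t \<Longrightarrow> stop t x \<in> \<Omega>"
proof -
  assume "x \<in> \<Omega>" "0 \<le> t"
  then obtain V :: "(real^'m) set" where "0 \<in> interior V" "\<And>e. e \<in> V \<Longrightarrow> bump t e (stop t x) \<in> \<Omega>"
    using gen unfolding generic_def by meson
  then have "bump t 0 (stop t x) \<in> \<Omega>" using interior_subset by blast
  then show ?thesis by (simp add: bump_0)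
qed

lemma stop_left_in: "x \<in> \<Omega> \<Longrightarrow> 0 \<le> t \<Longrightarrow> stop_left t x \<in> \<Omega>"
proof -
  assume "x \<in> \<Omega>" "0 \<le> t"
  then obtain V :: "(real^'m) set" where "- jump x t \<in> V" "\<And>e. e \<in> V \<Longrightarrow> bump t e (stop t x) \<in> \<Omega>"
    using gen unfolding generic_def by meson
  then show ?thesis by (simp add: bump_stop_left)
qed

lemma stop_paths: "x \<in> \<Omega> \<Longrightarrow> 0 \<le> t \<Longrightarrow> (t, stop t x) \<in> stopped_paths \<Omega>"
  by (intro stopped_pathsI stop_in stop_stop) auto

lemma stop_left_paths: "x \<in> \<Omega> \<Longrightarrow> 0 \<le> t \<Longrightarrow> (t, stop_left t x) \<in> stopped_paths \<Omega>"
  by (intro stopped_pathsI stop_left_in stop_stop_left) auto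

text \<open>\<Omega> is closed under stopping, also from the left, so membership of one stopped path
  covers all earlier times with the same bound on \<open>n\<close>. The maximum with 1 makes the
  horizon positive, as genericity asks.\<close>

lemma eventually_ap_in:
  assumes "x \<in> \<Omega>"
  shows "\<forall>\<^sub>F n in sequentially. \<forall>t. 0 \<le> t \<and> t \<le> T \<longrightarrow>
    stop t (ap n x) \<in> \<Omega> \<and> stop_left t (ap n x) \<in> \<Omega> \<and>
    (t, stop t (ap n x)) \<in> stopped_paths \<Omega> \<and> (t, stop_left t (ap n x)) \<in> stopped_paths \<Omega>"
proof -
  let ?T = "max T 1"
  have "\<exists>N. \<forall>n\<ge>N. stop ?T (ap n x) \<in> \<Omega>"
    using gen assms unfolding generic_def by (meson less_max_iff_disj zero_less_one)
  then have "\<forall>\<^sub>F n in sequentially. stop ?T (ap n x) \<in> \<Omega>" by (auto simp: eventually_sequentially)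
  then show ?thesis
  proof eventually_elim
    case (elim n)
    show ?case
    proof (intro allI impI)
      fix t assume t: "0 \<le> t \<and> t \<le> T"
      then have eq: "stop t (stop ?T (ap n x)) = stop t (ap n x)"
        "stop_left t (stop ?T (ap n x)) = stop_left t (ap n x)"
        by (auto intro!: stop_stop stop_left_stop)
      show "stop t (ap n x) \<in> \<Omega> \<and> stop_left t (ap n x) \<in> \<Omega> \<and>
        (t, stop t (ap n x)) \<in> stopped_paths \<Omega> \<and> (t, stop_left t (ap n x)) \<in> stopped_paths \<Omega>"
        using stop_in[OF elim, of t] stop_left_in[OF elim, of t]
          stop_paths[OF elim, of t] stop_left_paths[OF elim, of t] t by (simp add: eq)
    qed
  qed
qed

section \<open>Sequential continuity and the pi-topology\<close>

lemma left_cont_seq: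
  assumes G: "left_cont \<pi> \<Omega> G" and x: "x \<in> \<Omega>" and t: "0 \<le> t" and s: "s \<longlonglongrightarrow> t"
  shows "\<forall>\<^sub>F n in sequentially. 0 \<le> s n \<and> s n \<le> pp n t \<Longrightarrow>
      (\<lambda>n. G (s n, stop_left (s n) (ap n x))) \<longlonglongrightarrow> G (t, stop_left t x)"
    and "\<forall>\<^sub>F n in sequentially. 0 \<le> s n \<and> s n < pp n t \<Longrightarrow>
      (\<lambda>n. G (s n, stop (s n) (ap n x))) \<longlonglongrightarrow> G (t, stop_left t x)"
proof -
  note D = G[unfolded left_cont_def, rule_format, OF x t]
  show "(\<lambda>n. G (s n, stop_left (s n) (ap n x))) \<longlonglongrightarrow> G (t, stop_left t x)"
    if "\<forall>\<^sub>F n in sequentially. 0 \<le> s n \<and> s n \<le> pp n t"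
    by (rule tendsto_along_eventually_nonneg[where f = "\<lambda>n s. G (s, stop_left s (ap n x))" and P = "\<lambda>n s. s \<le> pp n t",
          OF _ t s that]) (use D in blast)
  show "(\<lambda>n. G (s n, stop (s n) (ap n x))) \<longlonglongrightarrow> G (t, stop_left t x)"
    if "\<forall>\<^sub>F n in sequentially. 0 \<le> s n \<and> s n < pp n t"
    by (rule tendsto_along_eventually_nonneg[where f = "\<lambda>n s. G (s, stop s (ap n x))" and P = "\<lambda>n s. s < pp n t",
          OF _ t s that]) (use D in blast)
qed

lemma right_cont_seq:
  assumes G: "right_cont \<pi> \<Omega> G" and x: "x \<in> \<Omega>" and t: "0 \<le> t" and s: "s \<longlonglongrightarrow> t"
  shows "\<forall>\<^sub>F n in sequentially. pp n t \<le> s n \<Longrightarrow>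
      (\<lambda>n. G (s n, stop (s n) (ap n x))) \<longlonglongrightarrow> G (t, stop t x)"
proof -
  note D = G[unfolded right_cont_def, rule_format, OF x t]
  assume "\<forall>\<^sub>F n in sequentially. pp n t \<le> s n"
  then have ev: "\<forall>\<^sub>F n in sequentially. 0 \<le> s n \<and> pp n t \<le> s n"
    by eventually_elim (use pp_nonneg order_trans in blast)
  show ?thesis
    by (rule tendsto_along_eventually_nonneg[where f = "\<lambda>n s. G (s, stop s (ap n x))" and P = "\<lambda>n s. pp n t \<le> s",
          OF _ t s ev]) (use D in blast)
qed

text \<open>In an initial topology, convergence tested on the generating functionals passes to
  finite intersections and unions of the generating sets, hence to every open set; the induction
  over \<open>generate_topology_on\<close> expresses this.\<close>

lemma continuous_map_tendsto:
  assumes F: "continuous_map (pi_topology \<pi> \<Omega>) euclideanreal F"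
    and p0: "p0 \<in> stopped_paths \<Omega>" and p: "\<forall>\<^sub>F z in net. p z \<in> stopped_paths \<Omega>"
    and lim: "\<And>f :: real \<times> (real \<Rightarrow> real^'m) \<Rightarrow> real. left_cont \<pi> \<Omega> f \<Longrightarrow> right_cont \<pi> \<Omega> f \<Longrightarrow>
      ((\<lambda>z. f (p z)) \<longlongrightarrow> f p0) net"
  shows "((\<lambda>z. F (p z)) \<longlongrightarrow> F p0) net"
proof (rule topological_tendstoI)
  fix V :: "real set" assume V: "open V" "F p0 \<in> V"
  define \<B> where "\<B> = {{p \<in> stopped_paths \<Omega>. f p \<in> V} | (f :: real \<times> (real \<Rightarrow> real^'m) \<Rightarrow> real) V.
        left_cont \<pi> \<Omega> f \<and> right_cont \<pi> \<Omega> f \<and> open V}"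
  have *: "p0 \<in> W \<longrightarrow> (\<forall>\<^sub>F z in net. p z \<in> W)" if "generate_topology_on \<B> W" for W
    using that
  proof (induction rule: generate_topology_on.induct)
    case (Int a b)
    then show ?case by (auto intro: eventually_conj)
  next
    case (UN K)
    show ?case
    proof
      assume "p0 \<in> \<Union>K"
      then obtain k where "k \<in> K" "p0 \<in> k" by auto
      then have "\<forall>\<^sub>F z in net. p z \<in> k" using UN by auto
      then show "\<forall>\<^sub>F z in net. p z \<in> \<Union>K" by eventually_elim (use \<open>k \<in> K\<close> in auto)
    qed
  next
    case (Basis s)
    then obtain f :: "real \<times> (real \<Rightarrow> real^'m) \<Rightarrow> real" and V where f: "s = {p \<in> stopped_paths \<Omega>. f p \<in> V}"
      "left_cont \<pi> \<Omega> f" "right_cont \<pi> \<Omega> f" "open V"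
      unfolding \<B>_def by blast
    show ?case
    proof
      assume "p0 \<in> s"
      then have "\<forall>\<^sub>F z in net. f (p z) \<in> V"
        using topological_tendstoD[OF lim[OF f(2,3)] f(4)] f(1) by auto
      with p show "\<forall>\<^sub>F z in net. p z \<in> s" by eventually_elim (simp add: f(1))
    qed
  qed auto
  have "openin (pi_topology \<pi> \<Omega>) {p \<in> topspace (pi_topology \<pi> \<Omega>). F p \<in> V}"
    using F V(1) by (auto simp: continuous_map_def)
  then have "generate_topology_on \<B> {p \<in> stopped_paths \<Omega>. F p \<in> V}"
    unfolding topspace_pi_topology unfolding pi_topology_def openin_topology_generated_by_iff \<B>_def .
  from *[OF this] have "\<forall>\<^sub>F z in net. p z \<in> {p \<in> stopped_paths \<Omega>. F p \<in> V}" using p0 V(2) by simp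
  then show "\<forall>\<^sub>F z in net. F (p z) \<in> V" by eventually_elim simp
qed

lemma eventually_le_Suc:
  assumes "s \<longlonglongrightarrow> (t :: real)" shows "\<forall>\<^sub>F n in sequentially. s n \<le> t + 1"
proof -
  have "\<forall>\<^sub>F n in sequentially. s n < t + 1" using assms by (rule order_tendstoD) simp
  then show ?thesis by eventually_elim simp
qed

lemma eventually_ap_paths:
  assumes "x \<in> \<Omega>" "\<forall>n. 0 \<le> s n" "s \<longlonglongrightarrow> t"
  shows "\<forall>\<^sub>F n in sequentially. (s n, stop (s n) (ap n x)) \<in> stopped_paths \<Omega>"
    "\<forall>\<^sub>F n in sequentially. (s n, stop_left (s n) (ap n x)) \<in> stopped_paths \<Omega>"
  using eventually_le_Suc[OF assms(3)] eventually_ap_in[OF assms(1), of "t + 1"] assms(2)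
  by (auto elim: eventually_elim2)

lemma eventually_at_paths:
  assumes "x \<in> \<Omega>" "S \<subseteq> {0..}"
  shows "\<forall>\<^sub>F s in at t within S. (s, stop s x) \<in> stopped_paths \<Omega>"
    "\<forall>\<^sub>F s in at t within S. (s, stop_left s x) \<in> stopped_paths \<Omega>"
  using assms stop_paths stop_left_paths by (auto simp: eventually_at_filter intro!: always_eventually)

text \<open>Each clause of the definition says that a functional converges along one fixed net of
  points of \<Lambda>. The generating functionals converge along all these nets by definition, so
  continuous functionals do as well.\<close>

lemma continuous_map_left_cont:
  assumes "continuous_map (pi_topology \<pi> \<Omega>) euclideanreal F"
  shows "left_cont \<pi> \<Omega> F"
  unfolding left_cont_def
proof (intro ballI allI impI)
  fix x t assume x: "x \<in> \<Omega>" and t: "(0::real) \<le> t"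
  note D = continuous_map_tendsto[OF assms stop_left_paths[OF x t]]
  show "((\<lambda>s. F (s, stop_left s x)) \<longlongrightarrow> F (t, stop_left t x)) (at t within {0..t}) \<and>
    ((\<lambda>s. F (s, stop s x)) \<longlongrightarrow> F (t, stop_left t x)) (at t within {0..<t}) \<and>
    (\<forall>s. (\<forall>n. 0 \<le> s n) \<and> s \<longlonglongrightarrow> t \<and> (\<forall>\<^sub>F n in sequentially. s n \<le> pp n t) \<longrightarrow>
       (\<lambda>n. F (s n, stop_left (s n) (ap n x))) \<longlonglongrightarrow> F (t, stop_left t x)) \<and>
    (\<forall>s. (\<forall>n. 0 \<le> s n) \<and> s \<longlonglongrightarrow> t \<and> (\<forall>\<^sub>F n in sequentially. s n < pp n t) \<longrightarrow>
       (\<lambda>n. F (s n, stop (s n) (ap n x))) \<longlonglongrightarrow> F (t, stop_left t x))"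
    using x t
    by (intro conjI allI impI D)
       (auto simp: left_cont_def intro!: eventually_at_paths eventually_ap_paths)
qed

lemma continuous_map_right_cont:
  assumes "continuous_map (pi_topology \<pi> \<Omega>) euclideanreal F"
  shows "right_cont \<pi> \<Omega> F"
  unfolding right_cont_def
proof (intro ballI allI impI)
  fix x t assume x: "x \<in> \<Omega>" and t: "(0::real) \<le> t"
  note D = continuous_map_tendsto[OF assms stop_paths[OF x t]]
  show "((\<lambda>s. F (s, stop s x)) \<longlongrightarrow> F (t, stop t x)) (at t within {t..}) \<and>
    ((\<lambda>s. F (s, stop_left s x)) \<longlongrightarrow> F (t, stop t x)) (at t within {t<..}) \<and>
    (\<forall>s. (\<forall>n. 0 \<le> s n) \<and> s \<longlonglongrightarrow> t \<and> (\<forall>\<^sub>F n in sequentially. s n \<ge> pp n t) \<longrightarrow>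
       (\<lambda>n. F (s n, stop (s n) (ap n x))) \<longlonglongrightarrow> F (t, stop t x)) \<and>
    (\<forall>s. (\<forall>n. 0 \<le> s n) \<and> s \<longlonglongrightarrow> t \<and> (\<forall>\<^sub>F n in sequentially. s n > pp n t) \<longrightarrow>
       (\<lambda>n. F (s n, stop_left (s n) (ap n x))) \<longlonglongrightarrow> F (t, stop t x))"
    using x t
    by (intro conjI allI impI D)
       (auto simp: right_cont_def intro!: eventually_at_paths eventually_ap_paths)
qed

lemma left_right_cont_continuous_map:
  fixes J :: "real \<times> (real \<Rightarrow> real^'m) \<Rightarrow> real"
  assumes "left_cont \<pi> \<Omega> J" "right_cont \<pi> \<Omega> J"
  shows "continuous_map (pi_topology \<pi> \<Omega>) euclideanreal J"
proof -
  have "openin (pi_topology \<pi> \<Omega>) {p \<in> stopped_paths \<Omega>. J p \<in> V}" if "open V" for V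
    unfolding pi_topology_def
    by (rule topology_generated_by_Basis) (use assms that in blast)
  then show ?thesis by (simp add: continuous_map_def topspace_pi_topology)
qed

end

section \<open>Vertical Taylor expansion\<close>

text \<open>Makes the definite description in \<open>vert_grad\<close> meaningful: the derivative is
  represented by exactly one vector.\<close>

lemma differentiable_imp_GDERIV:
  fixes f :: "real^'m \<Rightarrow> real"
  assumes "f differentiable (at x)"
  shows "GDERIV f x :> (THE g. GDERIV f x :> g)"
proof (rule theI')
  obtain D where D: "(f has_derivative D) (at x)" using assms by (auto simp: differentiable_def)
  then have lin: "linear D" by (rule has_derivative_linear)
  define g where "g = (\<Sum>b\<in>Basis. D b *\<^sub>R b)"
  have "D h = h \<bullet> g" for h
  proof -
    have "D h = D (\<Sum>b\<in>Basis. (h \<bullet> b) *\<^sub>R b)" by (simp add: euclidean_representation)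
    also have "\<dots> = (\<Sum>b\<in>Basis. (h \<bullet> b) * D b)"
      using lin by (simp add: linear_sum linear_cmul)
    finally show ?thesis by (simp add: g_def inner_sum_right mult.commute)
  qed
  then have "D = (\<lambda>h. h \<bullet> g)" by (rule ext)
  then have "GDERIV f x :> g" using D by (simp add: gderiv_def)
  moreover have "g1 = g2" if "GDERIV f x :> g1" "GDERIV f x :> g2" for g1 g2
  proof -
    have "(\<lambda>h. h \<bullet> g1) = (\<lambda>h. h \<bullet> g2)"
      using that unfolding gderiv_def by (rule has_derivative_unique)
    then have "\<forall>h. h \<bullet> g1 = h \<bullet> g2" by metis
    then show ?thesis by (simp add: vector_eq_ldot)
  qed
  ultimately show "\<exists>!g. GDERIV f x :> g" by blast
qed

text \<open>Bumps at the same time add up, so a vertical derivative at a bumped path is a derivative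
  along the line of bumps. This reduces vertical calculus to functions of one real variable.\<close>

lemma has_derivative_bump_line:
  assumes "((\<lambda>e. G (t, bump t e (bump t (\<xi> *\<^sub>R d) y))) has_derivative D) (at 0)"
  shows "((\<lambda>\<eta>. G (t, bump t (\<eta> *\<^sub>R d) y)) has_derivative (\<lambda>h. D (h *\<^sub>R d))) (at \<xi>)"
proof -
  have "((\<lambda>\<eta>. (\<eta> - \<xi>) *\<^sub>R d) has_derivative (\<lambda>h. h *\<^sub>R d)) (at \<xi>)"
    by (auto intro!: derivative_eq_intros)
  moreover have "((\<lambda>e. G (t, bump t e (bump t (\<xi> *\<^sub>R d) y))) has_derivative D) (at ((\<xi> - \<xi>) *\<^sub>R d))"
    using assms by simp
  ultimately have "((\<lambda>\<eta>. G (t, bump t ((\<eta> - \<xi>) *\<^sub>R d) (bump t (\<xi> *\<^sub>R d) y))) has_derivative (\<lambda>h. D (h *\<^sub>R d))) (at \<xi>)"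
    by (rule has_derivative_compose)
  then show ?thesis by (simp add: bump_bump algebra_simps)
qed

lemma quadratic_form_bound:
  fixes M :: "real^'m^'m" and d :: "real^'m"
  shows "\<bar>(M *v d) \<bullet> d\<bar> \<le> (real CARD('m))\<^sup>2 * norm M * (norm d)\<^sup>2"
proof -
  have comp: "\<bar>M $ a $ b\<bar> \<le> norm M" for a b
    using component_le_norm_cart[of "M $ a" b] Finite_Cartesian_Product.norm_nth_le[of M a] by linarith
  have "(M *v d) \<bullet> d = (\<Sum>a\<in>UNIV. \<Sum>b\<in>UNIV. M $ a $ b * d $ b * d $ a)"
    by (simp add: inner_vec_def matrix_vector_mult_def sum_distrib_right)
  \<comment> \<open>The factor in the bound counts matrix entries: each of the summands is at most
    \<open>norm M * (norm d)\<^sup>2\<close>.\<close>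
  also have "\<bar>\<dots>\<bar> \<le> (\<Sum>a\<in>(UNIV :: 'm set). \<Sum>b\<in>(UNIV :: 'm set). norm M * (norm d)\<^sup>2)"
  proof (intro order_trans[OF sum_abs] sum_mono)
    fix a b
    have "\<bar>M $ a $ b * d $ b * d $ a\<bar> \<le> norm M * norm d * norm d"
      unfolding abs_mult by (intro mult_mono comp component_le_norm_cart) auto
    then show "\<bar>M $ a $ b * d $ b * d $ a\<bar> \<le> norm M * (norm d)\<^sup>2" by (simp add: power2_eq_square)
  qed
  finally show ?thesis by (simp add: power2_eq_square mult_ac)
qed

locale c12_functional = generic_set +
  fixes U :: "real \<Rightarrow> (real \<Rightarrow> real^'m) \<Rightarrow> (real^'m) set"
    and F :: "real \<times> (real \<Rightarrow> real^'m) \<Rightarrow> real"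
  assumes QV: "\<Omega> \<subseteq> QV_paths \<pi>" and nbhds: "vertical_nbhds \<Omega> U" and F: "F \<in> C12 \<pi> \<Omega> U"
begin

abbreviation "grad \<equiv> vert_grad F"
abbreviation "hess \<equiv> vert_hess F"

lemma F_left_cont: "left_cont \<pi> \<Omega> F" and F_right_cont: "right_cont \<pi> \<Omega> F"
  using F continuous_map_left_cont continuous_map_right_cont by (auto simp: C12_def)

text \<open>On left-stopped paths a functional and its left version agree, because stopping from the
  left at the same time is idempotent. This transfers the regularity required in \<open>C12\<close>
  to the values occurring in the sums.\<close>

lemma left_version_left_cont_seq:
  fixes G :: "real \<times> (real \<Rightarrow> real^'m) \<Rightarrow> 'b::topological_space"
  assumes G: "left_cont \<pi> \<Omega> (left_version G)" and x: "x \<in> \<Omega>" and t: "0 \<le> t"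
    and s: "s \<longlonglongrightarrow> t" "\<forall>\<^sub>F n in sequentially. 0 \<le> s n \<and> s n \<le> pp n t"
  shows "(\<lambda>n. G (s n, stop_left (s n) (ap n x))) \<longlonglongrightarrow> G (t, stop_left t x)"
proof -
  have "(\<lambda>n. left_version G (s n, stop_left (s n) (ap n x))) \<longlonglongrightarrow> left_version G (t, stop_left t x)"
    by (rule left_cont_seq(1)[OF G x t s])
  then have "(\<lambda>n. left_version G (s n, stop_left (s n) (ap n x))) \<longlonglongrightarrow> G (t, stop_left t x)"
    using t by (simp add: left_version_def stop_left_idem)
  then show ?thesis
    by (rule Lim_transform_eventually)
       (use s(2) in \<open>auto simp: left_version_def stop_left_idem elim!: eventually_mono\<close>)
qed

lemma grad_seq:
  "x \<in> \<Omega> \<Longrightarrow> 0 \<le> t \<Longrightarrow> s \<longlonglongrightarrow> t \<Longrightarrow> \<forall>\<^sub>F n in sequentially. 0 \<le> s n \<and> s n \<le> pp n t \<Longrightarrow>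
    (\<lambda>n. grad (s n, stop_left (s n) (ap n x))) \<longlonglongrightarrow> grad (t, stop_left t x)"
  using F by (intro left_version_left_cont_seq) (auto simp: C12_def)

lemma hess_seq:
  "x \<in> \<Omega> \<Longrightarrow> 0 \<le> t \<Longrightarrow> s \<longlonglongrightarrow> t \<Longrightarrow> \<forall>\<^sub>F n in sequentially. 0 \<le> s n \<and> s n \<le> pp n t \<Longrightarrow>
    (\<lambda>n. hess (s n, stop_left (s n) (ap n x))) \<longlonglongrightarrow> hess (t, stop_left t x)"
  using F by (intro left_version_left_cont_seq) (auto simp: C12_def)

text \<open>Taylor's formula with Lagrange remainder for the restriction of \<open>F\<close> to the
  segment of bumps. The Hessian is taken at an intermediate path; its variation along the segment is
  estimated later through the vertical modulus.\<close>

lemma vertical_taylor: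
  assumes y: "\<And>\<xi>. 0 \<le> \<xi> \<Longrightarrow> \<xi> \<le> 1 \<Longrightarrow> (t, bump t (\<xi> *\<^sub>R d) y) \<in> stopped_paths \<Omega>"
  obtains \<xi> where "0 < \<xi>" "\<xi> < 1"
    "F (t, bump t d y) = F (t, y) + grad (t, y) \<bullet> d + (hess (t, bump t (\<xi> *\<^sub>R d) y) *v d) \<bullet> d / 2"
proof -
  define \<phi> where "\<phi> \<xi> = F (t, bump t (\<xi> *\<^sub>R d) y)" for \<xi>
  define \<psi> where "\<psi> \<xi> = d \<bullet> grad (t, bump t (\<xi> *\<^sub>R d) y)" for \<xi>
  define \<kappa> where "\<kappa> \<xi> = (hess (t, bump t (\<xi> *\<^sub>R d) y) *v d) \<bullet> d" for \<xi>
  have 1: "(\<phi> has_real_derivative \<psi> \<xi>) (at \<xi>)" if "0 \<le> \<xi>" "\<xi> \<le> 1" for \<xi>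
  proof -
    have "(\<lambda>e. F (t, bump t e (bump t (\<xi> *\<^sub>R d) y))) differentiable (at 0)"
      using F y[OF that] by (auto simp: C12_def vert_differentiable_def)
    from differentiable_imp_GDERIV[OF this]
    have "((\<lambda>e. F (t, bump t e (bump t (\<xi> *\<^sub>R d) y))) has_derivative
        (\<lambda>h. h \<bullet> grad (t, bump t (\<xi> *\<^sub>R d) y))) (at 0)"
      by (simp add: vert_grad_def gderiv_def)
    from has_derivative_bump_line[OF this]
    show ?thesis unfolding \<phi>_def \<psi>_def has_field_derivative_def
      by (simp add: mult_commute_abs)
  qed
  have 2: "(\<psi> has_real_derivative \<kappa> \<xi>) (at \<xi>)" if "0 \<le> \<xi>" "\<xi> \<le> 1" for \<xi>
  proof -
    have "(\<lambda>e. grad (t, bump t e (bump t (\<xi> *\<^sub>R d) y))) differentiable (at 0)"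
      using F y[OF that] by (auto simp: C12_def vert_differentiable_def)
    then have "((\<lambda>e. grad (t, bump t e (bump t (\<xi> *\<^sub>R d) y))) has_derivative
        (\<lambda>h. hess (t, bump t (\<xi> *\<^sub>R d) y) *v h)) (at 0)"
      by (simp add: jacobian_works vert_hess_def)
    from has_derivative_inner_right[OF has_derivative_bump_line[OF this], of d]
    show ?thesis unfolding \<psi>_def \<kappa>_def has_field_derivative_def
      by (simp add: matrix_vector_mult_scaleR inner_commute mult_commute_abs)
  qed
  define df where "df k = (if k = 0 then \<phi> else if k = 1 then \<psi> else \<kappa>)" for k :: nat
  have "\<exists>\<xi>. 0 < \<xi> \<and> \<xi> < 1 \<and> \<phi> 1 = (\<Sum>m<2. df m 0 / fact m * (1 - 0) ^ m) + df 2 \<xi> / fact 2 * (1 - 0) ^ 2"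
  proof (rule Taylor_up[where a = 0])
    show "\<forall>m t. m < 2 \<and> 0 \<le> t \<and> t \<le> 1 \<longrightarrow> DERIV (df m) t :> df (Suc m) t"
    proof (intro allI impI)
      fix m :: nat and t :: real assume "m < 2 \<and> 0 \<le> t \<and> t \<le> 1"
      then show "DERIV (df m) t :> df (Suc m) t"
        using 1[of t] 2[of t] by (cases m) (auto simp: df_def)
    qed
  qed (auto simp: df_def)
  then obtain \<xi> where "0 < \<xi>" "\<xi> < 1" "\<phi> 1 = \<phi> 0 + \<psi> 0 + \<kappa> \<xi> / 2"
    by (auto simp: df_def numeral_2_eq_2)
  then show ?thesis
    by (intro that[of \<xi>]) (auto simp: \<phi>_def \<psi>_def \<kappa>_def bump_0 inner_commute)
qed

text \<open>For positive \<open>i\<close> the vector \<open>dx x n i\<close> is the jump of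
  \<open>ap n x\<close>, so this is the error of the second-order expansion; at \<open>i = 0\<close>
  it has no such meaning and is left out of all sums.\<close>

definition rem :: "(real \<Rightarrow> real^'m) \<Rightarrow> nat \<Rightarrow> nat \<Rightarrow> real" where
  "rem x n i = F (\<pi> n ! i, stop (\<pi> n ! i) (ap n x)) - F (\<pi> n ! i, stop_left (\<pi> n ! i) (ap n x))
     - grad (\<pi> n ! i, stop_left (\<pi> n ! i) (ap n x)) \<bullet> dx x n i
     - (hess (\<pi> n ! i, stop_left (\<pi> n ! i) (ap n x)) *v dx x n i) \<bullet> dx x n i / 2"

lemma dx_bounded:
  assumes "x \<in> \<Omega>"
  obtains R where "0 < R" "\<forall>\<^sub>F n in sequentially. \<forall>i. Suc i < length (\<pi> n) \<and> \<pi> n ! i \<le> T \<longrightarrow> norm (dx x n i) \<le> R"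
proof -
  obtain B where B: "B > 0" "\<And>t. t \<le> T + 1 \<Longrightarrow> norm (x t) \<le> B"
    using cadlag_bounded[OF in_cadlag[OF assms], of "T + 1"] by metis
  have "\<forall>\<^sub>F n in sequentially. \<forall>i. Suc i < length (\<pi> n) \<and> \<pi> n ! i \<le> T \<longrightarrow> norm (dx x n i) \<le> 2 * B"
    using eventually_mesh[OF zero_less_one, of T]
  proof eventually_elim
    case (elim n)
    show ?case
    proof (intro allI impI)
      fix i assume i: "Suc i < length (\<pi> n) \<and> \<pi> n ! i \<le> T"
      then have "\<pi> n ! Suc i \<le> T + 1" using elim by force
      then have "norm (x (\<pi> n ! Suc i)) \<le> B" "norm (x (\<pi> n ! i)) \<le> B" using B i by auto
      then show "norm (dx x n i) \<le> 2 * B"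
        using norm_triangle_ineq4[of "x (\<pi> n ! Suc i)" "x (\<pi> n ! i)"] by linarith
    qed
  qed
  then show ?thesis using B that[of "2 * B"] by auto
qed

text \<open>Convexity of the neighbourhood keeps the whole segment between the left-stopped and the
  stopped path inside \<Omega>. The modulus then compares the Hessian at the intermediate path with
  the one at the left end, and \<open>R\<close> is the radius of the ball on which it is
  taken.\<close>

lemma rem_bound:
  assumes x: "x \<in> \<Omega>" and T: "0 \<le> T"
  obtains \<omega> :: "real \<Rightarrow> real" and R K where "mono_on {0..} \<omega>" "\<And>u. 0 \<le> u \<Longrightarrow> 0 \<le> \<omega> u" "(\<omega> \<longlongrightarrow> 0) (at_right 0)" "0 < R" "0 \<le> K"
    "\<forall>\<^sub>F n in sequentially. \<forall>i. Suc i < length (\<pi> n) \<and> 0 < i \<and> \<pi> n ! i \<le> T \<longrightarrow>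
       norm (dx x n i) \<le> R \<and> \<bar>rem x n i\<bar> \<le> K * \<omega> (norm (dx x n i)) * (norm (dx x n i))\<^sup>2"
proof -
  obtain R where R: "0 < R" "\<forall>\<^sub>F n in sequentially. \<forall>i. Suc i < length (\<pi> n) \<and> \<pi> n ! i \<le> T \<longrightarrow> norm (dx x n i) \<le> R"
    using dx_bounded[OF x] by blast
  obtain \<omega> :: "real \<Rightarrow> real" where \<omega>: "mono_on {0..} \<omega>" "\<And>u. 0 \<le> u \<Longrightarrow> 0 \<le> \<omega> u" "(\<omega> \<longlongrightarrow> 0) (at_right 0)"
    and mod: "\<forall>\<^sub>F n in sequentially. \<forall>t\<in>{0..T}.
           \<forall>a\<in>U t (ap n x) \<inter> cball 0 R. \<forall>b\<in>U t (ap n x) \<inter> cball 0 R.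
             norm (hess (t, bump t a (stop_left t (ap n x))) -
                   hess (t, bump t b (stop_left t (ap n x)))) \<le> \<omega> (norm (a - b))"
    using F x T R(1) unfolding C12_def vert_modulus_def by blast
  \<comment> \<open>The factor 1/2 comes from Taylor's formula, the squared dimension from
    \<open>quadratic_form_bound\<close>.\<close>
  define K where "K = (real CARD('m))\<^sup>2 / 2"
  have "\<forall>\<^sub>F n in sequentially. \<forall>i. Suc i < length (\<pi> n) \<and> 0 < i \<and> \<pi> n ! i \<le> T \<longrightarrow>
       norm (dx x n i) \<le> R \<and> \<bar>rem x n i\<bar> \<le> K * \<omega> (norm (dx x n i)) * (norm (dx x n i))\<^sup>2"
    using R(2) mod eventually_ap_in[OF x, of T]
  proof eventually_elim
    case (elim n)
    show ?case
    proof (intro allI impI conjI)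
      fix i assume i: "Suc i < length (\<pi> n) \<and> 0 < i \<and> \<pi> n ! i \<le> T"
      define t where "t = \<pi> n ! i"
      define d where "d = dx x n i"
      define y where "y = stop_left t (ap n x)"
      show dR: "norm (dx x n i) \<le> R" using elim(1) i by auto
      have t: "0 \<le> t" "t \<le> T" using i nth_nonneg[of i n] by (auto simp: t_def)
      have jump: "jump (ap n x) t = d" using i by (simp add: t_def d_def jump_ap)
      have stop_ap: "stop t (ap n x) \<in> \<Omega>" using elim(3) t by blast
      have V: "convex (U t (ap n x))" "0 \<in> U t (ap n x)" "d \<in> U t (ap n x)"
        "\<And>e. e \<in> U t (ap n x) \<Longrightarrow> bump t e y \<in> \<Omega>"
        using nbhds[unfolded vertical_nbhds_def, rule_format, OF t(1) ap_cadlag stop_ap]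
        by (auto simp: jump y_def intro: subsetD[OF interior_subset])
      have line: "\<xi> *\<^sub>R d \<in> U t (ap n x)" if "0 \<le> \<xi>" "\<xi> \<le> 1" for \<xi>
        using convexD[OF V(1,2,3), of "1 - \<xi>" \<xi>] that by simp
      have paths: "(t, bump t (\<xi> *\<^sub>R d) y) \<in> stopped_paths \<Omega>" if "0 \<le> \<xi>" "\<xi> \<le> 1" for \<xi>
        by (intro stopped_pathsI t V(4) line that stop_bump) (simp add: y_def stop_stop_left)
      obtain \<xi> where \<xi>: "0 < \<xi>" "\<xi> < 1"
        and eq: "F (t, bump t d y) = F (t, y) + grad (t, y) \<bullet> d + (hess (t, bump t (\<xi> *\<^sub>R d) y) *v d) \<bullet> d / 2"
        using vertical_taylor[OF paths] by blast
      let ?M = "hess (t, bump t (\<xi> *\<^sub>R d) y) - hess (t, y)"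
      have "bump t d y = stop t (ap n x)" using bump_jump[of t "ap n x"] by (simp add: jump y_def)
      then have "rem x n i = F (t, bump t d y) - F (t, y) - grad (t, y) \<bullet> d - (hess (t, y) *v d) \<bullet> d / 2"
        by (simp add: rem_def t_def d_def y_def)
      also have "\<dots> = (?M *v d) \<bullet> d / 2"
        unfolding eq by (simp add: matrix_vector_mult_diff_rdistrib inner_diff_left)
      finally have rem: "\<bar>rem x n i\<bar> = \<bar>(?M *v d) \<bullet> d\<bar> / 2" by simp
      have small: "norm (\<xi> *\<^sub>R d) \<le> norm d" using \<xi> by (simp add: mult_left_le_one_le)
      then have mem: "\<xi> *\<^sub>R d \<in> U t (ap n x) \<inter> cball 0 R" "0 \<in> U t (ap n x) \<inter> cball 0 R"
        using line[of \<xi>] \<xi> V(2) dR R(1) by (auto simp: d_def)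
      have "norm ?M \<le> \<omega> (norm (\<xi> *\<^sub>R d))"
        using bspec[OF bspec[OF bspec[OF elim(2), of t] mem(1)] mem(2)] t
        by (simp add: y_def bump_0)
      also have "\<dots> \<le> \<omega> (norm d)" using small by (intro mono_onD[OF \<omega>(1)]) auto
      finally have "(real CARD('m))\<^sup>2 * norm ?M * (norm d)\<^sup>2 \<le> (real CARD('m))\<^sup>2 * \<omega> (norm d) * (norm d)\<^sup>2"
        by (intro mult_right_mono mult_left_mono) auto
      with quadratic_form_bound[of ?M d]
      have "\<bar>(?M *v d) \<bullet> d\<bar> \<le> (real CARD('m))\<^sup>2 * \<omega> (norm d) * (norm d)\<^sup>2" by linarith
      then show "\<bar>rem x n i\<bar> \<le> K * \<omega> (norm (dx x n i)) * (norm (dx x n i))\<^sup>2"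
        unfolding rem by (simp add: K_def d_def)
    qed
  qed
  then show ?thesis using that[OF \<omega> R(1), of K] by (simp add: K_def)
qed

end

lemma quadratic_form_tendsto:
  fixes M :: "'z \<Rightarrow> real^'m^'m"
  assumes "(M \<longlongrightarrow> M0) net" "(d \<longlongrightarrow> d0) net"
  shows "((\<lambda>z. (M z *v d z) \<bullet> d z) \<longlongrightarrow> (M0 *v d0) \<bullet> d0) net"
  unfolding inner_vec_def matrix_vector_mult_def inner_real_def vec_lambda_beta
  by (intro tendsto_sum tendsto_mult tendsto_vec_nth assms)

text \<open>On \<open>outer d\<close> the functionals \<open>S 1 a b\<close> and
  \<open>S (- 1) a b\<close> are the squares of \<open>d $ a + d $ b\<close> and
  \<open>d $ a - d $ b\<close>. They are linear in the matrix, so they pass to the quadratic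
  variation, and nonnegative on increments, as the Stieltjes argument demands.\<close>

lemma quadratic_form_polarisation:
  fixes H :: "real^'m^'m"
  defines "S \<equiv> \<lambda>\<sigma> a b M :: real^'m^'m. M $ a $ a + M $ b $ b + \<sigma> * (M $ a $ b + M $ b $ a)"
  shows "(H *v d) \<bullet> d = (\<Sum>a\<in>UNIV. \<Sum>b\<in>UNIV. 1 / 4 * (H $ a $ b * S 1 a b (outer d) - H $ a $ b * S (- 1) a b (outer d)))"
  unfolding inner_vec_def matrix_vector_mult_def
  by (auto simp: S_def sum_distrib_left sum_distrib_right algebra_simps intro!: sum.cong)

context c12_functional begin

section \<open>The second-order terms\<close>

text \<open>A linear functional that is nonnegative on \<open>outer d\<close> makes the discrete
  quadratic variation a nondecreasing scalar integrator, whose sided limits are the images of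
  \<open>q\<close> and of its left limits.\<close>

lemma qv_conv:
  fixes L :: "real^'m^'m \<Rightarrow> real"
  assumes x: "x \<in> \<Omega>" and L: "bounded_linear L" "\<And>d. 0 \<le> L (outer d)"
    and f_at: "\<And>t i. \<lbrakk>0 < t; t < T; \<forall>\<^sub>F n in sequentially. Suc (i n) < length (\<pi> n) \<and> \<pi> n ! i n = pp n t\<rbrakk>
      \<Longrightarrow> (\<lambda>n. f n (i n)) \<longlonglongrightarrow> fa t"
    and f_left: "\<And>t i. \<lbrakk>0 < t; t < T; (\<lambda>n. \<pi> n ! i n) \<longlonglongrightarrow> t;
        \<forall>\<^sub>F n in sequentially. Suc (i n) < length (\<pi> n) \<and> \<pi> n ! i n < pp n t\<rbrakk>
      \<Longrightarrow> (\<lambda>n. f n (i n)) \<longlonglongrightarrow> fl t"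
    and f_bound: "\<And>n i. \<lbrakk>n0 \<le> n; Suc i < length (\<pi> n); \<pi> n ! i \<le> T\<rbrakk> \<Longrightarrow> \<bar>f n i\<bar> \<le> C"
  shows "sided_conv T (\<lambda>n s. \<Sum>i\<in>upto_idx n s. f n i * L (outer (dx x n i)))"
proof -
  obtain q where q: "q \<in> cadlag" "J1_converges (\<lambda>n. discrete_qv \<pi> n x) q"
    using QV x by (auto simp: QV_paths_def)
  note J = J1_sided_limits[OF in_cadlag[OF x] q]
  have eq: "L (discrete_qv \<pi> n x s) = (\<Sum>i\<in>upto_idx n s. L (outer (dx x n i)))" for n s
    unfolding discrete_qv_eq using bounded_linear.linear[OF L(1)] by (rule linear_sum)
  have lim: "sided_limits (\<lambda>n s. \<Sum>i\<in>upto_idx n s. L (outer (dx x n i))) (\<lambda>t. L (q t)) (\<lambda>t. L (left_lim q t))"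
    unfolding eq[symmetric] sided_limits_def
  proof (intro conjI allI impI)
    fix t s assume "(0::real) \<le> t" "right_approach t s"
    then show "(\<lambda>n. L (discrete_qv \<pi> n x (s n))) \<longlonglongrightarrow> L (q t)"
      by (intro bounded_linear.tendsto[OF L(1)] sided_limitsD(1)[OF J(1)])
  next
    fix t s assume "(0::real) < t" "left_approach t s"
    then show "(\<lambda>n. L (discrete_qv \<pi> n x (s n))) \<longlonglongrightarrow> L (left_lim q t)"
      by (intro bounded_linear.tendsto[OF L(1)] sided_limitsD(2)[OF J(1)])
  qed
  show ?thesis
    by (rule stieltjes_conv[where m = "\<lambda>n i. L (outer (dx x n i))", OF L(2) lim _ f_at f_left f_bound])
       (simp_all add: J(2) linear_0[OF bounded_linear.linear[OF L(1)]])
qed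

abbreviation hess_at :: "(real \<Rightarrow> real^'m) \<Rightarrow> nat \<Rightarrow> nat \<Rightarrow> real^'m^'m" where
  "hess_at x n i \<equiv> hess (\<pi> n ! i, stop_left (\<pi> n ! i) (ap n x))"

abbreviation grad_at :: "(real \<Rightarrow> real^'m) \<Rightarrow> nat \<Rightarrow> nat \<Rightarrow> real^'m" where
  "grad_at x n i \<equiv> grad (\<pi> n ! i, stop_left (\<pi> n ! i) (ap n x))"

lemma hess_at_tendsto:
  assumes x: "x \<in> \<Omega>" and t: "0 \<le> t" and i: "(\<lambda>n. \<pi> n ! i n) \<longlonglongrightarrow> t"
    "\<forall>\<^sub>F n in sequentially. Suc (i n) < length (\<pi> n) \<and> \<pi> n ! i n \<le> pp n t"
  shows "(\<lambda>n. hess_at x n (i n)) \<longlonglongrightarrow> hess (t, stop_left t x)"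
proof (rule hess_seq[OF x t i(1)])
  show "\<forall>\<^sub>F n in sequentially. 0 \<le> \<pi> n ! i n \<and> \<pi> n ! i n \<le> pp n t"
    using i(2) by eventually_elim (auto intro: nth_nonneg)
qed

lemma grad_at_tendsto:
  assumes x: "x \<in> \<Omega>" and t: "0 \<le> t" and i: "(\<lambda>n. \<pi> n ! i n) \<longlonglongrightarrow> t"
    "\<forall>\<^sub>F n in sequentially. Suc (i n) < length (\<pi> n) \<and> \<pi> n ! i n \<le> pp n t"
  shows "(\<lambda>n. grad_at x n (i n)) \<longlonglongrightarrow> grad (t, stop_left t x)"
proof (rule grad_seq[OF x t i(1)])
  show "\<forall>\<^sub>F n in sequentially. 0 \<le> \<pi> n ! i n \<and> \<pi> n ! i n \<le> pp n t"
    using i(2) by eventually_elim (auto intro: nth_nonneg)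
qed

text \<open>Here the two limits of the weights coincide: at \<open>pp n t\<close> as well as before
  it the Hessian is taken at the left-stopped path, so left continuity gives its value at
  \<open>stop_left t x\<close> in both cases.\<close>

lemma hess_conv:
  assumes x: "x \<in> \<Omega>" and T: "0 < T"
  shows "sided_conv T (\<lambda>n s. \<Sum>i\<in>upto_idx n s. (hess_at x n i *v dx x n i) \<bullet> dx x n i)"
proof -
  define S where "S = (\<lambda>\<sigma> a b (M :: real^'m^'m). M $ a $ a + M $ b $ b + \<sigma> * (M $ a $ b + M $ b $ a))"
  have "locally_bounded \<pi> \<Omega> (left_version hess)" using F by (simp add: C12_def)
  then obtain n0 C where C: "\<And>n t. n0 \<le> n \<Longrightarrow> 0 \<le> t \<Longrightarrow> t \<le> T \<Longrightarrow>
      norm (left_version hess (t, stop t (ap n x))) \<le> C"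
    using x T unfolding locally_bounded_def by (metis atLeastAtMost_iff less_imp_le)
  have S_lin: "bounded_linear (S \<sigma> a b)" for \<sigma> a b
    unfolding S_def
    by (intro bounded_linear_add bounded_linear_const_mult
          bounded_linear_compose[OF bounded_linear_vec_nth bounded_linear_vec_nth])
  have S_pos: "0 \<le> S \<sigma> a b (outer d)" if "\<sigma> = 1 \<or> \<sigma> = - 1" for \<sigma> a b d
  proof -
    have "S \<sigma> a b (outer d) = (d $ a + \<sigma> * d $ b)\<^sup>2"
      using that by (auto simp: S_def power2_eq_square algebra_simps)
    then show ?thesis by simp
  qed
  have conv: "sided_conv T (\<lambda>n s. \<Sum>i\<in>upto_idx n s. hess_at x n i $ a $ b * S \<sigma> a b (outer (dx x n i)))"
    if \<sigma>: "\<sigma> = 1 \<or> \<sigma> = - 1" for \<sigma> a b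
  proof (rule qv_conv[OF x S_lin S_pos[OF \<sigma>]])
    fix t i assume t: "0 < t" "t < T"
      and i: "\<forall>\<^sub>F n in sequentially. Suc (i n) < length (\<pi> n) \<and> \<pi> n ! i n = pp n t"
    show "(\<lambda>n. hess_at x n (i n) $ a $ b) \<longlonglongrightarrow> hess (t, stop_left t x) $ a $ b"
      by (intro tendsto_vec_nth hess_at_tendsto[OF x] dx_tendsto_jump(4)[OF in_cadlag[OF x] t(1) i])
         (use t i in \<open>auto elim: eventually_mono\<close>)
  next
    fix t i assume t: "0 < t" "t < T" and i: "(\<lambda>n. \<pi> n ! i n) \<longlonglongrightarrow> t"
      "\<forall>\<^sub>F n in sequentially. Suc (i n) < length (\<pi> n) \<and> \<pi> n ! i n < pp n t"
    show "(\<lambda>n. hess_at x n (i n) $ a $ b) \<longlonglongrightarrow> hess (t, stop_left t x) $ a $ b"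
      by (intro tendsto_vec_nth hess_at_tendsto[OF x _ i(1)])
         (use t i in \<open>auto elim: eventually_mono\<close>)
  next
    fix n i assume i: "n0 \<le> n" "Suc i < length (\<pi> n)" "\<pi> n ! i \<le> T"
    have nn: "0 \<le> \<pi> n ! i" using i nth_nonneg[of i n] by simp
    have "norm (hess_at x n i) \<le> C"
      using C[OF i(1) nn i(3)] nn by (simp add: left_version_def stop_left_stop)
    then show "\<bar>hess_at x n i $ a $ b\<bar> \<le> C"
      using component_le_norm_cart[of "hess_at x n i $ a" b]
        Finite_Cartesian_Product.norm_nth_le[of "hess_at x n i" a] by linarith
  qed
  let ?h = "\<lambda>\<sigma> a b n i. hess_at x n i $ a $ b * S \<sigma> a b (outer (dx x n i))"
  have "sided_conv T (\<lambda>n s. \<Sum>a\<in>UNIV. \<Sum>b\<in>UNIV. 1 / 4 *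
      ((\<Sum>i\<in>upto_idx n s. ?h 1 a b n i) - (\<Sum>i\<in>upto_idx n s. ?h (- 1) a b n i)))"
    by (intro sided_conv_sum sided_conv_cmult sided_conv_diff conv finite) auto
  moreover have "(\<Sum>a\<in>UNIV. \<Sum>b\<in>UNIV. 1 / 4 *
      ((\<Sum>i\<in>upto_idx n s. ?h 1 a b n i) - (\<Sum>i\<in>upto_idx n s. ?h (- 1) a b n i))) =
     (\<Sum>i\<in>upto_idx n s. (hess_at x n i *v dx x n i) \<bullet> dx x n i)" for n s
  proof -
    have "(\<Sum>i\<in>upto_idx n s. (hess_at x n i *v dx x n i) \<bullet> dx x n i) =
      (\<Sum>i\<in>upto_idx n s. \<Sum>a\<in>UNIV. \<Sum>b\<in>UNIV. 1 / 4 * (?h 1 a b n i - ?h (- 1) a b n i))"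
      by (intro sum.cong refl, subst quadratic_form_polarisation, simp only: S_def)
    also have "\<dots> = (\<Sum>a\<in>UNIV. \<Sum>b\<in>UNIV. \<Sum>i\<in>upto_idx n s. 1 / 4 * (?h 1 a b n i - ?h (- 1) a b n i))"
      by (subst sum.swap, intro sum.cong refl, rule sum.swap)
    also have "\<dots> = (\<Sum>a\<in>UNIV. \<Sum>b\<in>UNIV. 1 / 4 *
      ((\<Sum>i\<in>upto_idx n s. ?h 1 a b n i) - (\<Sum>i\<in>upto_idx n s. ?h (- 1) a b n i)))"
      by (simp only: sum_distrib_left[symmetric] sum_subtractf)
    finally show ?thesis by (rule sym)
  qed
  ultimately show ?thesis by (simp only:)
qed

text \<open>The remainder is written as a weight times the squared increment, that is, against the
  trace of the quadratic variation. The modulus bounds the weight and sends it to 0 where increments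
  vanish, while at \<open>pp n t\<close> it may keep a nonzero limit. This replaces a separation
  into small and large jumps.\<close>

lemma rem_conv:
  assumes x: "x \<in> \<Omega>" and T: "0 < T"
  shows "sided_conv T (\<lambda>n s. \<Sum>i\<in>upto_idx n s. if i = 0 then 0 else rem x n i)"
proof -
  \<comment> \<open>Where \<open>dx x n i = 0\<close> the quotient is 0 by the convention for
    division; for positive \<open>i\<close> and large \<open>n\<close> the remainder vanishes there
    too, by \<open>rem_bound\<close>, so no term is lost.\<close>
  define f where "f n i = (if i = 0 then 0 else rem x n i / (norm (dx x n i))\<^sup>2)" for n i
  define L where "L = (\<lambda>M :: real^'m^'m. \<Sum>a\<in>UNIV. M $ a $ a)"
  have L_outer: "L (outer d) = (norm d)\<^sup>2" for d
    by (simp add: L_def power2_norm_eq_inner inner_vec_def)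
  have L_lin: "bounded_linear L" unfolding L_def
    by (intro bounded_linear_sum bounded_linear_compose[OF bounded_linear_vec_nth bounded_linear_vec_nth])
  obtain \<omega> :: "real \<Rightarrow> real" and R K where \<omega>: "mono_on {0..} \<omega>" "\<And>u. 0 \<le> u \<Longrightarrow> 0 \<le> \<omega> u" "(\<omega> \<longlongrightarrow> 0) (at_right 0)"
    and R: "0 < R" and K: "0 \<le> K"
    and ev: "\<forall>\<^sub>F n in sequentially. \<forall>i. Suc i < length (\<pi> n) \<and> 0 < i \<and> \<pi> n ! i \<le> T \<longrightarrow>
       norm (dx x n i) \<le> R \<and> \<bar>rem x n i\<bar> \<le> K * \<omega> (norm (dx x n i)) * (norm (dx x n i))\<^sup>2"
    by (rule rem_bound[OF x less_imp_le[OF T]]) (rule that; assumption)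
  obtain n0 where ev_n0: "\<forall>n\<ge>n0. \<forall>i. Suc i < length (\<pi> n) \<and> 0 < i \<and> \<pi> n ! i \<le> T \<longrightarrow>
       norm (dx x n i) \<le> R \<and> \<bar>rem x n i\<bar> \<le> K * \<omega> (norm (dx x n i)) * (norm (dx x n i))\<^sup>2"
    by (rule exE[OF ev[unfolded eventually_sequentially]])
  have n0: "norm (dx x n i) \<le> R \<and> \<bar>rem x n i\<bar> \<le> K * \<omega> (norm (dx x n i)) * (norm (dx x n i))\<^sup>2"
    if "n0 \<le> n" "Suc i < length (\<pi> n)" "0 < i" "\<pi> n ! i \<le> T" for n i
    by (rule ev_n0[rule_format, OF that(1) conjI[OF that(2) conjI[OF that(3,4)]]])
  have f_le: "\<bar>f n i\<bar> \<le> K * \<omega> (norm (dx x n i))" if "n0 \<le> n" "Suc i < length (\<pi> n)" "\<pi> n ! i \<le> T" for n i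
  proof (cases "i = 0 \<or> dx x n i = 0")
    case True
    then have "f n i = 0" by (auto simp: f_def)
    moreover have "0 \<le> K * \<omega> (norm (dx x n i))"
      by (intro mult_nonneg_nonneg K \<omega>(2) norm_ge_zero)
    ultimately show ?thesis by simp
  next
    case False
    then have pos: "0 < (norm (dx x n i))\<^sup>2" and "0 < i" by auto
    have "\<bar>f n i\<bar> = \<bar>rem x n i\<bar> / (norm (dx x n i))\<^sup>2"
      using False by (simp add: f_def abs_divide)
    also have "\<dots> \<le> K * \<omega> (norm (dx x n i))"
      unfolding pos_divide_le_eq[OF pos] using n0[OF that(1,2) \<open>0 < i\<close> that(3)] by blast
    finally show ?thesis .
  qed
  \<comment> \<open>This covers indices strictly left of \<open>pp n t\<close>, and also those at
    \<open>pp n t\<close> when \<open>x\<close> does not jump at \<open>t\<close>.\<close>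
  have zero: "(\<lambda>n. f n (i n)) \<longlonglongrightarrow> 0"
    if i: "(\<lambda>n. \<pi> n ! i n) \<longlonglongrightarrow> t" "t < T" "\<forall>\<^sub>F n in sequentially. Suc (i n) < length (\<pi> n)"
      and d: "(\<lambda>n. dx x n (i n)) \<longlonglongrightarrow> 0" for i t
  proof (rule tendstoI)
    fix e :: real assume e: "e > 0"
    have "((\<lambda>u. K * \<omega> u) \<longlongrightarrow> K * 0) (at_right 0)" by (intro tendsto_mult_left \<omega>)
    then have "\<forall>\<^sub>F u in at_right 0. K * \<omega> u < e" by (rule order_tendstoD) (use e in simp)
    then obtain b where b: "b > 0" "\<And>u. 0 < u \<Longrightarrow> u < b \<Longrightarrow> K * \<omega> u < e"
      by (auto simp: eventually_at_right_field)
    have "\<forall>\<^sub>F n in sequentially. dist (dx x n (i n)) 0 < b" using d b(1) by (rule tendstoD)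
    moreover have "\<forall>\<^sub>F n in sequentially. \<pi> n ! i n < T" using i(1,2) by (rule order_tendstoD)
    ultimately show "\<forall>\<^sub>F n in sequentially. dist (f n (i n)) 0 < e"
      using i(3) eventually_ge_at_top[of n0]
    proof eventually_elim
      case (elim n)
      show ?case
      proof (cases "dx x n (i n) = 0")
        case True
        then show ?thesis using e by (simp add: f_def)
      next
        case False
        then have "K * \<omega> (norm (dx x n (i n))) < e" using b(2) elim(1) by simp
        then show ?thesis using f_le[of n "i n"] elim by (simp add: dist_real_def)
      qed
    qed
  qed
  \<comment> \<open>At a jump the quotient itself converges. Its first two terms use both kinds of
    continuity of \<open>F\<close> at \<open>pp n t\<close>, which is at once an admissible time for
    stopped paths from the right and for left-stopped paths from the left.\<close>
  define fa where "fa t = (if jump x t = 0 then 0 else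
      (F (t, stop t x) - F (t, stop_left t x) - grad (t, stop_left t x) \<bullet> jump x t
       - (hess (t, stop_left t x) *v jump x t) \<bullet> jump x t / 2) / (norm (jump x t))\<^sup>2)" for t
  have "sided_conv T (\<lambda>n s. \<Sum>i\<in>upto_idx n s. f n i * L (outer (dx x n i)))"
  proof (rule qv_conv[OF x L_lin, where fl = "\<lambda>_. 0"])
    show "0 \<le> L (outer d)" for d by (simp add: L_outer)
  next
    fix t i assume t: "0 < t" "t < T"
      and i: "\<forall>\<^sub>F n in sequentially. Suc (i n) < length (\<pi> n) \<and> \<pi> n ! i n = pp n t"
    note lim = dx_tendsto_jump[OF in_cadlag[OF x] t(1) i]
    have len: "\<forall>\<^sub>F n in sequentially. Suc (i n) < length (\<pi> n)" using i by eventually_elim auto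
    have le: "\<forall>\<^sub>F n in sequentially. Suc (i n) < length (\<pi> n) \<and> \<pi> n ! i n \<le> pp n t"
      and ge: "\<forall>\<^sub>F n in sequentially. pp n t \<le> \<pi> n ! i n"
      and nn: "\<forall>\<^sub>F n in sequentially. 0 \<le> \<pi> n ! i n \<and> \<pi> n ! i n \<le> pp n t"
      using i by (auto elim!: eventually_mono simp: pp_nonneg)
    show "(\<lambda>n. f n (i n)) \<longlonglongrightarrow> fa t"
    proof (cases "jump x t = 0")
      case True
      then show ?thesis using zero[OF lim(4) t(2) len] lim(3) by (simp add: fa_def)
    next
      case False
      have "(\<lambda>n. rem x n (i n) / (norm (dx x n (i n)))\<^sup>2) \<longlonglongrightarrow> fa t"
        unfolding rem_def fa_def if_not_P[OF False]
        by (intro tendsto_divide tendsto_diff tendsto_inner quadratic_form_tendsto tendsto_power tendsto_norm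
              tendsto_const lim(3) hess_at_tendsto[OF x _ lim(4) le] grad_at_tendsto[OF x _ lim(4) le]
              right_cont_seq[OF F_right_cont x _ lim(4) ge] left_cont_seq(1)[OF F_left_cont x _ lim(4) nn])
           (use False t in auto)
      moreover have "\<forall>\<^sub>F n in sequentially. rem x n (i n) / (norm (dx x n (i n)))\<^sup>2 = f n (i n)"
      proof -
        have "\<forall>\<^sub>F n in sequentially. 0 < \<pi> n ! i n" using lim(4) t(1) by (rule order_tendstoD)
        then show ?thesis by eventually_elim (auto simp: f_def nth_0)
      qed
      ultimately show ?thesis by (rule Lim_transform_eventually)
    qed
  next
    fix t i assume t: "0 < t" "t < T" and i: "(\<lambda>n. \<pi> n ! i n) \<longlonglongrightarrow> t"
      "\<forall>\<^sub>F n in sequentially. Suc (i n) < length (\<pi> n) \<and> \<pi> n ! i n < pp n t"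
    have len: "\<forall>\<^sub>F n in sequentially. Suc (i n) < length (\<pi> n)" using i(2) by eventually_elim auto
    have "(\<lambda>n. dx x n (i n)) \<longlonglongrightarrow> 0"
      by (rule dx_tendsto_0[OF in_cadlag[OF x] less_imp_le[OF t(1)] i(1)])
         (use i(2) t in \<open>auto elim: eventually_mono\<close>)
    then show "(\<lambda>n. f n (i n)) \<longlonglongrightarrow> 0" by (rule zero[OF i(1) t(2) len])
  next
    fix n i assume i: "n0 \<le> n" "Suc i < length (\<pi> n)" "\<pi> n ! i \<le> T"
    show "\<bar>f n i\<bar> \<le> K * \<omega> R"
    proof (cases "i = 0")
      case True
      then show ?thesis using K \<omega>(2)[of R] R by (simp add: f_def)
    next
      case False
      then have "\<omega> (norm (dx x n i)) \<le> \<omega> R"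
        using n0[OF i(1,2) _ i(3)] R by (intro mono_onD[OF \<omega>(1)]) auto
      then show ?thesis using f_le[OF i] K mult_left_mono by (meson order_trans)
    qed
  qed
  then show ?thesis
  proof (rule sided_conv_cong)
    show "\<forall>\<^sub>F n in sequentially. \<forall>s. 0 \<le> s \<and> s < T \<longrightarrow>
        (\<Sum>i\<in>upto_idx n s. f n i * L (outer (dx x n i))) = (\<Sum>i\<in>upto_idx n s. if i = 0 then 0 else rem x n i)"
      using eventually_ge_at_top[of n0]
    proof eventually_elim
      case (elim n)
      show ?case
      proof (intro allI impI sum.cong refl)
        fix s i assume s: "0 \<le> s \<and> s < T" and i: "i \<in> upto_idx n s"
        have "f n i * (norm (dx x n i))\<^sup>2 = (if i = 0 then 0 else rem x n i)"
        proof (cases "i = 0 \<or> dx x n i \<noteq> 0")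
          case False
          then have "\<bar>rem x n i\<bar> \<le> 0" using n0[OF elim, of i] i s by auto
          then show ?thesis using False by (simp add: f_def)
        qed (auto simp: f_def)
        then show "f n i * L (outer (dx x n i)) = (if i = 0 then 0 else rem x n i)"
          unfolding L_outer .
      qed
    qed
  qed
qed

section \<open>The horizontal term\<close>

definition vjump :: "(real \<Rightarrow> real^'m) \<Rightarrow> nat \<Rightarrow> nat \<Rightarrow> real" where
  "vjump x n i = F (\<pi> n ! i, stop (\<pi> n ! i) (ap n x)) - F (\<pi> n ! i, stop_left (\<pi> n ! i) (ap n x))"

text \<open>Removing the vertical jumps of \<open>F\<close> along \<open>ap n x\<close> leaves a
  continuous function of time. Between partition points the path is frozen, so its right derivative
  is the horizontal derivative of \<open>F\<close>. Index 0 contributes nothing, since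
  \<open>ap n x\<close> has no jump at time 0.\<close>

definition hor :: "(real \<Rightarrow> real^'m) \<Rightarrow> nat \<Rightarrow> real \<Rightarrow> real" where
  "hor x n s = F (s, stop s (ap n x)) - (\<Sum>i\<in>upto_idx n s. if i = 0 then 0 else vjump x n i)"

lemma hor_right_deriv:
  assumes paths: "\<forall>t. 0 \<le> t \<and> t \<le> T \<longrightarrow> (t, stop t (ap n x)) \<in> stopped_paths \<Omega>"
    and T: "T < last (\<pi> n)" and s: "0 \<le> s" "s < T"
  shows "((\<lambda>h. (hor x n (s + h) - hor x n s) / h) \<longlongrightarrow> horiz_deriv F (s, stop s (ap n x))) (at_right 0)"
proof -
  have p: "(s, stop s (ap n x)) \<in> stopped_paths \<Omega>" using paths s by auto
  have hd: "horiz_differentiable \<Omega> F" using F by (simp add: C12_def)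
  obtain l where l: "((\<lambda>h. (F (s + h, stop s (ap n x)) - F (s, stop s (ap n x))) / h) \<longlongrightarrow> l) (at_right 0)"
    using bspec[OF hd[unfolded horiz_differentiable_def] p] by auto
  then have "horiz_deriv F (s, stop s (ap n x)) = l"
    by (simp add: horiz_deriv_def tendsto_Lim)
  moreover obtain b where b: "s < b" "\<And>u. s \<le> u \<Longrightarrow> u < b \<Longrightarrow>
      stop u (ap n x) = stop s (ap n x) \<and> upto_idx n u = upto_idx n s"
    using ap_const_right[of s n x] s T by auto
  have "\<forall>\<^sub>F h in at_right 0. (F (s + h, stop s (ap n x)) - F (s, stop s (ap n x))) / h = (hor x n (s + h) - hor x n s) / h"
    unfolding eventually_at_right_field
  proof (intro exI[of _ "b - s"] conjI allI impI)
    fix h assume "0 < h" "h < b - s"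
    then have "stop (s + h) (ap n x) = stop s (ap n x)" "upto_idx n (s + h) = upto_idx n s"
      using b(2)[of "s + h"] by auto
    then show "(F (s + h, stop s (ap n x)) - F (s, stop s (ap n x))) / h = (hor x n (s + h) - hor x n s) / h"
      unfolding hor_def by simp
  qed (use b in simp)
  ultimately show ?thesis using Lim_transform_eventually[OF l] by simp
qed

text \<open>Between partition points \<open>ap n x\<close> is continuous, so the left-stopped and
  the stopped path coincide and both sides are 0.\<close>

lemma sum_vjump_at:
  assumes s: "0 < s" "s < last (\<pi> n)"
  shows "(\<Sum>i | Suc i < length (\<pi> n) \<and> \<pi> n ! i = s. if i = 0 then 0 else vjump x n i) =
    F (s, stop s (ap n x)) - F (s, stop_left s (ap n x))"
proof -
  obtain i where i: "Suc i < length (\<pi> n)" "\<pi> n ! i \<le> s" "s < \<pi> n ! Suc i"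
    using partition_interval[of s n] s by auto
  let ?I = "{i. Suc i < length (\<pi> n) \<and> \<pi> n ! i = s}"
  show ?thesis
  proof (cases "\<pi> n ! i = s")
    case True
    have "k = i" if "k \<in> ?I" for k using that i True nth_eq_iff[of k n i] by simp
    then have I: "?I = {i}" using i True by blast
    have "i \<noteq> 0" using True s nth_0[of n] by (intro notI) simp
    then show ?thesis unfolding I using True by (simp add: vjump_def)
  next
    case False
    have I: "?I = {}"
    proof (intro equals0I)
      fix k assume k: "k \<in> ?I"
      then have "\<pi> n ! i < \<pi> n ! k" "\<pi> n ! k < \<pi> n ! Suc i" using i False by auto
      then have "i < k" "k < Suc i" using k i nth_less_iff[of i n k] nth_less_iff[of k n "Suc i"] by simp_all
      then show False by simp
    qed
    have "left_lim (ap n x) s = ap n x s"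
      using left_lim_ap[OF i(1), of s x] ap_eq[OF i, of x] i False by simp
    then have "stop_left s (ap n x) = stop s (ap n x)" by (rule stop_left_continuous)
    then show ?thesis unfolding I by simp
  qed
qed

text \<open>From the right both \<open>F\<close> and the jump sum are continuous. From the left
  \<open>F\<close> tends to its value at the left-stopped path, and the jump sum lacks exactly the
  missing difference. Continuity of \<open>F\<close> is applied to \<open>stop T (ap n x)\<close>,
  since the unstopped approximation is not known to lie in \<Omega>.\<close>

lemma hor_continuous:
  assumes TO: "stop T (ap n x) \<in> \<Omega>" and T: "T < last (\<pi> n)"
  shows "continuous_on {0..T} (hor x n)"
  unfolding continuous_on_def
proof
  fix s assume s: "s \<in> {0..T}"
  define y where "y = stop T (ap n x)"
  have y: "y \<in> \<Omega>" using TO by (simp add: y_def)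
  have stop_y: "stop u y = stop u (ap n x)" if "u \<le> T" for u
    using that by (simp add: y_def stop_stop)
  have stop_left_y: "stop_left s y = stop_left s (ap n x)"
    using s by (simp add: y_def stop_left_stop)
  have right: "(hor x n \<longlongrightarrow> hor x n s) (at s within {s..T})"
  proof -
    let ?c = "\<Sum>i\<in>upto_idx n s. if i = 0 then 0 else vjump x n i"
    obtain b where b: "s < b" "\<And>u. s \<le> u \<Longrightarrow> u < b \<Longrightarrow>
        stop u (ap n x) = stop s (ap n x) \<and> upto_idx n u = upto_idx n s"
      using ap_const_right[of s n x] s T by auto
    have "((\<lambda>u. F (u, stop u y)) \<longlongrightarrow> F (s, stop s y)) (at s within {s..})"
      using F_right_cont y s by (auto simp: right_cont_def)
    then have "((\<lambda>u. F (u, stop u y)) \<longlongrightarrow> F (s, stop s y)) (at s within {s..T})"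
      by (rule tendsto_within_subset) auto
    then have "((\<lambda>u. F (u, stop u y) - ?c) \<longlongrightarrow> F (s, stop s y) - ?c) (at s within {s..T})"
      by (intro tendsto_intros)
    moreover have "F (s, stop s y) - ?c = hor x n s" using s by (simp add: stop_y hor_def)
    moreover have "\<forall>\<^sub>F u in at s within {s..T}. F (u, stop u y) - ?c = hor x n u"
    proof -
      have "\<forall>\<^sub>F u in at s within {s..T}. u < b" using tendsto_ident_at b(1) by (rule order_tendstoD)
      moreover have "\<forall>\<^sub>F u in at s within {s..T}. u \<in> {s..T}" by (simp add: eventually_at_filter)
      ultimately show ?thesis
      proof eventually_elim
        case (elim u)
        then have "upto_idx n u = upto_idx n s" using b(2)[of u] by auto
        then show ?case using elim stop_y[of u] unfolding hor_def by simp
      qed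
    qed
    ultimately show ?thesis using Lim_transform_eventually by force
  qed
  show "(hor x n \<longlongrightarrow> hor x n s) (at s within {0..T})"
  proof (cases "s = 0")
    case True
    then show ?thesis using right by simp
  next
    case False
    then have s0: "0 < s" "s < last (\<pi> n)" using s T by auto
    let ?c = "\<lambda>u. \<Sum>i\<in>upto_idx n u. if i = 0 then 0 else vjump x n i"
    let ?j = "F (s, stop s (ap n x)) - F (s, stop_left s (ap n x))"
    have "((\<lambda>u. F (u, stop u y)) \<longlongrightarrow> F (s, stop_left s y)) (at s within {0..<s})"
      using F_left_cont y s by (auto simp: left_cont_def)
    then have "((\<lambda>u. F (u, stop u y) - (?c s - ?j)) \<longlongrightarrow> F (s, stop_left s y) - (?c s - ?j)) (at s within {0..<s})"
      by (intro tendsto_intros)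
    moreover have "F (s, stop_left s y) - (?c s - ?j) = hor x n s"
      unfolding stop_left_y hor_def by simp
    moreover have "\<forall>\<^sub>F u in at s within {0..<s}. F (u, stop u y) - (?c s - ?j) = hor x n u"
    proof -
      have "\<forall>\<^sub>F u in at s within {0..<s}. pp n s < u"
        using tendsto_ident_at pp_max(2)[OF s0(1)] by (rule order_tendstoD)
      moreover have "\<forall>\<^sub>F u in at s within {0..<s}. u \<in> {0..<s}" by (simp add: eventually_at_filter)
      ultimately show ?thesis
      proof eventually_elim
        case (elim u)
        have "?c s - ?c u = (\<Sum>i | Suc i < length (\<pi> n) \<and> \<pi> n ! i = s. if i = 0 then 0 else vjump x n i)"
          by (rule sum_upto_idx_step) (use s0 elim in auto)
        also have "\<dots> = ?j" by (rule sum_vjump_at[OF s0])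
        finally have "?c s - ?c u = ?j" .
        then show ?case using elim stop_y[of u] s unfolding hor_def by simp
      qed
    qed
    ultimately have "(hor x n \<longlongrightarrow> hor x n s) (at s within {0..<s})"
      using Lim_transform_eventually by force
    then have "(hor x n \<longlongrightarrow> hor x n s) (at s within {0..<s} \<union> {s..T})"
      using right by (rule Lim_Un)
    moreover have "{0..<s} \<union> {s..T} = {0..T}" using s by auto
    ultimately show ?thesis by simp
  qed
qed

text \<open>The limit is the same for both approaches: the horizontal term converges along every
  sequence of times tending to \<open>t\<close>.\<close>

lemma hor_conv:
  assumes x: "x \<in> \<Omega>" and T: "0 < T"
  shows "sided_conv T (hor x)"
proof -
  have bd: "locally_bounded \<pi> \<Omega> (horiz_deriv F)" and rc: "right_cont \<pi> \<Omega> (horiz_deriv F)"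
    using F by (auto simp: C12_def)
  obtain n1 C where C: "\<And>n t. n1 \<le> n \<Longrightarrow> 0 \<le> t \<Longrightarrow> t \<le> T \<Longrightarrow>
      norm (horiz_deriv F (t, stop t (ap n x))) \<le> C"
    using bd x T unfolding locally_bounded_def by (metis atLeastAtMost_iff less_imp_le)
  have "\<forall>\<^sub>F n in sequentially. n1 \<le> n \<and> T < last (\<pi> n) \<and> stop T (ap n x) \<in> \<Omega> \<and>
      (\<forall>t. 0 \<le> t \<and> t \<le> T \<longrightarrow> (t, stop t (ap n x)) \<in> stopped_paths \<Omega>)"
    using eventually_ge_at_top[of n1] eventually_last[of T] eventually_ap_in[OF x, of T]
    by eventually_elim (use T in auto)
  then obtain n0 where n0: "\<And>n. n0 \<le> n \<Longrightarrow> n1 \<le> n \<and> T < last (\<pi> n) \<and> stop T (ap n x) \<in> \<Omega> \<and>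
      (\<forall>t. 0 \<le> t \<and> t \<le> T \<longrightarrow> (t, stop t (ap n x)) \<in> stopped_paths \<Omega>)"
    unfolding eventually_sequentially by blast
  have incr: "(\<lambda>n. hor x n (s n) - hor x n 0) \<longlonglongrightarrow> integral {0..t} (\<lambda>s. horiz_deriv F (s, stop s x))"
    if t: "0 \<le> t" "t < T" and s: "\<And>n. 0 \<le> s n" "s \<longlonglongrightarrow> t" for t s
  proof (rule right_deriv_increments_converge[OF t _ _ _ _ s])
    fix n assume n: "n0 \<le> n"
    show "continuous_on {0..T} (hor x n)" using n0[OF n] by (intro hor_continuous) auto
    fix s :: real assume s: "0 \<le> s" "s < T"
    show "((\<lambda>h. (hor x n (s + h) - hor x n s) / h) \<longlongrightarrow> horiz_deriv F (s, stop s (ap n x))) (at_right 0)"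
      using n0[OF n] s by (intro hor_right_deriv) auto
    show "\<bar>horiz_deriv F (s, stop s (ap n x))\<bar> \<le> C" using C[of n s] n0[OF n] s by auto
  next
    fix s :: real assume s: "0 \<le> s" "s < T"
    show "(\<lambda>n. horiz_deriv F (s, stop s (ap n x))) \<longlonglongrightarrow> horiz_deriv F (s, stop s x)"
      by (rule right_cont_seq[OF rc x s(1) tendsto_const]) (simp add: pp_le s)
  qed
  have hor0: "(\<lambda>n. hor x n 0) \<longlonglongrightarrow> F (0, stop 0 x)"
  proof (rule Lim_transform_eventually)
    show "(\<lambda>n. F (0, stop 0 (ap n x))) \<longlonglongrightarrow> F (0, stop 0 x)"
      by (rule right_cont_seq[OF F_right_cont x order_refl tendsto_const]) (simp add: pp_nonpos)
    show "\<forall>\<^sub>F n in sequentially. F (0, stop 0 (ap n x)) = hor x n 0"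
      using upto_idx_0
    proof eventually_elim
      case (elim n)
      then show ?case unfolding hor_def by simp
    qed
  qed
  have lim: "(\<lambda>n. hor x n (s n)) \<longlonglongrightarrow> integral {0..t} (\<lambda>s. horiz_deriv F (s, stop s x)) + F (0, stop 0 x)"
    if t: "0 \<le> t" "t < T" and s: "\<And>n. 0 \<le> s n" "s \<longlonglongrightarrow> t" for t s
    using tendsto_add[OF incr[OF that] hor0] by simp
  show ?thesis
    by (rule sided_convI; rule lim) (auto simp: right_approach_def left_approach_def)
qed

lemma F_conv:
  assumes x: "x \<in> \<Omega>"
  shows "sided_conv T (\<lambda>n s. F (s, stop s (ap n x)))"
proof (rule sided_convI)
  fix t s assume "0 \<le> t" "right_approach t s"
  then show "(\<lambda>n. F (s n, stop (s n) (ap n x))) \<longlonglongrightarrow> F (t, stop t x)"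
    by (intro right_cont_seq[OF F_right_cont x]) (auto simp: right_approach_def)
next
  fix t s assume "0 < t" "left_approach t s"
  then show "(\<lambda>n. F (s n, stop (s n) (ap n x))) \<longlonglongrightarrow> F (t, stop_left t x)"
    by (intro left_cont_seq(2)[OF F_left_cont x]) (auto simp: left_approach_def)
qed

section \<open>Convergence of the Riemann sums\<close>

abbreviation isum :: "(real \<Rightarrow> real^'m) \<Rightarrow> nat \<Rightarrow> real \<Rightarrow> real" where
  "isum x n s \<equiv> integral_sum \<pi> grad n s x"

lemma isum_eq: "isum x n s = (\<Sum>i\<in>upto_idx n s. grad_at x n i \<bullet> dx x n i)"
  by (simp add: integral_sum_def)

text \<open>By right continuity at 0 the first increment tends to 0, while the gradient and Hessian
  at index 0 converge. This is what allows index 0 to be treated apart from the expansion.\<close>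

lemma initial_term:
  assumes x: "x \<in> \<Omega>"
  shows "(\<lambda>n. grad_at x n 0 \<bullet> dx x n 0) \<longlonglongrightarrow> 0"
    "(\<lambda>n. (hess_at x n 0 *v dx x n 0) \<bullet> dx x n 0) \<longlonglongrightarrow> 0"
proof -
  have p0: "(\<lambda>n. \<pi> n ! 0) \<longlonglongrightarrow> 0" by (simp add: nth_0)
  have ev: "\<forall>\<^sub>F n in sequentially. Suc 0 < length (\<pi> n) \<and> \<pi> n ! 0 \<le> pp n 0"
    using upto_idx_0 by eventually_elim (simp add: nth_0 pp_nonpos)
  note d0 = dx_0_tendsto_0[OF in_cadlag[OF x]]
  show "(\<lambda>n. grad_at x n 0 \<bullet> dx x n 0) \<longlonglongrightarrow> 0"
    using tendsto_inner[OF grad_at_tendsto[OF x order_refl p0 ev] d0] by simp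
  show "(\<lambda>n. (hess_at x n 0 *v dx x n 0) \<bullet> dx x n 0) \<longlonglongrightarrow> 0"
    using quadratic_form_tendsto[OF hess_at_tendsto[OF x order_refl p0 ev] d0] by simp
qed

text \<open>Solving the second-order expansion for the gradient terms expresses the Riemann sum
  through four families with sided limits, since \<open>F\<close> minus \<open>hor\<close> is the
  sum of the vertical jumps.\<close>

lemma isum_sided_limits:
  assumes x: "x \<in> \<Omega>"
  obtains A B where "sided_limits (isum x) A B"
proof (rule sided_conv_imp_limits)
  fix T :: real
  show "sided_conv T (isum x)"
  proof (cases "0 < T")
    case False
    then show ?thesis by (auto simp: sided_conv_def sided_limits_before_def)
  next
    case T: True
    \<comment> \<open>Corrects index 0, which is not expanded: its gradient term is added, and its
      Hessian term, included in the Hessian sum, is cancelled.\<close>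
    let ?z = "\<lambda>n. grad_at x n 0 \<bullet> dx x n 0 + 1 / 2 * ((hess_at x n 0 *v dx x n 0) \<bullet> dx x n 0)"
    have z: "?z \<longlonglongrightarrow> 0 + 1 / 2 * 0" by (intro tendsto_intros initial_term x)
    have "sided_conv T (\<lambda>n s. (F (s, stop s (ap n x)) - hor x n s) -
        1 / 2 * (\<Sum>i\<in>upto_idx n s. (hess_at x n i *v dx x n i) \<bullet> dx x n i) -
        (\<Sum>i\<in>upto_idx n s. if i = 0 then 0 else rem x n i) + ?z n)"
      by (intro sided_conv_add sided_conv_diff sided_conv_cmult F_conv hor_conv hess_conv rem_conv x T
            sided_conv_const[OF z])
    then show ?thesis
    proof (rule sided_conv_cong)
      show "\<forall>\<^sub>F n in sequentially. \<forall>s. 0 \<le> s \<and> s < T \<longrightarrow>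
        (F (s, stop s (ap n x)) - hor x n s) -
        1 / 2 * (\<Sum>i\<in>upto_idx n s. (hess_at x n i *v dx x n i) \<bullet> dx x n i) -
        (\<Sum>i\<in>upto_idx n s. if i = 0 then 0 else rem x n i) + ?z n = isum x n s"
        using upto_idx_0
      proof eventually_elim
        case (elim n)
        show ?case
        proof (intro allI impI)
          fix s assume s: "0 \<le> s \<and> s < T"
          then have mem: "0 \<in> upto_idx n s" using elim nth_0[of n] by simp
          have "(\<Sum>i\<in>upto_idx n s. if i = 0 then ?z n else 0) = ?z n"
            using mem finite_upto_idx[of n s] by (simp add: sum.delta)
          moreover have "(\<Sum>i\<in>upto_idx n s. grad_at x n i \<bullet> dx x n i) =
            (\<Sum>i\<in>upto_idx n s. (if i = 0 then 0 else vjump x n i)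
               - 1 / 2 * ((hess_at x n i *v dx x n i) \<bullet> dx x n i)
               - (if i = 0 then 0 else rem x n i) + (if i = 0 then ?z n else 0))"
            by (intro sum.cong refl) (auto simp: vjump_def rem_def)
          ultimately show "(F (s, stop s (ap n x)) - hor x n s) -
            1 / 2 * (\<Sum>i\<in>upto_idx n s. (hess_at x n i *v dx x n i) \<bullet> dx x n i) -
            (\<Sum>i\<in>upto_idx n s. if i = 0 then 0 else rem x n i) + ?z n = isum x n s"
            unfolding isum_eq hor_def
            by (simp only: sum.distrib sum_subtractf sum_distrib_left)
        qed
      qed
    qed
  qed
qed

section \<open>The integral at stopped paths\<close>

text \<open>An approximation looks ahead only to the next partition point. Before
  \<open>pp n t\<close> that point is still below \<open>t\<close>, so paths agreeing before
  \<open>t\<close> have the same approximation there.\<close>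

lemma stop_left_ap_cong:
  assumes eq: "\<And>s. s < t \<Longrightarrow> y s = x s" and t: "0 < pp n t"
    and i: "i < length (\<pi> n)" "\<pi> n ! i \<le> pp n t"
  shows "stop_left (\<pi> n ! i) (ap n y) = stop_left (\<pi> n ! i) (ap n x)"
proof -
  have t0: "0 < t" using t pp_nonpos[of t n] by (cases "0 < t") auto
  have ap: "ap n y s = ap n x s" if s: "s < pp n t" for s
  proof (cases "0 \<le> s")
    case True
    obtain m where "m < length (\<pi> n)" "\<pi> n ! m = pp n t"
      using pp_max(1)[OF t0, of n] by (auto simp: in_set_conv_nth)
    then have "pp n t \<le> last (\<pi> n)" using nth_le_last[of m n] by simp
    then have "s < last (\<pi> n)" using s by simp
    then obtain j where j: "Suc j < length (\<pi> n)" "\<pi> n ! j \<le> s" "s < \<pi> n ! Suc j"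
      by (rule partition_interval[OF True])
    have "\<pi> n ! Suc j < t" using Suc_le_pp[OF t0 j(1)] j s pp_max(2)[OF t0, of n] by simp
    then show ?thesis using ap_eq[OF j, of y] ap_eq[OF j, of x] eq by simp
  qed (simp add: ap_neg)
  have "left_lim (ap n y) (\<pi> n ! i) = left_lim (ap n x) (\<pi> n ! i)"
  proof (cases "0 < \<pi> n ! i")
    case True
    then show ?thesis by (rule left_lim_cong) (use ap i in auto)
  next
    case False
    then show ?thesis using ap[OF t] by (simp add: left_lim_def)
  qed
  then show ?thesis using ap i by (auto simp: stop_left_def fun_eq_iff)
qed

text \<open>Freezing the path at \<open>t\<close> alters the increment that starts at
  \<open>pp n t\<close> and no earlier one; its right end becomes \<open>y t\<close>. Stated for
  general \<open>y\<close> because it is used both for \<open>stop t x\<close> and for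
  \<open>stop_left t x\<close>.\<close>

lemma isum_stopped:
  assumes x: "x \<in> \<Omega>" and lim: "sided_limits (isum x) A B" and t: "0 < t"
    and eq: "\<And>s. s < t \<Longrightarrow> y s = x s" and const: "\<And>s. t \<le> s \<Longrightarrow> y s = y t"
  shows "(\<lambda>n. isum y n t) \<longlonglongrightarrow> A t + grad (t, stop_left t x) \<bullet> (y t - x t)"
proof -
  obtain k where k: "\<forall>\<^sub>F n in sequentially. Suc (k n) < length (\<pi> n) \<and> \<pi> n ! k n = pp n t"
    by (rule pp_index_seq[OF tendsto_const]) (use t in auto)
  note jl = dx_tendsto_jump[OF in_cadlag[OF x] t k]
  have "(\<lambda>n. isum x n (pp n t) + grad_at x n (k n) \<bullet> (y t - x (\<pi> n ! Suc (k n))))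
      \<longlonglongrightarrow> A t + grad (t, stop_left t x) \<bullet> (y t - x t)"
    by (intro tendsto_add tendsto_inner tendsto_diff tendsto_const jl(1)
          sided_limitsD(1)[OF lim _ right_approach_pp] grad_at_tendsto[OF x _ jl(4)])
       (use t k in \<open>auto elim: eventually_mono\<close>)
  moreover have "\<forall>\<^sub>F n in sequentially. isum x n (pp n t) + grad_at x n (k n) \<bullet> (y t - x (\<pi> n ! Suc (k n))) = isum y n t"
    using k eventually_pp_gt[OF order_refl t]
  proof eventually_elim
    case (elim n)
    \<comment> \<open>The sums up to \<open>t\<close> and up to \<open>pp n t\<close> can differ
      only if \<open>t\<close> is itself a partition point, and then the extra increment is 0
      because \<open>y\<close> is constant from \<open>t\<close> on.\<close>
    have "isum y n t - isum y n (pp n t) = (\<Sum>i | Suc i < length (\<pi> n) \<and> \<pi> n ! i = t. grad_at y n i \<bullet> dx y n i)"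
      unfolding isum_eq by (rule sum_upto_idx_step) (use t pp_max(2)[OF t] in auto)
    also have "\<dots> = 0"
    proof (rule sum.neutral, rule ballI)
      fix i assume i: "i \<in> {i. Suc i < length (\<pi> n) \<and> \<pi> n ! i = t}"
      then have "t \<le> \<pi> n ! Suc i" using nth_less_iff[of i n "Suc i"] by auto
      then have "y (\<pi> n ! Suc i) = y t" by (rule const)
      then show "grad_at y n i \<bullet> dx y n i = 0" using i by simp
    qed
    finally have 1: "isum y n t = isum y n (pp n t)" by simp
    have "\<pi> n ! k n < \<pi> n ! Suc (k n)" using elim nth_less_iff[of "k n" n "Suc (k n)"] by simp
    then have "t \<le> \<pi> n ! Suc (k n)"
      using elim pp_max(3)[OF t, of "\<pi> n ! Suc (k n)" n] by fastforce
    then have yS: "y (\<pi> n ! Suc (k n)) = y t" by (rule const)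
    have mem: "k n \<in> upto_idx n (pp n t)" using elim by simp
    have grad_eq: "grad_at y n i = grad_at x n i" if "i \<in> upto_idx n (pp n t)" for i
      using stop_left_ap_cong[where y = y and x = x, OF eq elim(2), of i] that by simp
    have y_le: "y u = x u" if "u \<le> pp n t" for u
      using that pp_max(2)[OF t, of n] by (intro eq) simp
    have "isum y n (pp n t) - isum x n (pp n t) =
        (\<Sum>i\<in>upto_idx n (pp n t). if i = k n then grad_at x n (k n) \<bullet> (y t - x (\<pi> n ! Suc (k n))) else 0)"
      unfolding isum_eq sum_subtractf[symmetric]
    proof (rule sum.cong[OF refl])
      fix i assume i: "i \<in> upto_idx n (pp n t)"
      show "grad_at y n i \<bullet> dx y n i - grad_at x n i \<bullet> dx x n i =
        (if i = k n then grad_at x n (k n) \<bullet> (y t - x (\<pi> n ! Suc (k n))) else 0)"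
      proof (cases "i = k n")
        case True
        then show ?thesis
          using i grad_eq[OF i] yS y_le[of "\<pi> n ! i"] by (simp add: inner_diff_right)
      next
        case False
        then have "\<pi> n ! i < pp n t" using i elim nth_eq_iff[of i n "k n"] by auto
        then have "\<pi> n ! Suc i \<le> pp n t" using i by (intro Suc_le_pp t) auto
        then show ?thesis
          using False i grad_eq[OF i] y_le[of "\<pi> n ! i"] y_le[of "\<pi> n ! Suc i"] by simp
      qed
    qed
    also have "\<dots> = grad_at x n (k n) \<bullet> (y t - x (\<pi> n ! Suc (k n)))"
      using mem finite_upto_idx[of n "pp n t"] by simp
    finally show ?case using 1 by simp
  qed
  ultimately show ?thesis by (rule Lim_transform_eventually)
qed

text \<open>The times \<open>pp n t\<close> and \<open>pp n (pp n t)\<close> are a right and a left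
  approach whose sums differ by the single term at \<open>pp n t\<close>.\<close>

lemma sided_limits_jump:
  assumes x: "x \<in> \<Omega>" and lim: "sided_limits (isum x) A B" and t: "0 < t"
  shows "B t = A t - grad (t, stop_left t x) \<bullet> jump x t"
proof -
  obtain k where k: "\<forall>\<^sub>F n in sequentially. Suc (k n) < length (\<pi> n) \<and> \<pi> n ! k n = pp n t"
    by (rule pp_index_seq[OF tendsto_const]) (use t in auto)
  note jl = dx_tendsto_jump[OF in_cadlag[OF x] t k]
  have "(\<lambda>n. isum x n (pp n t) - grad_at x n (k n) \<bullet> dx x n (k n))
      \<longlonglongrightarrow> A t - grad (t, stop_left t x) \<bullet> jump x t"
    by (intro tendsto_diff tendsto_inner jl(3)
          sided_limitsD(1)[OF lim _ right_approach_pp] grad_at_tendsto[OF x _ jl(4)])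
       (use t k in \<open>auto elim: eventually_mono\<close>)
  moreover have "\<forall>\<^sub>F n in sequentially. isum x n (pp n t) - grad_at x n (k n) \<bullet> dx x n (k n) = isum x n (pp n (pp n t))"
    using k eventually_pp_gt[OF order_refl t]
  proof eventually_elim
    case (elim n)
    let ?I = "{i. Suc i < length (\<pi> n) \<and> \<pi> n ! i = pp n t}"
    have "j = k n" if "j \<in> ?I" for j using that elim nth_eq_iff[of j n "k n"] by simp
    then have I: "?I = {k n}" using elim by blast
    have "isum x n (pp n t) - isum x n (pp n (pp n t)) = (\<Sum>i\<in>?I. grad_at x n i \<bullet> dx x n i)"
      unfolding isum_eq by (rule sum_upto_idx_step) (use elim pp_max(2)[of "pp n t" n] in auto)
    then show ?case unfolding I by simp
  qed
  ultimately have "(\<lambda>n. isum x n (pp n (pp n t))) \<longlonglongrightarrow> A t - grad (t, stop_left t x) \<bullet> jump x t"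
    by (rule Lim_transform_eventually)
  with sided_limits_const(2)[OF lim t] show ?thesis by (rule LIMSEQ_unique)
qed

abbreviation J :: "real \<times> (real \<Rightarrow> real^'m) \<Rightarrow> real" where "J \<equiv> pathwise_integral \<pi> grad"

lemma J_eq: "(\<lambda>n. isum y n t) \<longlonglongrightarrow> L \<Longrightarrow> J (t, y) = L"
  by (simp add: pathwise_integral_def limI)

lemma isum_0:
  assumes x: "x \<in> \<Omega>" shows "(\<lambda>n. isum x n 0) \<longlonglongrightarrow> 0"
proof (rule Lim_transform_eventually[OF initial_term(1)[OF x]])
  show "\<forall>\<^sub>F n in sequentially. grad_at x n 0 \<bullet> dx x n 0 = isum x n 0"
    using upto_idx_0
  proof eventually_elim
    case (elim n)
    then show ?case unfolding isum_eq by simp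
  qed
qed

text \<open>Stopping at \<open>t\<close> leaves the limit \<open>A t\<close> unchanged. Stopping
  from the left subtracts the gradient applied to the jump, which is exactly the difference between
  \<open>A t\<close> and \<open>B t\<close>.\<close>

lemma J_at:
  assumes x: "x \<in> \<Omega>" and lim: "sided_limits (isum x) A B"
  shows "0 \<le> t \<Longrightarrow> J (t, stop t x) = A t" "0 < t \<Longrightarrow> J (t, stop_left t x) = B t"
    "J (0, stop_left 0 x) = 0" "A 0 = 0"
proof -
  show A0: "A 0 = 0"
    using sided_limits_const(1)[OF lim order_refl] isum_0[OF x] by (rule LIMSEQ_unique)
  have J0: "J (0, stop 0 x) = 0" by (rule J_eq[OF isum_0[OF stop_in[OF x order_refl]]])
  moreover have "stop_left 0 x = stop 0 x" by (rule stop_left_continuous) (simp add: left_lim_def)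
  ultimately show "J (0, stop_left 0 x) = 0" by simp
  show "J (t, stop t x) = A t" if "0 \<le> t"
  proof (cases "t = 0")
    case True
    then show ?thesis using J0 A0 by simp
  next
    case False
    then have t: "0 < t" using that by simp
    have "(\<lambda>n. isum (stop t x) n t) \<longlonglongrightarrow> A t + grad (t, stop_left t x) \<bullet> (stop t x t - x t)"
      by (rule isum_stopped[OF x lim t]) (auto simp: stop_def)
    then show ?thesis by (intro J_eq) (simp add: stop_def)
  qed
  show "J (t, stop_left t x) = B t" if t: "0 < t"
  proof -
    have "(\<lambda>n. isum (stop_left t x) n t) \<longlonglongrightarrow> A t + grad (t, stop_left t x) \<bullet> (stop_left t x t - x t)"
      by (rule isum_stopped[OF x lim t]) (auto simp: stop_left_def)
    moreover have "A t + grad (t, stop_left t x) \<bullet> (stop_left t x t - x t) = B t"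
      using sided_limits_jump[OF x lim t] by (simp add: stop_left_def jump_def inner_diff_right)
    ultimately show ?thesis by (intro J_eq) simp
  qed
qed

text \<open>In the limit each jump is charged to the last partition point before it, where left
  continuity gives the convergence of the integrand.\<close>

lemma isum_step_path:
  assumes y: "y \<in> \<Omega>" and I: "finite I" and t: "0 \<le> t"
    and u: "\<And>k. k \<in> I \<Longrightarrow> 0 < u k" "\<And>k. k \<in> I \<Longrightarrow> u k \<le> t"
    and step: "\<And>s. 0 \<le> s \<Longrightarrow> y s = c + (\<Sum>k\<in>I. if u k \<le> s then d k else 0)"
  shows "(\<lambda>n. isum y n t) \<longlonglongrightarrow> (\<Sum>k\<in>I. grad (u k, stop_left (u k) y) \<bullet> d k)"
proof -
  have "(\<lambda>n. grad (pp n (u k), stop_left (pp n (u k)) (ap n y))) \<longlonglongrightarrow> grad (u k, stop_left (u k) y)"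
    if "k \<in> I" for k
    using u(1)[OF that] by (intro grad_seq[OF y]) (auto simp: pp_nonneg intro!: pp_tendsto)
  then have "(\<lambda>n. \<Sum>k\<in>I. grad (pp n (u k), stop_left (pp n (u k)) (ap n y)) \<bullet> d k)
      \<longlonglongrightarrow> (\<Sum>k\<in>I. grad (u k, stop_left (u k) y) \<bullet> d k)"
    by (intro tendsto_sum tendsto_inner tendsto_const)
  moreover have "\<forall>\<^sub>F n in sequentially. (\<Sum>k\<in>I. grad (pp n (u k), stop_left (pp n (u k)) (ap n y)) \<bullet> d k) = isum y n t"
    using eventually_last[of t]
  proof eventually_elim
    case (elim n)
    have dx_eq: "dx y n j = (\<Sum>k\<in>I. if \<pi> n ! j < u k \<and> u k \<le> \<pi> n ! Suc j then d k else 0)"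
      if "Suc j < length (\<pi> n)" for j
    proof -
      have "0 \<le> \<pi> n ! j" "0 \<le> \<pi> n ! Suc j" "\<pi> n ! j \<le> \<pi> n ! Suc j"
        using that nth_nonneg[of j n] nth_nonneg[of "Suc j" n] nth_le_iff[of j n "Suc j"] by auto
      then show ?thesis
        unfolding step[OF \<open>0 \<le> \<pi> n ! j\<close>] step[OF \<open>0 \<le> \<pi> n ! Suc j\<close>]
        by (simp add: sum_subtractf[symmetric]) (intro sum.cong; auto)
    qed
    have "isum y n t = (\<Sum>j\<in>upto_idx n t. \<Sum>k\<in>I. if \<pi> n ! j < u k \<and> u k \<le> \<pi> n ! Suc j then grad_at y n j \<bullet> d k else 0)"
      unfolding isum_eq
    proof (rule sum.cong[OF refl])
      fix j assume "j \<in> upto_idx n t"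
      then have "Suc j < length (\<pi> n)" by simp
      then show "grad_at y n j \<bullet> dx y n j = (\<Sum>k\<in>I. if \<pi> n ! j < u k \<and> u k \<le> \<pi> n ! Suc j then grad_at y n j \<bullet> d k else 0)"
        by (subst dx_eq) (auto simp: inner_sum_right intro!: sum.cong)
    qed
    also have "\<dots> = (\<Sum>k\<in>I. \<Sum>j\<in>upto_idx n t. if \<pi> n ! j < u k \<and> u k \<le> \<pi> n ! Suc j then grad_at y n j \<bullet> d k else 0)"
      by (rule sum.swap)
    also have "\<dots> = (\<Sum>k\<in>I. grad (pp n (u k), stop_left (pp n (u k)) (ap n y)) \<bullet> d k)"
    proof (rule sum.cong[OF refl])
      fix k assume k: "k \<in> I"
      obtain i where i: "Suc i < length (\<pi> n)" "\<pi> n ! i = pp n (u k)" "\<pi> n ! i < u k" "u k \<le> \<pi> n ! Suc i"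
        using pp_index[of "u k" n] u[OF k] elim by auto
      have iff: "\<pi> n ! j < u k \<and> u k \<le> \<pi> n ! Suc j \<longleftrightarrow> j = i" if "Suc j < length (\<pi> n)" for j
      proof
        assume "\<pi> n ! j < u k \<and> u k \<le> \<pi> n ! Suc j"
        then have "\<pi> n ! j < \<pi> n ! Suc i" "\<pi> n ! i < \<pi> n ! Suc j" using i by auto
        then have "j < Suc i" "i < Suc j"
          using that i nth_less_iff[of j n "Suc i"] nth_less_iff[of i n "Suc j"] by simp_all
        then show "j = i" by simp
      qed (use i in simp)
      have "(\<Sum>j\<in>upto_idx n t. if \<pi> n ! j < u k \<and> u k \<le> \<pi> n ! Suc j then grad_at y n j \<bullet> d k else 0) =
          (\<Sum>j\<in>upto_idx n t. if j = i then grad_at y n i \<bullet> d k else 0)"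
        by (rule sum.cong[OF refl]) (use iff in auto)
      also have "\<dots> = grad_at y n i \<bullet> d k"
        using i u[OF k] finite_upto_idx[of n t] by simp
      finally show "(\<Sum>j\<in>upto_idx n t. if \<pi> n ! j < u k \<and> u k \<le> \<pi> n ! Suc j then grad_at y n j \<bullet> d k else 0) =
          grad (pp n (u k), stop_left (pp n (u k)) (ap n y)) \<bullet> d k" by (simp only: i(2))
    qed
    finally show ?case by simp
  qed
  ultimately show ?thesis by (rule Lim_transform_eventually)
qed

text \<open>A telescoping sum. It starts at index 1, because the approximation already has the value
  at the second partition point on its first interval.\<close>

lemma stop_ap_step:
  assumes t: "0 \<le> t" "t < last (\<pi> n)" and s: "0 \<le> s"
  shows "stop t (ap n x) s = x (\<pi> n ! Suc 0) +
    (\<Sum>k\<in>{k \<in> upto_idx n t. 0 < k}. if \<pi> n ! k \<le> s then dx x n k else 0)"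
proof -
  define r where "r = min s t"
  have "0 \<le> r" "r < last (\<pi> n)" using t s by (auto simp: r_def)
  then obtain i where i: "Suc i < length (\<pi> n)" "\<pi> n ! i \<le> r" "r < \<pi> n ! Suc i"
    by (rule partition_interval)
  have iff: "\<pi> n ! k \<le> r \<longleftrightarrow> k \<le> i" if "Suc k < length (\<pi> n)" for k
  proof
    assume "\<pi> n ! k \<le> r"
    then have "\<pi> n ! k < \<pi> n ! Suc i" using i by simp
    then show "k \<le> i" using that i nth_less_iff[of k n "Suc i"] by simp
  next
    assume "k \<le> i"
    then have "\<pi> n ! k \<le> \<pi> n ! i" using that i nth_le_iff[of k n i] by simp
    then show "\<pi> n ! k \<le> r" using i by simp
  qed
  have set: "{k \<in> {k \<in> upto_idx n t. 0 < k}. \<pi> n ! k \<le> s} = {1..i}"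
  proof (rule set_eqI)
    fix k
    have "Suc k < length (\<pi> n)" if "k \<le> i" using that i by simp
    then show "k \<in> {k \<in> {k \<in> upto_idx n t. 0 < k}. \<pi> n ! k \<le> s} \<longleftrightarrow> k \<in> {1..i}"
      using iff[of k] by (auto simp: r_def)
  qed
  have "(\<Sum>k\<in>{k \<in> upto_idx n t. 0 < k}. if \<pi> n ! k \<le> s then dx x n k else 0) =
      (\<Sum>k\<in>{k \<in> {k \<in> upto_idx n t. 0 < k}. \<pi> n ! k \<le> s}. dx x n k)"
    by (rule sum.inter_filter[symmetric]) (rule finite_subset[OF _ finite_upto_idx[of n t]], auto)
  also have "\<dots> = x (\<pi> n ! Suc i) - x (\<pi> n ! 1)"
    unfolding set by (rule sum_Suc_diff) simp
  finally show ?thesis using ap_eq[OF i, of x] by (simp add: stop_def r_def)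
qed

text \<open>The stopped approximation is a step path jumping by \<open>dx x n k\<close> at the
  \<open>k\<close>-th partition point, and stopping at \<open>t'\<close> does not affect its
  left-stopped versions up to \<open>t'\<close>. Its integral is therefore the Riemann sum itself,
  lacking the first term. The evaluation time may exceed \<open>t'\<close>, as happens for
  left-stopped paths.\<close>

lemma J_stop_ap:
  assumes t: "0 \<le> t'" "t' \<le> t" "t' < last (\<pi> n)" and y: "stop t' (ap n x) \<in> \<Omega>"
    and len: "Suc 0 < length (\<pi> n)"
  shows "J (t, stop t' (ap n x)) = isum x n t' - grad_at x n 0 \<bullet> dx x n 0"
proof -
  let ?I = "{k \<in> upto_idx n t'. 0 < k}"
  have lim: "(\<lambda>N. isum (stop t' (ap n x)) N t) \<longlonglongrightarrow>
      (\<Sum>k\<in>?I. grad (\<pi> n ! k, stop_left (\<pi> n ! k) (stop t' (ap n x))) \<bullet> dx x n k)"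
  proof (rule isum_step_path[OF y])
    show "finite ?I" by (rule finite_subset[OF _ finite_upto_idx[of n t']]) auto
  qed (use t in \<open>auto simp: stop_ap_step intro: nth_pos\<close>)
  have "(\<Sum>k\<in>?I. grad (\<pi> n ! k, stop_left (\<pi> n ! k) (stop t' (ap n x))) \<bullet> dx x n k) =
      (\<Sum>k\<in>?I. grad_at x n k \<bullet> dx x n k)"
  proof (rule sum.cong[OF refl])
    fix k assume k: "k \<in> ?I"
    then have "stop_left (\<pi> n ! k) (stop t' (ap n x)) = stop_left (\<pi> n ! k) (ap n x)"
      by (intro stop_left_stop) (auto intro: nth_nonneg)
    then show "grad (\<pi> n ! k, stop_left (\<pi> n ! k) (stop t' (ap n x))) \<bullet> dx x n k = grad_at x n k \<bullet> dx x n k"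
      by simp
  qed
  also have "\<dots> = isum x n t' - grad_at x n 0 \<bullet> dx x n 0"
  proof -
    have mem: "0 \<in> upto_idx n t'" using t len nth_0[of n] by simp
    have "?I = upto_idx n t' - {0}" by auto
    then show ?thesis
      unfolding isum_eq sum.remove[OF finite_upto_idx mem] by simp
  qed
  finally show ?thesis using J_eq[OF lim] by simp
qed

text \<open>The approximation is constant between \<open>pp n t\<close> and \<open>t\<close>, so
  stopping from the left at \<open>t\<close> is the same as stopping at \<open>pp n t\<close>.
  Left-stopped values of the integral thus become Riemann sums at an earlier time.\<close>

lemma stop_left_ap:
  assumes "0 < t" "t \<le> last (\<pi> n)"
  shows "stop_left t (ap n x) = stop (pp n t) (ap n x)"
proof -
  obtain i where i: "Suc i < length (\<pi> n)" "\<pi> n ! i = pp n t" "\<pi> n ! i < t" "t \<le> \<pi> n ! Suc i"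
    using pp_index[OF assms] by metis
  have "ap n x s = x (\<pi> n ! Suc i)" if "pp n t \<le> s" "s < t" for s
    using that i by (intro ap_eq) auto
  moreover have "left_lim (ap n x) t = x (\<pi> n ! Suc i)" using i by (intro left_lim_ap) auto
  ultimately show ?thesis
    using i by (auto simp: stop_left_def stop_def fun_eq_iff min_def)
qed

lemma eventually_J_ap:
  assumes x: "x \<in> \<Omega>"
  shows "\<forall>\<^sub>F n in sequentially. \<forall>s. 0 \<le> s \<and> s \<le> T \<longrightarrow>
    J (s, stop s (ap n x)) = isum x n s - grad_at x n 0 \<bullet> dx x n 0 \<and>
    J (s, stop_left s (ap n x)) = isum x n (pp n s) - grad_at x n 0 \<bullet> dx x n 0"
  using eventually_last[of T] eventually_ap_in[OF x, of T] upto_idx_0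
proof eventually_elim
  case (elim n)
  show ?case
  proof (intro allI impI conjI)
    fix s assume s: "0 \<le> s \<and> s \<le> T"
    show stop: "J (s, stop s (ap n x)) = isum x n s - grad_at x n 0 \<bullet> dx x n 0"
      by (rule J_stop_ap) (use s elim in auto)
    show "J (s, stop_left s (ap n x)) = isum x n (pp n s) - grad_at x n 0 \<bullet> dx x n 0"
    proof (cases "s = 0")
      case True
      have "stop_left 0 (ap n x) = stop 0 (ap n x)"
        by (rule stop_left_continuous) (simp add: left_lim_def)
      then show ?thesis using stop True by (simp add: pp_nonpos)
    next
      case False
      have pp: "0 \<le> pp n s" "pp n s \<le> s" using s pp_nonneg[of n s] pp_le[of s n] by auto
      show ?thesis
        unfolding stop_left_ap[of s n x, OF order_neq_le_trans[OF False[symmetric] conjunct1[OF s]] order_trans[OF conjunct2[OF s] less_imp_le[OF elim(1)]]]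
        by (rule J_stop_ap) (use pp s elim in auto)
    qed
  qed
qed

section \<open>Continuity of the integral\<close>

lemma J_ap_tendsto:
  assumes x: "x \<in> \<Omega>" and s: "\<And>n. 0 \<le> s n" "s \<longlonglongrightarrow> t"
  shows "(\<lambda>n. isum x n (s n)) \<longlonglongrightarrow> L \<Longrightarrow> (\<lambda>n. J (s n, stop (s n) (ap n x))) \<longlonglongrightarrow> L"
    and "(\<lambda>n. isum x n (pp n (s n))) \<longlonglongrightarrow> L \<Longrightarrow> (\<lambda>n. J (s n, stop_left (s n) (ap n x))) \<longlonglongrightarrow> L"
proof -
  have ev: "\<forall>\<^sub>F n in sequentially. isum x n (s n) - grad_at x n 0 \<bullet> dx x n 0 = J (s n, stop (s n) (ap n x)) \<and>
      isum x n (pp n (s n)) - grad_at x n 0 \<bullet> dx x n 0 = J (s n, stop_left (s n) (ap n x))"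
    using eventually_J_ap[OF x, of "t + 1"] eventually_le_Suc[OF s(2)]
    by eventually_elim (use s(1) in auto)
  show "(\<lambda>n. J (s n, stop (s n) (ap n x))) \<longlonglongrightarrow> L" if L: "(\<lambda>n. isum x n (s n)) \<longlonglongrightarrow> L"
  proof (rule Lim_transform_eventually)
    show "(\<lambda>n. isum x n (s n) - grad_at x n 0 \<bullet> dx x n 0) \<longlonglongrightarrow> L"
      using tendsto_diff[OF L initial_term(1)[OF x]] by simp
    show "\<forall>\<^sub>F n in sequentially. isum x n (s n) - grad_at x n 0 \<bullet> dx x n 0 = J (s n, stop (s n) (ap n x))"
      using ev by eventually_elim simp
  qed
  show "(\<lambda>n. J (s n, stop_left (s n) (ap n x))) \<longlonglongrightarrow> L" if L: "(\<lambda>n. isum x n (pp n (s n))) \<longlonglongrightarrow> L"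
  proof (rule Lim_transform_eventually)
    show "(\<lambda>n. isum x n (pp n (s n)) - grad_at x n 0 \<bullet> dx x n 0) \<longlonglongrightarrow> L"
      using tendsto_diff[OF L initial_term(1)[OF x]] by simp
    show "\<forall>\<^sub>F n in sequentially. isum x n (pp n (s n)) - grad_at x n 0 \<bullet> dx x n 0 = J (s n, stop_left (s n) (ap n x))"
      using ev by eventually_elim simp
  qed
qed

lemma J_left_cont: "left_cont \<pi> \<Omega> J"
  unfolding left_cont_def
proof (intro ballI allI impI)
  fix x t assume x: "x \<in> \<Omega>" and t: "(0::real) \<le> t"
  obtain A B where lim: "sided_limits (isum x) A B" using isum_sided_limits[OF x] by blast
  note J = J_at[OF x lim]
  show "((\<lambda>s. J (s, stop_left s x)) \<longlongrightarrow> J (t, stop_left t x)) (at t within {0..t}) \<and>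
        ((\<lambda>s. J (s, stop s x)) \<longlongrightarrow> J (t, stop_left t x)) (at t within {0..<t}) \<and>
        (\<forall>s. (\<forall>n. 0 \<le> s n) \<and> s \<longlonglongrightarrow> t \<and> (\<forall>\<^sub>F n in sequentially. s n \<le> pp n t) \<longrightarrow>
           (\<lambda>n. J (s n, stop_left (s n) (ap n x))) \<longlonglongrightarrow> J (t, stop_left t x)) \<and>
        (\<forall>s. (\<forall>n. 0 \<le> s n) \<and> s \<longlonglongrightarrow> t \<and> (\<forall>\<^sub>F n in sequentially. s n < pp n t) \<longrightarrow>
           (\<lambda>n. J (s n, stop (s n) (ap n x))) \<longlonglongrightarrow> J (t, stop_left t x))"
  proof (cases "t = 0")
    case True
    \<comment> \<open>At time 0 both filters are trivial; on sequences, the weak condition forces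
      \<open>s n = 0\<close> eventually and the strict one can never hold.\<close>
    show ?thesis
    proof (intro conjI allI impI)
      show "((\<lambda>s. J (s, stop_left s x)) \<longlongrightarrow> J (t, stop_left t x)) (at t within {0..t})"
        "((\<lambda>s. J (s, stop s x)) \<longlongrightarrow> J (t, stop_left t x)) (at t within {0..<t})"
        using True by (simp_all add: at_within_def)
    next
      fix s assume s: "(\<forall>n. 0 \<le> s n) \<and> s \<longlonglongrightarrow> t \<and> (\<forall>\<^sub>F n in sequentially. s n \<le> pp n t)"
      have "(\<lambda>n. isum x n (pp n (s n))) \<longlonglongrightarrow> 0"
      proof (rule Lim_transform_eventually[OF isum_0[OF x]])
        have "\<forall>\<^sub>F n in sequentially. s n \<le> pp n t" using s by blast
        then show "\<forall>\<^sub>F n in sequentially. isum x n 0 = isum x n (pp n (s n))"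
          by eventually_elim (simp add: True pp_nonpos)
      qed
      then show "(\<lambda>n. J (s n, stop_left (s n) (ap n x))) \<longlonglongrightarrow> J (t, stop_left t x)"
        using J(3) True by (intro J_ap_tendsto(2)[OF x, of s t]) (use s in auto)
    next
      fix s assume s: "(\<forall>n. 0 \<le> s n) \<and> s \<longlonglongrightarrow> t \<and> (\<forall>\<^sub>F n in sequentially. s n < pp n t)"
      then have "\<forall>\<^sub>F n in sequentially. s n < pp n t" by blast
      then have "\<forall>\<^sub>F n :: nat in sequentially. False"
        by eventually_elim (use s True pp_nonpos[of 0] in \<open>auto simp: not_less[symmetric]\<close>)
      then show "(\<lambda>n. J (s n, stop (s n) (ap n x))) \<longlonglongrightarrow> J (t, stop_left t x)" by simp
    qed
  next
    case False
    then have t: "0 < t" using t by simp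
    note left = sided_limits_at_left[OF lim t]
    show ?thesis
      unfolding J(2)[OF t]
    proof (intro conjI allI impI)
      have "\<forall>\<^sub>F s in at_left t. 0 < s" using tendsto_ident_at t by (rule order_tendstoD)
      then have "\<forall>\<^sub>F s in at_left t. B s = J (s, stop_left s x)" by eventually_elim (simp add: J(2))
      with left(2) have "((\<lambda>s. J (s, stop_left s x)) \<longlongrightarrow> B t) (at_left t)"
        by (rule Lim_transform_eventually)
      then show "((\<lambda>s. J (s, stop_left s x)) \<longlongrightarrow> B t) (at t within {0..t})"
        using t by (simp add: at_within_Icc_at_left)
    next
      have "(A \<longlongrightarrow> B t) (at t within {0..<t})"
        by (rule tendsto_within_subset[OF left(1)]) auto
      moreover have "\<forall>\<^sub>F s in at t within {0..<t}. A s = J (s, stop s x)"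
        by (auto simp: eventually_at_filter J(1))
      ultimately show "((\<lambda>s. J (s, stop s x)) \<longlongrightarrow> B t) (at t within {0..<t})"
        by (rule Lim_transform_eventually)
    next
      fix s assume s: "(\<forall>n. 0 \<le> s n) \<and> s \<longlonglongrightarrow> t \<and> (\<forall>\<^sub>F n in sequentially. s n \<le> pp n t)"
      then have s': "\<And>n. 0 \<le> s n" "s \<longlonglongrightarrow> t" "\<forall>\<^sub>F n in sequentially. s n \<le> pp n t" by blast+
      have "\<forall>\<^sub>F n in sequentially. 0 < s n" using s'(2) t by (rule order_tendstoD)
      \<comment> \<open>Stopping from the left moves the sum back to \<open>pp n (s n)\<close>. As
        this is strictly below \<open>s n\<close>, the weak inequality with \<open>pp n t\<close>
        becomes the strict one of a left approach.\<close>
      with s'(3) have "\<forall>\<^sub>F n in sequentially. pp n (s n) < pp n t"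
        by eventually_elim (use pp_max(2) less_le_trans in blast)
      then have "left_approach t (\<lambda>n. pp n (s n))"
        using s' by (simp add: left_approach_def pp_nonneg pp_tendsto)
      then show "(\<lambda>n. J (s n, stop_left (s n) (ap n x))) \<longlonglongrightarrow> B t"
        by (intro J_ap_tendsto(2)[OF x s'(1,2)] sided_limitsD(2)[OF lim t])
    next
      fix s assume s: "(\<forall>n. 0 \<le> s n) \<and> s \<longlonglongrightarrow> t \<and> (\<forall>\<^sub>F n in sequentially. s n < pp n t)"
      then have s': "\<And>n. 0 \<le> s n" "s \<longlonglongrightarrow> t" "left_approach t s" by (auto simp: left_approach_def)
      then show "(\<lambda>n. J (s n, stop (s n) (ap n x))) \<longlonglongrightarrow> B t"
        by (intro J_ap_tendsto(1)[OF x s'(1,2)] sided_limitsD(2)[OF lim t])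
    qed
  qed
qed

lemma J_right_cont: "right_cont \<pi> \<Omega> J"
  unfolding right_cont_def
proof (intro ballI allI impI)
  fix x t assume x: "x \<in> \<Omega>" and t: "(0::real) \<le> t"
  obtain A B where lim: "sided_limits (isum x) A B" using isum_sided_limits[OF x] by blast
  note J = J_at[OF x lim]
  note right = sided_limits_at_right[OF lim t]
  show "((\<lambda>s. J (s, stop s x)) \<longlongrightarrow> J (t, stop t x)) (at t within {t..}) \<and>
        ((\<lambda>s. J (s, stop_left s x)) \<longlongrightarrow> J (t, stop t x)) (at t within {t<..}) \<and>
        (\<forall>s. (\<forall>n. 0 \<le> s n) \<and> s \<longlonglongrightarrow> t \<and> (\<forall>\<^sub>F n in sequentially. s n \<ge> pp n t) \<longrightarrow>
           (\<lambda>n. J (s n, stop (s n) (ap n x))) \<longlonglongrightarrow> J (t, stop t x)) \<and>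
        (\<forall>s. (\<forall>n. 0 \<le> s n) \<and> s \<longlonglongrightarrow> t \<and> (\<forall>\<^sub>F n in sequentially. s n > pp n t) \<longrightarrow>
           (\<lambda>n. J (s n, stop_left (s n) (ap n x))) \<longlonglongrightarrow> J (t, stop t x))"
    unfolding J(1)[OF t]
  proof (intro conjI allI impI)
    have "{t..} - {t} = {t<..} - {t}" by auto
    then have at: "at t within {t..} = at_right t" by (simp add: at_within_def)
    have "\<forall>\<^sub>F s in at_right t. A s = J (s, stop s x)"
      using t by (auto simp: eventually_at_filter J(1))
    with right(1) show "((\<lambda>s. J (s, stop s x)) \<longlongrightarrow> A t) (at t within {t..})"
      unfolding at by (rule Lim_transform_eventually)
    have "\<forall>\<^sub>F s in at_right t. B s = J (s, stop_left s x)"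
      using t by (auto simp: eventually_at_filter J(2))
    with right(2) show "((\<lambda>s. J (s, stop_left s x)) \<longlongrightarrow> A t) (at_right t)"
      by (rule Lim_transform_eventually)
  next
    fix s assume s: "(\<forall>n. 0 \<le> s n) \<and> s \<longlonglongrightarrow> t \<and> (\<forall>\<^sub>F n in sequentially. s n \<ge> pp n t)"
    then have s': "\<And>n. 0 \<le> s n" "s \<longlonglongrightarrow> t" "right_approach t s" by (auto simp: right_approach_def)
    then show "(\<lambda>n. J (s n, stop (s n) (ap n x))) \<longlonglongrightarrow> A t"
      by (intro J_ap_tendsto(1)[OF x s'(1,2)] sided_limitsD(1)[OF lim t])
  next
    fix s assume s: "(\<forall>n. 0 \<le> s n) \<and> s \<longlonglongrightarrow> t \<and> (\<forall>\<^sub>F n in sequentially. s n > pp n t)"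
    then have s': "\<And>n. 0 \<le> s n" "s \<longlonglongrightarrow> t" "\<forall>\<^sub>F n in sequentially. pp n t < s n" by blast+
    have in_pi: "pp n t \<in> set (\<pi> n)" for n
      using pp_max(1)[of t n] pp_nonpos[of t n] zero_in[of n] by (cases "0 < t") auto
    \<comment> \<open>Conversely, \<open>pp n t\<close> is a partition point strictly before
      \<open>s n\<close>, so moving back to \<open>pp n (s n)\<close> does not go below it: the
      strict inequality becomes the weak one of a right approach.\<close>
    from s'(3) have "\<forall>\<^sub>F n in sequentially. pp n t \<le> pp n (s n)"
    proof eventually_elim
      case (elim n)
      then have "0 < s n" using pp_nonneg[of n t] by simp
      then show ?case by (rule pp_max(3)[OF _ in_pi elim])
    qed
    then have "right_approach t (\<lambda>n. pp n (s n))"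
      using s' by (simp add: right_approach_def pp_nonneg pp_tendsto)
    then show "(\<lambda>n. J (s n, stop_left (s n) (ap n x))) \<longlonglongrightarrow> A t"
      by (intro J_ap_tendsto(2)[OF x s'(1,2)] sided_limitsD(1)[OF lim t])
  qed
qed

lemma J_continuous: "continuous_map (pi_topology \<pi> \<Omega>) euclideanreal J"
  by (rule left_right_cont_continuous_map[OF J_left_cont J_right_cont])

lemma isum_tendsto_J:
  assumes x: "x \<in> \<Omega>" and t: "0 \<le> t"
  shows "(\<lambda>n. isum x n t) \<longlonglongrightarrow> J (t, stop t x)"
proof -
  obtain A B where lim: "sided_limits (isum x) A B" using isum_sided_limits[OF x] by blast
  show ?thesis using sided_limits_const(1)[OF lim t] J_at(1)[OF x lim t] by simp
qed

lemma grad_integrable: "path_integrable \<pi> \<Omega> grad"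
  using F isum_tendsto_J J_continuous by (auto simp: path_integrable_def C12_def)

end

theorem proposition5p15:
  fixes \<pi> :: partitions
    and \<Omega> :: "(real \<Rightarrow> real^'m) set"
    and U :: "real \<Rightarrow> (real \<Rightarrow> real^'m) \<Rightarrow> (real^'m) set"
    and F :: "real \<times> (real \<Rightarrow> real^'m) \<Rightarrow> real"
  assumes "partition_sequence \<pi>"
    and "\<Omega> \<subseteq> QV_paths \<pi>"
    and "generic \<pi> \<Omega>"
    and "vertical_nbhds \<Omega> U"
    and "F \<in> C12 \<pi> \<Omega> U"
  shows "\<exists>J :: real \<times> (real \<Rightarrow> real^'m) \<Rightarrow> real.
    (\<forall>x\<in>\<Omega>. \<forall>t\<ge>0.
      (\<lambda>n. \<Sum>i | Suc i < length (\<pi> n) \<and> \<pi> n ! i \<le> t.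
         vert_grad F (\<pi> n ! i, stop_left (\<pi> n ! i) (approx_path \<pi> n x)) \<bullet>
           (x (\<pi> n ! Suc i) - x (\<pi> n ! i)))
      \<longlonglongrightarrow> J (t, stop t x)) \<and>
    continuous_map (pi_topology \<pi> \<Omega>) euclideanreal J \<and>
    path_integrable \<pi> \<Omega> (vert_grad F) \<and>
    (\<forall>p\<in>stopped_paths \<Omega>. J p = pathwise_integral \<pi> (vert_grad F) p)"
proof -
  interpret c12_functional \<pi> \<Omega> U F
    by unfold_locales (fact assms)+
  show ?thesis
    using isum_tendsto_J J_continuous grad_integrable
    by (intro exI[of _ "pathwise_integral \<pi> (vert_grad F)"]) (simp add: integral_sum_def)
qed

end
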